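(* Fix nonzero $h_1,h_2\in\mathbb{C}$ with $|h_1|\neq|h_2|$, fix the constellations $\mathcal{X}_1,\mathcal{X}_{2,1},\mathcal{X}_{2,2}\subset\mathbb{C}$ described in the context, and fix $\epsilon_2\in(0,1)$. Let $1\le N_1\le N_2$ and $N_0=0$. Consider user 2's channel $$Y_2[j]=h_2(X_1[j]+X_2[j])+Z_2[j],\ j=1,\ldots,N_1,\qquad Y_2[j]=h_2X_2[j]+Z_2[j],\ j=N_1+1,\ldots,N_2,$$ where $Z_2[j]$ are i.i.d. $\mathcal{CN}(0,1)$ and the interference symbols $X_1[j]$ of user 1 are i.i.d. uniform on $\mathcal{X}_1$, independent of the noise and of user 2's message, and are treated as noise by the decoder. Then, with average decoding error probability at most $\epsilon_2$, user 2 can achieve all rates $$R_2\le\sum_{i=1}^2\frac{N_i-N_{i-1}}{N_2}I(X_{2,i};Y_{2,i})-\frac{\sqrt{\sum_{i=1}^2(N_i-N_{i-1})V(X_{2,i};Y_{2,i})}}{N_2}\,Q^{-1}(\epsilon_2)+O\!\left(\frac{\log N_2}{N_2}\right).$$ That is, there exist constants $C>0$ and $n_0\ge2$ (depending on $h_2,\mathcal{X}_1,\mathcal{X}_{2,1},\mathcal{X}_{2,2},\epsilon_2$ but not on $N_1,N_2$) such that for all $N_2\ge n_0$ and $1\le N_1\le N_2$ there is an integer $M_2\ge1$ with $$\frac{\log M_2}{N_2}\ \ge\ \sum_{i=1}^2\frac{N_i-N_{i-1}}{N_2}I(X_{2,i};Y_{2,i})-\frac{\sqrt{\sum_{i=1}^2(N_i-N_{i-1})V(X_{2,i};Y_{2,i})}}{N_2}\,Q^{-1}(\epsilon_2)-C\,\frac{\log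 N_2}{N_2}$$ and a code for user 2 with $M_2$ codewords in $\mathcal{X}_{2,1}^{N_1}\times\mathcal{X}_{2,2}^{N_2-N_1}$ whose average decoding error probability is at most $\epsilon_2$. The quantities $I(X_{2,i};Y_{2,i})$ and $V(X_{2,i};Y_{2,i})$ are the mutual informations and dispersions defined in the context.
   Context: All logarithms are base 2. $\mathcal{CN}(0,1)$ is the circularly symmetric complex Gaussian law with density $\frac1\pi e^{-|z|^2}$ on $\mathbb{C}$. $Q^{-1}$ is the inverse of $Q(x)=\int_x^\infty\frac{1}{\sqrt{2\pi}}e^{-t^2/2}\,dt$. Channel. A transmitter sends to two users; user $i$'s coded symbol block has length $N_i$, $N_1\le N_2$, and user 1's block is superimposed on the first $N_1$ symbols of user 2's block. The channel coefficients $h_1,h_2$ are constant during the transmission. Constellations. For an even integer $m\ge0$, the regular (square) QAM constellation of order $m$ with minimum distance 1 is the set of $2^m$ points $a+\mathrm{i}b$ with $a,b\in\{-\frac{q-1}{2},-\frac{q-1}{2}+1,\ldots,\frac{q-1}{2}\}$, $q=2^{m/2}$ (so it has zero mean; $\{0\}$ if $m=0$). Let $\Lambda_1,\Lambda_{2,1},\Lambda_{2,2}$ be such QAMs of orders $m_1,m_{2,1},m_{2,2}$ with $m_1+m_{2,1}>0$. Let $S>0$ be the total power $P_1+P_{2,1}$ of the superimposed first $N_1$ symbols and $P_{2,2}>0$ the power of the last $N_2-N_1$ symbols, $\eta_1=\sqrt{6/(2^{m_1+m_{2,1}}-1)}$ and, if $m_{2,2}>0$, $\eta_2=\sqrt{6/(2^{m_{2,2}}-1)}$.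 The constellations after power assignment are: if $|h_1|>|h_2|$, $\mathcal{X}_1=\eta_1\sqrt{S}\,\Lambda_1$ and $\mathcal{X}_{2,1}=\eta_1\sqrt{2^{m_1}S}\,\Lambda_{2,1}$; if $|h_1|<|h_2|$, $\mathcal{X}_1=\eta_1\sqrt{2^{m_{2,1}}S}\,\Lambda_1$ and $\mathcal{X}_{2,1}=\eta_1\sqrt{S}\,\Lambda_{2,1}$; in both cases $\mathcal{X}_{2,2}=\eta_2\sqrt{P_{2,2}}\,\Lambda_{2,2}$ (equal to $\{0\}$ if $m_{2,2}=0$). Here $m_1,m_{2,1},m_{2,2},S,P_{2,2}$ are fixed, independent of $N_1,N_2$. Mutual informations and dispersions. Let $Z\sim\mathcal{CN}(0,1)$. (i) Interfered sub-block: let $X_1$ be uniform on $\mathcal{X}_1$ and $X_{2,1}$ uniform on $\mathcal{X}_{2,1}$, with $X_1,X_{2,1},Z$ independent, and $Y_{2,1}=h_2(X_1+X_{2,1})+Z$. Set $$L_1(x_{2,1},x_1,z)=\frac{\sum_{x_{2,1}'\in\mathcal{X}_{2,1}}\sum_{x_1'\in\mathcal{X}_1}e^{-|z+h_2(x_{2,1}-x_{2,1}'+x_1-x_1')|^2}}{\sum_{x_1'\in\mathcal{X}_1}e^{-|z+h_2(x_1-x_1')|^2}}.$$ Then $I(X_{2,1};Y_{2,1})=\log|\mathcal{X}_{2,1}|-\mathbb{E}[\log L_1(X_{2,1},X_1,Z)]$ and $V(X_{2,1};Y_{2,1})=\mathrm{Var}[\log L_1(X_{2,1},X_1,Z)]$.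 (ii) Interference-free sub-block: let $X_{2,2}$ be uniform on $\mathcal{X}_{2,2}$, independent of $Z$, and $Y_{2,2}=h_2X_{2,2}+Z$. Set $$L_2(x,z)=\frac{\sum_{x'\in\mathcal{X}_{2,2}}e^{-|z+h_2(x-x')|^2}}{e^{-|z|^2}}.$$ Then $I(X_{2,2};Y_{2,2})=\log|\mathcal{X}_{2,2}|-\mathbb{E}[\log L_2(X_{2,2},Z)]$ and $V(X_{2,2};Y_{2,2})=\mathrm{Var}[\log L_2(X_{2,2},Z)]$. Codes with treating interference as noise (single-user decoding). A code for user 2 with $M_2$ codewords consists of an encoder $\{1,\ldots,M_2\}\to\mathcal{X}_{2,1}^{N_1}\times\mathcal{X}_{2,2}^{N_2-N_1}$ and a decoder $\mathbb{C}^{N_2}\to\{1,\ldots,M_2\}$ acting on $(Y_2[1],\ldots,Y_2[N_2])$ only (it may depend on $h_2$ and the distribution of the interference, but not on user 1's codebook or message). Its rate is $R_2=\frac{\log M_2}{N_2}$. Its average decoding error probability is the probability that the decoder output differs from the message, over a uniformly distributed message, the i.i.d. uniform interference symbols and the noise. *)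

theory Defs
  imports "HOL-Probability.Probability"
begin

definition Q_fun :: "real \<Rightarrow> real" where
  "Q_fun x = (LINT t:{x..}|lborel. 1 / sqrt (2 * pi) * exp (- t\<^sup>2 / 2))"

text \<open>\<^const>\<open>Q_fun\<close> is a decreasing bijection onto \<open>(0, 1)\<close>; the value of \<open>Q_inv\<close> outside
  \<open>(0, 1)\<close> is irrelevant.\<close>
definition Q_inv :: "real \<Rightarrow> real" where
  "Q_inv = inv Q_fun"

text \<open>The law \<open>CN(0,1)\<close>.\<close>
definition cgauss :: "complex measure" where
  "cgauss = density lborel (\<lambda>z. ennreal (1 / pi * exp (- (cmod z)\<^sup>2)))"

abbreviation unif :: "'a set \<Rightarrow> 'a measure" where
  "unif A \<equiv> measure_pmf (pmf_of_set A)"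

subsection \<open>Constellations\<close>

definition pam :: "nat \<Rightarrow> real set" where
  "pam q = (\<lambda>k. real k - (real q - 1) / 2) ` {..<q}"

text \<open>Only meaningful for even \<open>m\<close>, where \<open>2 ^ (m div 2)\<close> is \<open>2\<^bsup>m/2\<^esup>\<close>.\<close>
definition qam :: "nat \<Rightarrow> complex set" where
  "qam m = {Complex a b | a b. a \<in> pam (2 ^ (m div 2)) \<and> b \<in> pam (2 ^ (m div 2))}"

definition scaled :: "real \<Rightarrow> complex set \<Rightarrow> complex set" where
  "scaled r A = (\<lambda>z. complex_of_real r * z) ` A"

definition eta :: "nat \<Rightarrow> real" where
  "eta m = sqrt (6 / (2 ^ m - 1))"

text \<open>In the next two definitions the second branch is the case \<open>cmod h1 < cmod h2\<close>; equality is
  excluded by hypothesis.\<close>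
definition const_1 :: "complex \<Rightarrow> complex \<Rightarrow> nat \<Rightarrow> nat \<Rightarrow> real \<Rightarrow> complex set" where
  "const_1 h1 h2 m1 m21 S =
     (if cmod h1 > cmod h2 then scaled (eta (m1 + m21) * sqrt S) (qam m1)
      else scaled (eta (m1 + m21) * sqrt (2 ^ m21 * S)) (qam m1))"

definition const_21 :: "complex \<Rightarrow> complex \<Rightarrow> nat \<Rightarrow> nat \<Rightarrow> real \<Rightarrow> complex set" where
  "const_21 h1 h2 m1 m21 S =
     (if cmod h1 > cmod h2 then scaled (eta (m1 + m21) * sqrt (2 ^ m1 * S)) (qam m21)
      else scaled (eta (m1 + m21) * sqrt S) (qam m21))"

definition const_22 :: "nat \<Rightarrow> real \<Rightarrow> complex set" where
  "const_22 m22 P22 = (if m22 = 0 then {0} else scaled (eta m22 * sqrt P22) (qam m22))"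

subsection \<open>Mutual informations and dispersions\<close>

text \<open>Below, \<open>A\<close> is the constellation of user 2 in the sub-block concerned, \<open>B\<close> is the constellation
  of the interference, and \<open>h\<close> is the channel coefficient of user 2. The lemmas
  \<open>I_int_eq\<close> and \<open>I_free_eq\<close> express the mutual informations through \<open>L_int\<close> and \<open>L_free\<close>.\<close>

text \<open>Joint law of \<open>(X\<^sub>2\<^sub>1, X\<^sub>1, Z)\<close>.\<close>
definition law_int :: "complex set \<Rightarrow> complex set \<Rightarrow> (complex \<times> complex \<times> complex) measure" where
  "law_int A B = unif A \<Otimes>\<^sub>M (unif B \<Otimes>\<^sub>M cgauss)"

text \<open>Joint law of \<open>(X\<^sub>2\<^sub>2, Z)\<close>.\<close>
definition law_free :: "complex set \<Rightarrow> (complex \<times> complex) measure" where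
  "law_free A = unif A \<Otimes>\<^sub>M cgauss"

definition L_int :: "complex set \<Rightarrow> complex set \<Rightarrow> complex \<Rightarrow> complex \<Rightarrow> complex \<Rightarrow> complex \<Rightarrow> real" where
  "L_int A B h x x1 z =
     (\<Sum>x'\<in>A. \<Sum>x1'\<in>B. exp (- (cmod (z + h * (x - x' + x1 - x1')))\<^sup>2)) /
     (\<Sum>x1'\<in>B. exp (- (cmod (z + h * (x1 - x1')))\<^sup>2))"

definition L_free :: "complex set \<Rightarrow> complex \<Rightarrow> complex \<Rightarrow> complex \<Rightarrow> real" where
  "L_free A h x z =
     (\<Sum>x'\<in>A. exp (- (cmod (z + h * (x - x')))\<^sup>2)) / exp (- (cmod z)\<^sup>2)"

definition I_int :: "complex set \<Rightarrow> complex set \<Rightarrow> complex \<Rightarrow> real" where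
  "I_int A B h = prob_space.mutual_information (law_int A B) 2 borel borel
     (\<lambda>(x, x1, z). x) (\<lambda>(x, x1, z). h * (x1 + x) + z)"

definition V_int :: "complex set \<Rightarrow> complex set \<Rightarrow> complex \<Rightarrow> real" where
  "V_int A B h = prob_space.variance (law_int A B) (\<lambda>(x, x1, z). log 2 (L_int A B h x x1 z))"

definition I_free :: "complex set \<Rightarrow> complex \<Rightarrow> real" where
  "I_free A h = prob_space.mutual_information (law_free A) 2 borel borel
     (\<lambda>(x, z). x) (\<lambda>(x, z). h * x + z)"

definition V_free :: "complex set \<Rightarrow> complex \<Rightarrow> real" where
  "V_free A h = prob_space.variance (law_free A) (\<lambda>(x, z). log 2 (L_free A h x z))"

lemma nn_integral_exp_cmod:
  assumes s: "s > 0"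
  shows "(\<integral>\<^sup>+z. ennreal (exp (- s * (cmod z)\<^sup>2)) \<partial>lborel) = ennreal (pi / s)"
proof -
  define \<sigma> where "\<sigma> = 1 / sqrt (2 * s)"
  have \<sigma>: "\<sigma> > 0" and \<sigma>2: "\<sigma>\<^sup>2 = 1 / (2 * s)"
    using s by (auto simp: \<sigma>_def power_divide)
  have gauss: "exp (- s * x\<^sup>2) = sqrt (pi / s) * normal_density 0 \<sigma> x" for x
    using s by (simp add: normal_density_def \<sigma>2 real_sqrt_divide mult.commute)
  have one: "(\<integral>\<^sup>+x. ennreal (exp (- s * x\<^sup>2)) \<partial>lborel) = ennreal (sqrt (pi / s))"
  proof -
    have "(\<integral>\<^sup>+x. ennreal (normal_density 0 \<sigma> x) \<partial>lborel) = ennreal 1"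
      using \<sigma> by (subst nn_integral_eq_integral) auto
    moreover have "(\<integral>\<^sup>+x. ennreal (exp (- s * x\<^sup>2)) \<partial>lborel)
        = ennreal (sqrt (pi / s)) * (\<integral>\<^sup>+x. ennreal (normal_density 0 \<sigma> x) \<partial>lborel)"
      unfolding gauss using s by (subst ennreal_mult) (auto simp: nn_integral_cmult)
    ultimately show ?thesis by simp
  qed
  have "(\<integral>\<^sup>+z. ennreal (exp (- s * (cmod z)\<^sup>2)) \<partial>lborel)
      = (\<integral>\<^sup>+z. (\<Prod>b\<in>Basis. ennreal (exp (- s * (z \<bullet> b)\<^sup>2))) \<partial>(lborel :: complex measure))"
  proof (rule nn_integral_cong)
    fix z :: complex
    have "(\<Prod>b\<in>Basis. ennreal (exp (- s * (z \<bullet> b)\<^sup>2)))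
        = ennreal (exp (- s * (Re z)\<^sup>2)) * ennreal (exp (- s * (Im z)\<^sup>2))"
      by (simp add: Basis_complex_def complex_eq_iff)
    also have "\<dots> = ennreal (exp (- s * (cmod z)\<^sup>2))"
      by (simp add: ennreal_mult[symmetric] exp_add[symmetric] cmod_power2 algebra_simps)
    finally show "ennreal (exp (- s * (cmod z)\<^sup>2)) = (\<Prod>b\<in>Basis. ennreal (exp (- s * (z \<bullet> b)\<^sup>2)))"
      by simp
  qed
  also have "\<dots> = (\<Prod>b\<in>(Basis::complex set). \<integral>\<^sup>+x. ennreal (exp (- s * x\<^sup>2)) \<partial>lborel)"
    by (rule nn_integral_lborel_prod) auto
  also have "\<dots> = ennreal (sqrt (pi / s)) ^ 2"
    unfolding one by simp
  also have "\<dots> = ennreal (pi / s)"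
    using s by (simp add: ennreal_power)
  finally show ?thesis .
qed

lemma sets_cgauss [simp, measurable_cong]: "sets cgauss = sets borel"
  by (simp add: cgauss_def)

lemma prob_space_cgauss: "prob_space cgauss"
proof
  have "emeasure cgauss (space cgauss)
      = ennreal (1 / pi) * (\<integral>\<^sup>+z. ennreal (exp (- 1 * (cmod z)\<^sup>2)) \<partial>lborel)"
    by (simp add: cgauss_def emeasure_density ennreal_mult nn_integral_cmult del: times_divide_eq_left)
  also have "\<dots> = 1"
    by (subst nn_integral_exp_cmod) (auto simp: ennreal_mult[symmetric])
  finally show "emeasure cgauss (space cgauss) = 1" .
qed

lemma integrable_cgauss_norm2: "integrable cgauss (\<lambda>z. (cmod z)\<^sup>2)"
proof -
  have int: "integrable lborel (\<lambda>z::complex. 2 / pi * exp (- (1/2) * (cmod z)\<^sup>2))"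
    using nn_integral_exp_cmod[of "1/2"]
    by (intro integrable_mult_right integrableI_nonneg) auto
  have "integrable lborel (\<lambda>z::complex. 1 / pi * exp (- (cmod z)\<^sup>2) * (cmod z)\<^sup>2)"
  proof (rule Bochner_Integration.integrable_bound[OF int])
    have "exp (- t) * t \<le> 2 * exp (- (1/2) * t)" for t :: real
    proof -
      have "t \<le> 2 * exp (t / 2)"
        using exp_ge_add_one_self[of "t/2"] exp_gt_zero[of "t/2"] by linarith
      then have "exp (- t) * t \<le> exp (- t) * (2 * exp (t / 2))"
        by (intro mult_left_mono) auto
      also have "\<dots> = 2 * exp (- t + t / 2)"
        by (simp only: exp_add mult_ac)
      finally show ?thesis by (simp add: field_simps)
    qed
    then have "norm (1 / pi * exp (- (cmod z)\<^sup>2) * (cmod z)\<^sup>2)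
        \<le> norm (2 / pi * exp (- (1/2) * (cmod z)\<^sup>2))" for z :: complex
      by (simp add: divide_right_mono abs_mult)
    then show "AE z::complex in lborel. norm (1 / pi * exp (- (cmod z)\<^sup>2) * (cmod z)\<^sup>2)
        \<le> norm (2 / pi * exp (- (1/2) * (cmod z)\<^sup>2))"
      by simp
  qed auto
  then show ?thesis
    unfolding cgauss_def by (subst integrable_density) (auto simp: mult.assoc)
qed

lemma measurable_id_count_space_borel [measurable]:
  "(\<lambda>x. x) \<in> (count_space UNIV :: complex measure) \<rightarrow>\<^sub>M borel"
  by simp

lemma lborel_shift:
  fixes f :: "complex \<Rightarrow> ennreal"
  assumes [measurable]: "f \<in> borel_measurable borel"
  shows "(\<integral>\<^sup>+y. f (c + y) \<partial>lborel) = (\<integral>\<^sup>+y. f y \<partial>lborel)"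
proof -
  have "(\<integral>\<^sup>+y. f y \<partial>lborel) = (\<integral>\<^sup>+y. f y \<partial>distr lborel borel ((+) c))"
    by (simp add: lborel_distr_plus)
  also have "\<dots> = (\<integral>\<^sup>+y. f (c + y) \<partial>lborel)"
    by (subst nn_integral_distr) auto
  finally show ?thesis by simp
qed

lemma distr_pair_snd:
  assumes "prob_space M1" "prob_space M2"
  shows "distr (M1 \<Otimes>\<^sub>M M2) M2 snd = M2"
proof -
  interpret M1: prob_space M1 by fact
  interpret M2: prob_space M2 by fact
  show ?thesis
  proof (rule measure_eqI)
    fix E assume "E \<in> sets (distr (M1 \<Otimes>\<^sub>M M2) M2 snd)"
    then have E: "E \<in> sets M2" by simp
    have "snd -` E \<inter> space (M1 \<Otimes>\<^sub>M M2) = space M1 \<times> E"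
      using sets.sets_into_space[OF E] by (auto simp: space_pair_measure)
    then show "emeasure (distr (M1 \<Otimes>\<^sub>M M2) M2 snd) E = emeasure M2 E"
      using E by (simp add: emeasure_distr M2.emeasure_pair_measure_Times M1.emeasure_space_1)
  qed simp
qed

lemma mutual_information_additive:
  fixes A :: "complex set" and N :: "'b measure" and v :: "'b \<Rightarrow> complex" and g :: "complex \<Rightarrow> real"
  assumes A: "finite A" "A \<noteq> {}" and N: "prob_space N"
    and v [measurable]: "v \<in> N \<rightarrow>\<^sub>M borel" and g [measurable]: "g \<in> borel_measurable borel"
    and gpos: "\<And>y. g y > 0" and law: "distr N borel v = density lborel g"
  shows "prob_space.mutual_information (unif A \<Otimes>\<^sub>M N) 2 borel borel (\<lambda>(x, n). x) (\<lambda>(x, n). h * x + v n)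
    = (\<integral>(x, n). log 2 (real (card A) * g (v n) / (\<Sum>a\<in>A. g (v n + h * (x - a)))) \<partial>(unif A \<Otimes>\<^sub>M N))"
proof -
  interpret N: prob_space N by fact
  interpret U: prob_space "unif A" by (rule prob_space_measure_pmf)
  interpret UN: pair_prob_space "unif A" N ..
  define M where "M = unif A \<Otimes>\<^sub>M N"
  interpret M: prob_space M unfolding M_def by (rule UN.prob_space_axioms)
  define X where "X = (\<lambda>(x::complex, n::'b). x)"
  define Y where "Y = (\<lambda>(x, n). h * x + v n)"
  have fst_meas [measurable]: "fst \<in> M \<rightarrow>\<^sub>M borel"
    unfolding M_def by (rule measurable_compose[OF measurable_fst]) simp
  have X [measurable]: "X \<in> M \<rightarrow>\<^sub>M borel"
    using fst_meas by (simp add: X_def case_prod_beta')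
  have "(\<lambda>w. v (snd w)) \<in> M \<rightarrow>\<^sub>M borel"
    unfolding M_def by measurable
  then have Y [measurable]: "Y \<in> M \<rightarrow>\<^sub>M borel"
    unfolding Y_def case_prod_beta' by measurable
  define p where "p = (\<lambda>y. (\<Sum>a\<in>A. g (y - h * a)) / real (card A))"
  have cardA: "card A > 0" using A by (simp add: card_gt_0_iff)
  have ppos: "p y > 0" for y
    using A cardA gpos unfolding p_def by (intro divide_pos_pos sum_pos) auto
  have p [measurable]: "p \<in> borel_measurable borel" unfolding p_def by measurable
  define f where "f = (\<lambda>(x, y). g (y - h * x) / p y)"
  have f [measurable]: "f \<in> borel_measurable (borel \<Otimes>\<^sub>M borel)"
    unfolding f_def by measurable
  have fpos: "f w > 0" for w using gpos ppos by (auto simp: f_def split: prod.splits)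
  have key: "(\<integral>\<^sup>+w. \<phi> (X w, Y w) \<partial>M)
      = (\<integral>\<^sup>+x. \<integral>\<^sup>+y. ennreal (g (y - h * x)) * \<phi> (x, y) \<partial>lborel \<partial>unif A)"
    if [measurable]: "\<phi> \<in> borel_measurable (borel \<Otimes>\<^sub>M borel)" for \<phi> :: "complex \<times> complex \<Rightarrow> ennreal"
  proof -
    have "(\<lambda>w. \<phi> (X w, Y w)) \<in> borel_measurable M" by measurable
    then have "(\<integral>\<^sup>+w. \<phi> (X w, Y w) \<partial>M) = (\<integral>\<^sup>+x. \<integral>\<^sup>+n. \<phi> (X (x, n), Y (x, n)) \<partial>N \<partial>unif A)"
      unfolding M_def by (rule N.nn_integral_fst[symmetric])
    also have "\<dots> = (\<integral>\<^sup>+x. \<integral>\<^sup>+y. ennreal (g (y - h * x)) * \<phi> (x, y) \<partial>lborel \<partial>unif A)"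
    proof (rule nn_integral_cong)
      fix x :: complex
      have "(\<integral>\<^sup>+n. \<phi> (X (x, n), Y (x, n)) \<partial>N) = (\<integral>\<^sup>+y. \<phi> (x, h * x + y) \<partial>distr N borel v)"
        by (subst nn_integral_distr) (auto simp: X_def Y_def)
      also have "\<dots> = (\<integral>\<^sup>+y. ennreal (g y) * \<phi> (x, h * x + y) \<partial>lborel)"
        unfolding law by (subst nn_integral_density) auto
      also have "\<dots> = (\<integral>\<^sup>+y. ennreal (g (y - h * x)) * \<phi> (x, y) \<partial>lborel)"
        using lborel_shift[of "\<lambda>y. ennreal (g (y - h * x)) * \<phi> (x, y)" "h * x"] by simp
      finally show "(\<integral>\<^sup>+n. \<phi> (X (x, n), Y (x, n)) \<partial>N)
        = (\<integral>\<^sup>+y. ennreal (g (y - h * x)) * \<phi> (x, y) \<partial>lborel)" .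
    qed
    finally show ?thesis .
  qed
  have PY: "distr M borel Y = density lborel p"
  proof (rule measure_eqI)
    fix E assume "E \<in> sets (distr M borel Y)"
    then have E [measurable]: "E \<in> sets borel" by simp
    have "emeasure (distr M borel Y) E = (\<integral>\<^sup>+y. indicator E y \<partial>distr M borel Y)"
      by simp
    also have "\<dots> = (\<integral>\<^sup>+w. indicator E (snd (X w, Y w)) \<partial>M)"
      by (subst nn_integral_distr) auto
    also have "\<dots> = (\<integral>\<^sup>+x. \<integral>\<^sup>+y. ennreal (g (y - h * x)) * indicator E y \<partial>lborel \<partial>unif A)"
      by (subst key[of "\<lambda>w. indicator E (snd w)"]) auto
    also have "\<dots> = (\<Sum>x\<in>A. \<integral>\<^sup>+y. ennreal (g (y - h * x)) * indicator E y \<partial>lborel) / card A"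
      using A by (simp add: nn_integral_pmf_of_set ennreal_of_nat_eq_real_of_nat)
    also have "\<dots> = (\<integral>\<^sup>+y. (\<Sum>x\<in>A. ennreal (g (y - h * x)) * indicator E y) / card A \<partial>lborel)"
      by (subst nn_integral_divide) (auto simp: nn_integral_sum)
    also have "\<dots> = (\<integral>\<^sup>+y. ennreal (p y) * indicator E y \<partial>lborel)"
    proof (rule nn_integral_cong)
      fix y
      have "(\<Sum>x\<in>A. ennreal (g (y - h * x))) / of_nat (card A) = ennreal (p y)"
        using cardA gpos unfolding p_def
        by (subst sum_ennreal) (auto simp: ennreal_of_nat_eq_real_of_nat less_imp_le sum_nonneg divide_ennreal)
      then show "(\<Sum>x\<in>A. ennreal (g (y - h * x)) * indicator E y) / of_nat (card A)
          = ennreal (p y) * indicator E y"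
        by (simp split: split_indicator)
    qed
    also have "\<dots> = emeasure (density lborel p) E"
      by (subst emeasure_density) auto
    finally show "emeasure (distr M borel Y) E = emeasure (density lborel p) E" .
  qed simp
  define P where "P = distr M borel X \<Otimes>\<^sub>M distr M borel Y"
  interpret PX: prob_space "distr M borel X" by (rule M.prob_space_distr) simp
  interpret PYp: prob_space "distr M borel Y" by (rule M.prob_space_distr) simp
  interpret P: pair_prob_space "distr M borel X" "distr M borel Y" ..
  have setsP [measurable_cong]: "sets P = sets (borel \<Otimes>\<^sub>M borel)"
    unfolding P_def by (intro sets_pair_measure_cong) auto
  have PX: "distr M borel X = distr (unif A) borel (\<lambda>x. x)"
  proof -
    have "distr M borel X = distr (distr M (unif A) fst) borel (\<lambda>x. x)"
      by (subst distr_distr) (auto simp: M_def X_def comp_def case_prod_beta')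
    also have "distr M (unif A) fst = unif A"
      unfolding M_def by (rule N.distr_pair_fst)
    finally show ?thesis .
  qed
  have XY: "(\<lambda>w. (X w, Y w)) \<in> M \<rightarrow>\<^sub>M borel \<Otimes>\<^sub>M borel" by measurable
  have joint: "distr M (borel \<Otimes>\<^sub>M borel) (\<lambda>w. (X w, Y w)) = density P f"
  proof (rule measure_eqI)
    show "sets (distr M (borel \<Otimes>\<^sub>M borel) (\<lambda>w. (X w, Y w))) = sets (density P (\<lambda>w. ennreal (f w)))"
      by (simp add: setsP)
    fix E assume "E \<in> sets (distr M (borel \<Otimes>\<^sub>M borel) (\<lambda>w. (X w, Y w)))"
    then have E [measurable]: "E \<in> sets (borel \<Otimes>\<^sub>M borel)" by simp
    have EP: "E \<in> sets P" using E setsP by simp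
    have fE: "(\<lambda>w. ennreal (f w) * indicator E w) \<in> borel_measurable (borel \<Otimes>\<^sub>M borel)"
      by measurable
    have "emeasure (density P f) E = (\<integral>\<^sup>+w. ennreal (f w) * indicator E w \<partial>P)"
      using EP by (subst emeasure_density) auto
    also have "\<dots> = (\<integral>\<^sup>+x. \<integral>\<^sup>+y. ennreal (f (x, y)) * indicator E (x, y) \<partial>distr M borel Y \<partial>distr M borel X)"
      unfolding P_def using fE setsP
      by (subst PYp.nn_integral_fst[symmetric]) (auto simp: P_def cong: measurable_cong_sets)
    also have "\<dots> = (\<integral>\<^sup>+x. \<integral>\<^sup>+y. ennreal (f (x, y)) * indicator E (x, y) \<partial>density lborel p \<partial>distr (unif A) borel (\<lambda>x. x))"
      unfolding PX PY ..
    also have "\<dots> = (\<integral>\<^sup>+x. \<integral>\<^sup>+y. ennreal (f (x, y)) * indicator E (x, y) \<partial>density lborel p \<partial>unif A)"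
    proof -
      interpret L: sigma_finite_measure "density lborel p"
        unfolding PY[symmetric] ..
      have "(\<lambda>x. \<integral>\<^sup>+y. ennreal (f (x, y)) * indicator E (x, y) \<partial>density lborel p) \<in> borel_measurable borel"
        by (rule L.borel_measurable_nn_integral) (use fE in \<open>auto simp: case_prod_beta' cong: measurable_cong_sets\<close>)
      then show ?thesis by (subst nn_integral_distr) auto
    qed
    also have "\<dots> = (\<integral>\<^sup>+x. \<integral>\<^sup>+y. ennreal (g (y - h * x)) * indicator E (x, y) \<partial>lborel \<partial>unif A)"
    proof (intro nn_integral_cong)
      fix x
      have "(\<integral>\<^sup>+y. ennreal (f (x, y)) * indicator E (x, y) \<partial>density lborel p)
          = (\<integral>\<^sup>+y. ennreal (p y) * (ennreal (f (x, y)) * indicator E (x, y)) \<partial>lborel)"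
        by (subst nn_integral_density) auto
      also have "\<dots> = (\<integral>\<^sup>+y. ennreal (g (y - h * x)) * indicator E (x, y) \<partial>lborel)"
      proof (rule nn_integral_cong)
        fix y
        have "ennreal (p y) * ennreal (f (x, y)) = ennreal (g (y - h * x))"
          using ppos[of y] gpos fpos[of "(x, y)"]
          by (subst ennreal_mult[symmetric]) (auto simp: f_def less_imp_le)
        then show "ennreal (p y) * (ennreal (f (x, y)) * indicator E (x, y))
            = ennreal (g (y - h * x)) * indicator E (x, y)"
          by (simp add: mult.assoc[symmetric])
      qed
      finally show "(\<integral>\<^sup>+y. ennreal (f (x, y)) * indicator E (x, y) \<partial>density lborel p)
          = (\<integral>\<^sup>+y. ennreal (g (y - h * x)) * indicator E (x, y) \<partial>lborel)" .
    qed
    also have "\<dots> = (\<integral>\<^sup>+w. indicator E (X w, Y w) \<partial>M)"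
      by (rule key[symmetric]) measurable
    also have "\<dots> = (\<integral>\<^sup>+w. indicator E w \<partial>distr M (borel \<Otimes>\<^sub>M borel) (\<lambda>w. (X w, Y w)))"
      by (subst nn_integral_distr) auto
    also have "\<dots> = emeasure (distr M (borel \<Otimes>\<^sub>M borel) (\<lambda>w. (X w, Y w))) E"
      by simp
    finally show "emeasure (distr M (borel \<Otimes>\<^sub>M borel) (\<lambda>w. (X w, Y w))) E = emeasure (density P f) E"
      by simp
  qed
  have fP [measurable]: "f \<in> borel_measurable P"
    using f setsP by (simp cong: measurable_cong_sets)
  have sfP: "sigma_finite_measure P"
    unfolding P_def by (rule P.sigma_finite_measure_axioms)
  have "M.mutual_information 2 borel borel X Y = KL_divergence 2 P (density P f)"
    unfolding M.mutual_information_def P_def[symmetric] joint ..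
  also have "\<dots> = (\<integral>w. f w * log 2 (f w) \<partial>P)"
    using fpos by (intro sigma_finite_measure.KL_density[OF sfP]) (auto simp: less_imp_le)
  also have "\<dots> = (\<integral>w. log 2 (f w) \<partial>density P f)"
    using fpos by (subst integral_density) (auto simp: less_imp_le)
  also have "\<dots> = (\<integral>w. log 2 (f (X w, Y w)) \<partial>M)"
    unfolding joint[symmetric] by (subst integral_distr) auto
  also have "\<dots> = (\<integral>(x, n). log 2 (real (card A) * g (v n) / (\<Sum>a\<in>A. g (v n + h * (x - a)))) \<partial>M)"
    by (rule Bochner_Integration.integral_cong)
      (auto simp: f_def X_def Y_def p_def algebra_simps)
  finally show ?thesis unfolding M_def X_def Y_def .
qed

lemma sum_log_bounds:
  fixes a t :: real
  assumes "1 \<le> a" "a \<le> K * exp t" "K \<ge> 1"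
  shows "\<bar>log 2 a\<bar> \<le> log 2 K + t / ln 2"
proof -
  have "log 2 a \<le> log 2 (K * exp t)" using assms by (subst log_le_cancel_iff) auto
  also have "\<dots> = log 2 K + t / ln 2"
    using assms by (simp add: ln_mult log_def add_divide_distrib)
  finally show ?thesis using assms by simp
qed

lemma I_free_eq:
  assumes A: "finite A" "A \<noteq> {}"
  shows "I_free A h = log 2 (real (card A)) - prob_space.expectation (law_free A) (\<lambda>(x, z). log 2 (L_free A h x z))"
proof -
  interpret N: prob_space cgauss by (rule prob_space_cgauss)
  interpret U: prob_space "unif A" by (rule prob_space_measure_pmf)
  interpret UN: pair_prob_space "unif A" cgauss ..
  have M: "law_free A = unif A \<Otimes>\<^sub>M cgauss" by (simp add: law_free_def)
  interpret M: prob_space "law_free A" unfolding M by (rule UN.prob_space_axioms)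
  define g where "g = (\<lambda>z. 1 / pi * exp (- (cmod z)\<^sup>2))"
  have g [measurable]: "g \<in> borel_measurable borel" unfolding g_def by measurable
  have cardA: "card A > 0" using A by (simp add: card_gt_0_iff)
  have Lge: "1 \<le> L_free A h x z" and Lle: "L_free A h x z \<le> real (card A) * exp ((cmod z)\<^sup>2)"
    if x: "x \<in> A" for x z
  proof -
    have "exp (- (cmod (z + h * (x - x)))\<^sup>2) \<le> (\<Sum>x'\<in>A. exp (- (cmod (z + h * (x - x')))\<^sup>2))"
      using A x by (intro member_le_sum) auto
    then show "1 \<le> L_free A h x z" by (simp add: L_free_def)
    have "(\<Sum>x'\<in>A. exp (- (cmod (z + h * (x - x')))\<^sup>2)) \<le> (\<Sum>x'\<in>A. 1)"
      by (intro sum_mono) auto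
    then show "L_free A h x z \<le> real (card A) * exp ((cmod z)\<^sup>2)"
      by (simp add: L_free_def exp_minus field_simps)
  qed
  have fst_meas [measurable]: "fst \<in> law_free A \<rightarrow>\<^sub>M borel"
    unfolding M by (rule measurable_compose[OF measurable_fst]) simp
  have snd_meas [measurable]: "snd \<in> law_free A \<rightarrow>\<^sub>M borel"
    unfolding M by measurable
  have Lm: "(\<lambda>(x, z). log 2 (L_free A h x z)) \<in> borel_measurable (law_free A)"
    unfolding L_free_def case_prod_beta' by measurable
  have inA: "AE w in law_free A. fst w \<in> A"
    proof -
    have "AE x in distr (law_free A) (unif A) fst. x \<in> A"
      unfolding M N.distr_pair_fst using A by (auto simp: AE_measure_pmf_iff)
    then show ?thesis by (subst (asm) AE_distr_iff) (auto simp: M)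
  qed
  have intb: "integrable (law_free A) (\<lambda>w. log 2 (real (card A)) + (cmod (snd w))\<^sup>2 / ln 2)"
  proof -
    have "integrable (distr (law_free A) cgauss snd) (\<lambda>z. (cmod z)\<^sup>2)"
      unfolding M distr_pair_snd[OF prob_space_measure_pmf N.prob_space_axioms] by (rule integrable_cgauss_norm2)
    moreover have "snd \<in> law_free A \<rightarrow>\<^sub>M cgauss" unfolding M by simp
    ultimately have "integrable (law_free A) (\<lambda>w. (cmod (snd w))\<^sup>2)"
      by (rule integrable_distr[rotated])
    then show ?thesis by simp
  qed
  have intL: "integrable (law_free A) (\<lambda>(x, z). log 2 (L_free A h x z))"
  proof (rule Bochner_Integration.integrable_bound[OF intb Lm])
    show "AE w in law_free A. norm (case w of (x, z) \<Rightarrow> log 2 (L_free A h x z))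
        \<le> norm (log 2 (real (card A)) + (cmod (snd w))\<^sup>2 / ln 2)"
      using inA
    proof eventually_elim
      case (elim w)
      then have "\<bar>log 2 (L_free A h (fst w) (snd w))\<bar> \<le> log 2 (real (card A)) + (cmod (snd w))\<^sup>2 / ln 2"
        using cardA Lge Lle by (intro sum_log_bounds) auto
      then show ?case by (auto simp: case_prod_beta')
    qed
  qed
  have "I_free A h = (\<integral>(x, z). log 2 (real (card A) * g z / (\<Sum>a\<in>A. g (z + h * (x - a)))) \<partial>law_free A)"
    unfolding I_free_def M
    by (rule mutual_information_additive[OF A N.prob_space_axioms])
      (auto simp: g_def cgauss_def distr_id2)
  also have "\<dots> = (\<integral>w. log 2 (real (card A)) - (case w of (x, z) \<Rightarrow> log 2 (L_free A h x z)) \<partial>law_free A)"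
  proof (rule integral_cong_AE)
    show "AE w in law_free A. (case w of (x, z) \<Rightarrow> log 2 (real (card A) * g z / (\<Sum>a\<in>A. g (z + h * (x - a)))))
        = log 2 (real (card A)) - (case w of (x, z) \<Rightarrow> log 2 (L_free A h x z))"
      using inA
    proof eventually_elim
      case (elim w)
      obtain x z where w: "w = (x, z)" by force
      have "real (card A) * g z / (\<Sum>a\<in>A. g (z + h * (x - a))) = real (card A) / L_free A h x z"
        by (simp add: g_def L_free_def sum_distrib_left[symmetric] sum_divide_distrib[symmetric])
      moreover have "L_free A h x z > 0" using Lge[of x z] elim w by simp
      moreover have "log 2 (real (card A) / L_free A h x z) = log 2 (real (card A)) - log 2 (L_free A h x z)"
        using calculation cardA by (simp add: log_divide)
      ultimately show ?case using w by simp
    qed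
  qed (use Lm in \<open>auto simp: case_prod_beta'\<close>)
  also have "\<dots> = log 2 (real (card A)) - M.expectation (\<lambda>(x, z). log 2 (L_free A h x z))"
    using intL by (subst Bochner_Integration.integral_diff) (auto simp: M.prob_space)
  finally show ?thesis .
qed

lemma I_int_eq:
  assumes A: "finite A" "A \<noteq> {}" and B: "finite B" "B \<noteq> {}"
  shows "I_int A B h = log 2 (real (card A)) - prob_space.expectation (law_int A B) (\<lambda>(x, x1, z). log 2 (L_int A B h x x1 z))"
proof -
  interpret G: prob_space cgauss by (rule prob_space_cgauss)
  interpret UB: prob_space "unif B" by (rule prob_space_measure_pmf)
  interpret BG: pair_prob_space "unif B" cgauss ..
  define N where "N = unif B \<Otimes>\<^sub>M cgauss"
  interpret N: prob_space N unfolding N_def by (rule BG.prob_space_axioms)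
  interpret U: prob_space "unif A" by (rule prob_space_measure_pmf)
  interpret UN: pair_prob_space "unif A" N ..
  have M: "law_int A B = unif A \<Otimes>\<^sub>M N" by (simp add: law_int_def N_def)
  interpret M: prob_space "law_int A B" unfolding M by (rule UN.prob_space_axioms)
  have cardA: "card A > 0" and cardB: "card B > 0" using A B by (auto simp: card_gt_0_iff)
  define e where "e = (\<lambda>z. exp (- (cmod z)\<^sup>2))"
  have e [measurable]: "e \<in> borel_measurable borel" unfolding e_def by measurable
  have epos: "e z > 0" and ele: "e z \<le> 1" for z by (auto simp: e_def)
  define g where "g = (\<lambda>y. (\<Sum>b\<in>B. 1 / pi * e (y - h * b)) / real (card B))"
  have g [measurable]: "g \<in> borel_measurable borel" unfolding g_def by measurable
  have gpos: "g y > 0" for y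
    unfolding g_def using B cardB epos by (intro divide_pos_pos sum_pos) auto
  define v where "v = (\<lambda>(x1, z). h * x1 + z)"
  have fstN [measurable]: "fst \<in> N \<rightarrow>\<^sub>M borel"
    unfolding N_def by (rule measurable_compose[OF measurable_fst]) simp
  have sndN [measurable]: "snd \<in> N \<rightarrow>\<^sub>M borel"
    unfolding N_def by measurable
  have v [measurable]: "v \<in> N \<rightarrow>\<^sub>M borel"
    unfolding v_def case_prod_beta' by measurable
  have law: "distr N borel v = density lborel g"
  proof (rule measure_eqI)
    fix E assume "E \<in> sets (distr N borel v)"
    then have E [measurable]: "E \<in> sets borel" by simp
    have "emeasure (distr N borel v) E = (\<integral>\<^sup>+y. indicator E y \<partial>distr N borel v)"
      by simp
    also have "\<dots> = (\<integral>\<^sup>+w. indicator E (v w) \<partial>N)"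
      by (subst nn_integral_distr) auto
    also have "\<dots> = (\<integral>\<^sup>+x. \<integral>\<^sup>+z. indicator E (v (x, z)) \<partial>cgauss \<partial>unif B)"
    proof -
      have "(\<lambda>w. indicator E (v w) :: ennreal) \<in> borel_measurable N" by measurable
      then show ?thesis unfolding N_def by (rule G.nn_integral_fst[symmetric])
    qed
    also have "\<dots> = (\<integral>\<^sup>+x. \<integral>\<^sup>+y. ennreal (1 / pi * e (y - h * x)) * indicator E y \<partial>lborel \<partial>unif B)"
    proof (rule nn_integral_cong)
      fix x
      have "(\<integral>\<^sup>+z. indicator E (v (x, z)) \<partial>cgauss)
          = (\<integral>\<^sup>+z. ennreal (1 / pi * e z) * indicator E (h * x + z) \<partial>lborel)"
        unfolding cgauss_def v_def e_def by (subst nn_integral_density) auto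
      also have "\<dots> = (\<integral>\<^sup>+y. ennreal (1 / pi * e (y - h * x)) * indicator E y \<partial>lborel)"
        using lborel_shift[of "\<lambda>y. ennreal (1 / pi * e (y - h * x)) * indicator E y" "h * x"] by simp
      finally show "(\<integral>\<^sup>+z. indicator E (v (x, z)) \<partial>cgauss)
          = (\<integral>\<^sup>+y. ennreal (1 / pi * e (y - h * x)) * indicator E y \<partial>lborel)" .
    qed
    also have "\<dots> = (\<Sum>x\<in>B. \<integral>\<^sup>+y. ennreal (1 / pi * e (y - h * x)) * indicator E y \<partial>lborel) / card B"
      using B by (simp add: nn_integral_pmf_of_set ennreal_of_nat_eq_real_of_nat)
    also have "\<dots> = (\<integral>\<^sup>+y. (\<Sum>x\<in>B. ennreal (1 / pi * e (y - h * x)) * indicator E y) / card B \<partial>lborel)"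
      by (subst nn_integral_divide) (auto simp: nn_integral_sum)
    also have "\<dots> = (\<integral>\<^sup>+y. ennreal (g y) * indicator E y \<partial>lborel)"
    proof (rule nn_integral_cong)
      fix y
      have "(\<Sum>x\<in>B. ennreal (1 / pi * e (y - h * x))) / of_nat (card B) = ennreal (g y)"
        using cardB epos unfolding g_def
        by (subst sum_ennreal) (auto simp: ennreal_of_nat_eq_real_of_nat less_imp_le sum_nonneg divide_ennreal)
      then show "(\<Sum>x\<in>B. ennreal (1 / pi * e (y - h * x)) * indicator E y) / of_nat (card B)
          = ennreal (g y) * indicator E y"
        by (simp split: split_indicator)
    qed
    also have "\<dots> = emeasure (density lborel g) E"
      by (subst emeasure_density) auto
    finally show "emeasure (distr N borel v) E = emeasure (density lborel g) E" .
  qed simp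
  have L_alt: "L_int A B h x x1 z
      = (\<Sum>x'\<in>A. \<Sum>x1'\<in>B. e (z + h * (x - x' + x1 - x1'))) / (\<Sum>x1'\<in>B. e (z + h * (x1 - x1')))"
    for x x1 z by (simp add: L_int_def e_def)
  have den: "(\<Sum>x1'\<in>B. e (z + h * (x1 - x1'))) > 0" for x1 z
    using B epos by (intro sum_pos) auto
  have Lge: "1 \<le> L_int A B h x x1 z"
    and Lle: "L_int A B h x x1 z \<le> real (card A * card B) * exp ((cmod z)\<^sup>2)"
    if x: "x \<in> A" and x1: "x1 \<in> B" for x x1 z
  proof -
    have "(\<Sum>x1'\<in>B. e (z + h * (x - x + x1 - x1'))) \<le> (\<Sum>x'\<in>A. \<Sum>x1'\<in>B. e (z + h * (x - x' + x1 - x1')))"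
    proof (rule member_le_sum[OF x])
      show "0 \<le> (\<Sum>x1'\<in>B. e (z + h * (x - x' + x1 - x1')))" for x'
        using epos by (meson less_imp_le sum_nonneg)
    qed (rule A(1))
    then show "1 \<le> L_int A B h x x1 z" unfolding L_alt using den[of z x1] by simp
    have "e (z + h * (x1 - x1)) \<le> (\<Sum>x1'\<in>B. e (z + h * (x1 - x1')))"
      using B(1) epos by (intro member_le_sum[OF x1]) (meson less_imp_le)+
    then have d: "e z \<le> (\<Sum>x1'\<in>B. e (z + h * (x1 - x1')))" by simp
    have n: "(\<Sum>x'\<in>A. \<Sum>x1'\<in>B. e (z + h * (x - x' + x1 - x1'))) \<le> (\<Sum>x'\<in>A. \<Sum>x1'\<in>B. 1)"
      by (intro sum_mono ele)
    have "L_int A B h x x1 z \<le> real (card A * card B) / e z"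
      unfolding L_alt using d n epos[of z] by (intro frac_le) auto
    then show "L_int A B h x x1 z \<le> real (card A * card B) * exp ((cmod z)\<^sup>2)"
      by (simp add: e_def exp_minus field_simps)
  qed
  have fst_meas [measurable]: "fst \<in> law_int A B \<rightarrow>\<^sub>M borel"
    unfolding M by (rule measurable_compose[OF measurable_fst]) simp
  have snd_meas: "snd \<in> law_int A B \<rightarrow>\<^sub>M N"
    unfolding M by measurable
  have [measurable]: "(\<lambda>w. fst (snd w)) \<in> law_int A B \<rightarrow>\<^sub>M borel" "(\<lambda>w. snd (snd w)) \<in> law_int A B \<rightarrow>\<^sub>M borel"
    using measurable_compose[OF snd_meas fstN] measurable_compose[OF snd_meas sndN] by auto
  have vm [measurable]: "(\<lambda>w. v (snd w)) \<in> law_int A B \<rightarrow>\<^sub>M borel"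
    using measurable_compose[OF snd_meas v] .
  have Lm: "(\<lambda>(x, x1, z). log 2 (L_int A B h x x1 z)) \<in> borel_measurable (law_int A B)"
    unfolding L_int_def case_prod_beta' by measurable
  have inA: "AE w in law_int A B. fst w \<in> A"
  proof -
    have "AE x in distr (law_int A B) (unif A) fst. x \<in> A"
      unfolding M N.distr_pair_fst using A by (auto simp: AE_measure_pmf_iff)
    then show ?thesis by (subst (asm) AE_distr_iff) (auto simp: M)
  qed
  have inB: "AE w in law_int A B. fst (snd w) \<in> B"
  proof -
    have "AE x in distr N (unif B) fst. x \<in> B"
      unfolding N_def G.distr_pair_fst using B by (auto simp: AE_measure_pmf_iff)
    then have "AE w in N. fst w \<in> B"
      by (subst (asm) AE_distr_iff) (auto simp: N_def)
    then have "AE w in distr (law_int A B) N snd. fst w \<in> B"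
      unfolding M distr_pair_snd[OF prob_space_measure_pmf N.prob_space_axioms] .
    then show ?thesis by (rule AE_distrD[OF snd_meas])
  qed
  have intb: "integrable (law_int A B) (\<lambda>w. log 2 (real (card A * card B)) + (cmod (snd (snd w)))\<^sup>2 / ln 2)"
  proof -
    have "integrable (distr N cgauss snd) (\<lambda>z. (cmod z)\<^sup>2)"
      unfolding N_def distr_pair_snd[OF prob_space_measure_pmf G.prob_space_axioms] by (rule integrable_cgauss_norm2)
    moreover have "snd \<in> N \<rightarrow>\<^sub>M cgauss" unfolding N_def by simp
    ultimately have "integrable N (\<lambda>w. (cmod (snd w))\<^sup>2)"
      by (rule integrable_distr[rotated])
    then have "integrable (distr (law_int A B) N snd) (\<lambda>w. (cmod (snd w))\<^sup>2)"
      unfolding M distr_pair_snd[OF prob_space_measure_pmf N.prob_space_axioms] .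
    then have "integrable (law_int A B) (\<lambda>w. (cmod (snd (snd w)))\<^sup>2)"
      by (rule integrable_distr[OF snd_meas])
    then show ?thesis by simp
  qed
  have intL: "integrable (law_int A B) (\<lambda>(x, x1, z). log 2 (L_int A B h x x1 z))"
  proof (rule Bochner_Integration.integrable_bound[OF intb Lm])
    show "AE w in law_int A B. norm (case w of (x, x1, z) \<Rightarrow> log 2 (L_int A B h x x1 z))
        \<le> norm (log 2 (real (card A * card B)) + (cmod (snd (snd w)))\<^sup>2 / ln 2)"
      using inA inB
    proof eventually_elim
      case (elim w)
      have "real (card A * card B) \<ge> 1"
        using cardA cardB by (metis One_nat_def Suc_leI nat_0_less_mult_iff of_nat_1 of_nat_mono)
      then have "\<bar>log 2 (L_int A B h (fst w) (fst (snd w)) (snd (snd w)))\<bar>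
          \<le> log 2 (real (card A * card B)) + (cmod (snd (snd w)))\<^sup>2 / ln 2"
        using elim Lge Lle by (intro sum_log_bounds) auto
      then show ?case by (auto simp: case_prod_beta')
    qed
  qed
  have "I_int A B h = prob_space.mutual_information (unif A \<Otimes>\<^sub>M N) 2 borel borel (\<lambda>(x, n). x) (\<lambda>(x, n). h * x + v n)"
    unfolding I_int_def M by (simp add: v_def case_prod_beta' algebra_simps)
  also have "\<dots> = (\<integral>(x, n). log 2 (real (card A) * g (v n) / (\<Sum>a\<in>A. g (v n + h * (x - a)))) \<partial>law_int A B)"
    unfolding M by (rule mutual_information_additive[OF A N.prob_space_axioms v g gpos law])
  also have "\<dots> = (\<integral>w. log 2 (real (card A)) - (case w of (x, x1, z) \<Rightarrow> log 2 (L_int A B h x x1 z)) \<partial>law_int A B)"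
  proof (rule integral_cong_AE)
    show "AE w in law_int A B. (case w of (x, n) \<Rightarrow> log 2 (real (card A) * g (v n) / (\<Sum>a\<in>A. g (v n + h * (x - a)))))
        = log 2 (real (card A)) - (case w of (x, x1, z) \<Rightarrow> log 2 (L_int A B h x x1 z))"
      using inA inB
    proof eventually_elim
      case (elim w)
      obtain x x1 z where w: "w = (x, x1, z)" by (cases w) auto
      define c where "c = 1 / (pi * real (card B))"
      have c: "c > 0" using cardB by (simp add: c_def)
      have g_alt: "g y = c * (\<Sum>b\<in>B. e (y - h * b))" for y
        by (simp add: g_def c_def sum_divide_distrib[symmetric])
      have 1: "g (v (x1, z)) = c * (\<Sum>b\<in>B. e (z + h * (x1 - b)))"
        by (simp add: g_alt v_def algebra_simps)
      have 2: "(\<Sum>a\<in>A. g (v (x1, z) + h * (x - a))) = c * (\<Sum>a\<in>A. \<Sum>b\<in>B. e (z + h * (x - a + x1 - b)))"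
        by (simp add: g_alt v_def sum_distrib_left[symmetric] algebra_simps)
      have "real (card A) * g (v (x1, z)) / (\<Sum>a\<in>A. g (v (x1, z) + h * (x - a))) = real (card A) / L_int A B h x x1 z"
        unfolding 1 2 L_alt using c by simp
      moreover have "L_int A B h x x1 z > 0" using Lge[of x x1 z] elim w by simp
      moreover have "log 2 (real (card A) / L_int A B h x x1 z) = log 2 (real (card A)) - log 2 (L_int A B h x x1 z)"
        using calculation cardA by (simp add: log_divide)
      ultimately show ?case using w by simp
    qed
  qed (use Lm in \<open>auto simp: case_prod_beta'\<close>)
  also have "\<dots> = log 2 (real (card A)) - M.expectation (\<lambda>(x, x1, z). log 2 (L_int A B h x x1 z))"
    using intL by (subst Bochner_Integration.integral_diff) (auto simp: M.prob_space)
  finally show ?thesis .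
qed

subsection \<open>Codes\<close>

text \<open>Blocks of length \<open>n\<close> are extensional functions on \<open>{1..n}\<close>. Measurability of the decoder is
  needed for its error probability to be meaningful.\<close>
definition is_code ::
    "complex set \<Rightarrow> complex set \<Rightarrow> nat \<Rightarrow> nat \<Rightarrow> nat \<Rightarrow> (nat \<Rightarrow> nat \<Rightarrow> complex) \<Rightarrow> ((nat \<Rightarrow> complex) \<Rightarrow> nat) \<Rightarrow> bool" where
  "is_code X21 X22 N1 N2 M enc dec \<longleftrightarrow>
     enc \<in> {1..M} \<rightarrow> (\<Pi>\<^sub>E j\<in>{1..N2}. if j \<le> N1 then X21 else X22) \<and>
     dec \<in> (\<Pi>\<^sub>M j\<in>{1..N2}. (borel :: complex measure)) \<rightarrow>\<^sub>M count_space {1..M}"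

text \<open>Received block for codeword \<open>c\<close>, interference \<open>x\<close> and noise \<open>z\<close>.\<close>
definition received ::
    "complex \<Rightarrow> nat \<Rightarrow> nat \<Rightarrow> (nat \<Rightarrow> complex) \<Rightarrow> (nat \<Rightarrow> complex) \<Rightarrow> (nat \<Rightarrow> complex) \<Rightarrow> nat \<Rightarrow> complex" where
  "received h N1 N2 c x z =
     (\<lambda>j\<in>{1..N2}. if j \<le> N1 then h * (x j + c j) + z j else h * c j + z j)"

text \<open>Joint law of the message, the interference block and the noise block.\<close>
definition transmission_law ::
    "complex set \<Rightarrow> nat \<Rightarrow> nat \<Rightarrow> nat \<Rightarrow> (nat \<times> (nat \<Rightarrow> complex) \<times> (nat \<Rightarrow> complex)) measure" where
  "transmission_law B N1 N2 M =
     unif {1..M} \<Otimes>\<^sub>M ((\<Pi>\<^sub>M j\<in>{1..N1}. unif B) \<Otimes>\<^sub>M (\<Pi>\<^sub>M j\<in>{1..N2}. cgauss))"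

definition error_prob ::
    "complex \<Rightarrow> complex set \<Rightarrow> nat \<Rightarrow> nat \<Rightarrow> nat \<Rightarrow> (nat \<Rightarrow> nat \<Rightarrow> complex) \<Rightarrow> ((nat \<Rightarrow> complex) \<Rightarrow> nat) \<Rightarrow> real" where
  "error_prob h B N1 N2 M enc dec =
     \<P>((w, x, z) in transmission_law B N1 N2 M. dec (received h N1 N2 (enc w) x z) \<noteq> w)"

end

theory Submission
  imports Defs
begin

text \<open>
  Feinstein's greedy construction yields \<open>M\<close> codewords with error probability at most
  \<open>P(i \<le> \<theta>) + M * 2 powr - \<theta>\<close>, where the information density \<open>i\<close> of the block is a sum of
  independent terms. The tail is compared with the Gaussian one through characteristic functions.
  The remainder \<open>O(log N2)\<close> leaves room to add an independent Gaussian of variance of order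
  \<open>log N2\<close> to the sum first: this makes the characteristic function negligible away from the
  origin, so Levy's inversion formula gives the error \<open>O(1 / \<sigma>)\<close>, where \<open>\<sigma>\<^sup>2\<close> is the
  total dispersion, without a smoothing kernel. Each third absolute central moment is at most a
  constant times the variance, also when the variance is 0, so the bound is uniform in \<open>N1\<close>; when
  \<open>\<sigma>\<close> is bounded, Chebyshev's inequality suffices. The interference-free sub-block is the case of
  interference constellation \<open>{0}\<close>.
\<close>

subsection \<open>Tails of sums of independent variables\<close>

text \<open>Budget: with \<open>\<theta> = block_info - x\<close>, a code of size about
  \<open>2 powr \<theta> / sqrt N2\<close> has confusion term \<open>1 / sqrt N2\<close>, at the
  cost of half a \<open>log N2\<close> in the exponent. The total variance is at most a constant
  times \<open>N2\<close>, so this term is O(1 / \<sigma>) too. All errors of order 1 / \<sigma> are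
  then paid at once by moving the quantile from \<open>q\<close> to \<open>q + r / \<sigma>\<close>:
  the tail drops by a fixed multiple of \<open>r / \<sigma>\<close>, while the threshold
  \<open>\<sigma> * q\<close> rises by the constant \<open>r\<close> only. The smoothing Gaussian
  enlarges the variance and shifts the threshold, both by O(log N2), which is again affordable. The
  structural obstacle is that the error probability refers to a message, an interference block of
  length \<open>N1\<close> and a noise block of length \<open>N2\<close>, while the estimates need
  independent letters. Drawing the codeword uniformly from all words makes the triples (symbol,
  interference, noise) independent over the positions; \<open>chan_eq\<close> recovers the channel
  law of a single word by conditioning, and Feinstein's construction needs only averages over all
  words.\<close>

lemma char_diff_interval_bound:
  fixes B :: "real \<Rightarrow> real"
  assumes M1: "real_distribution M1" and M2: "real_distribution M2" and ab: "a \<le> b"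
    and atoms: "measure M1 {a} = 0" "measure M1 {b} = 0" "measure M2 {a} = 0" "measure M2 {b} = 0"
    and B: "integrable lborel B" "\<And>t. 0 \<le> B t"
    and bound: "\<And>t. cmod (char M1 t - char M2 t) \<le> \<bar>t\<bar> * B t"
  shows "\<bar>measure M1 {a<..b} - measure M2 {a<..b}\<bar> \<le> (LINT t|lborel. B t) / pi"
proof -
  define F where "F = (\<lambda>t. (iexp (-(t * a)) - iexp (-(t * b))) / (\<i> * complex_of_real t))"
  have F_meas [measurable]: "F \<in> borel_measurable borel"
    unfolding F_def by measurable
  have [measurable]: "char M1 \<in> borel_measurable borel" "char M2 \<in> borel_measurable borel"
    using M1 M2 by (auto intro: real_distribution.char_measurable)
  \<comment> \<open>Two bounds on the inversion kernel serve two purposes. This one, finite near 0,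
    makes the truncated integrals of the two laws exist separately, so that they may be subtracted;
    \<open>F2\<close> supplies the \<open>1 / \<bar>t\<bar>\<close> that cancels the factor
    \<open>\<bar>t\<bar>\<close> in \<open>bound\<close>.\<close>
  have F1: "cmod (F t) \<le> b - a" if "t \<noteq> 0" for t
    using Levy_Inversion_aux2[of "-b" "-a" t] ab that by (simp add: F_def)
  have F2: "cmod (F t) \<le> 2 / \<bar>t\<bar>" for t
  proof -
    have "cmod (iexp (-(t * a)) - iexp (-(t * b))) \<le> 1 + 1"
      by (rule order_trans[OF norm_triangle_ineq4]) (simp only: norm_exp_i_times order_refl)
    then show ?thesis
      by (simp add: F_def norm_divide norm_mult divide_right_mono)
  qed
  have t0: "AE t in lborel. t \<noteq> (0::real)"
    by (rule AE_lborel_singleton)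
  have Bint: "cmod (F t * (char M1 t - char M2 t)) \<le> 2 * B t" for t
  proof -
    have "cmod (F t * (char M1 t - char M2 t)) \<le> (2 / \<bar>t\<bar>) * (\<bar>t\<bar> * B t)"
      unfolding norm_mult by (intro mult_mono F2 bound) auto
    then show ?thesis using B(2)[of t] by (cases "t = 0") (simp_all add: F_def)
  qed
  have int1: "integrable lborel (\<lambda>t. indicator {- T<..<T} t *\<^sub>R (F t * char M t))"
    if M: "real_distribution M" for M :: "real measure" and T :: real
  proof -
    interpret real_distribution M by fact
    show ?thesis
    proof (rule integrableI_bounded_set_indicator[where B="b - a"])
      show "AE t in lborel. t \<in> {- T<..<T} \<longrightarrow> norm (F t * char M t) \<le> b - a"
        using t0
      proof eventually_elim
        case (elim t)
        have "cmod (F t) * cmod (char M t) \<le> (b - a) * 1"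
          using F1[OF elim] cmod_char_le_1[of t] ab by (intro mult_mono) auto
        then show ?case by (simp add: norm_mult)
      qed
      show "emeasure lborel {- T<..<T} < \<infinity>"
        by (cases "- T \<le> T") auto
    qed auto
  qed
  define J where "J = (\<lambda>T. (CLBINT t=-T..T. F t * char M1 t) - (CLBINT t=-T..T. F t * char M2 t))"
  \<comment> \<open>The bound does not depend on the truncation, because \<open>B\<close> is
    integrable on the whole line. The 2 from \<open>F2\<close> against the
    \<open>1 / (2 * pi)\<close> of the inversion formula leaves \<open>1 / pi\<close>.\<close>
  have J: "cmod (J T) \<le> 2 * (LINT t|lborel. B t)" if T: "T \<ge> 0" for T :: real
  proof -
    have "J T = (CLINT t|lborel. indicator {- T<..<T} t *\<^sub>R (F t * char M1 t))
        - (CLINT t|lborel. indicator {- T<..<T} t *\<^sub>R (F t * char M2 t))"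
      using T by (simp add: J_def interval_lebesgue_integral_def set_lebesgue_integral_def)
    also have "\<dots> = (CLINT t|lborel. indicator {- T<..<T} t *\<^sub>R (F t * char M1 t)
        - indicator {- T<..<T} t *\<^sub>R (F t * char M2 t))"
      by (intro Bochner_Integration.integral_diff[symmetric] int1 M1 M2)
    finally have J_eq: "J T = \<dots>" .
    have "cmod (J T) \<le> (LINT t|lborel. 2 * B t)"
      unfolding J_eq
    proof (rule Bochner_Integration.integral_norm_bound_integral)
      show "integrable lborel (\<lambda>t. indicator {- T<..<T} t *\<^sub>R (F t * char M1 t)
        - indicator {- T<..<T} t *\<^sub>R (F t * char M2 t))"
        by (intro Bochner_Integration.integrable_diff int1 M1 M2)
      show "integrable lborel (\<lambda>t. 2 * B t)" using B(1) by simp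
      show "norm (indicator {- T<..<T} t *\<^sub>R (F t * char M1 t)
        - indicator {- T<..<T} t *\<^sub>R (F t * char M2 t)) \<le> 2 * B t" for t
        using Bint[of t] B(2)[of t] by (simp add: indicator_def right_diff_distrib)
    qed
    then show ?thesis by simp
  qed
  have L: "(\<lambda>n. 1 / (2 * pi) * J (real n)) \<longlonglongrightarrow> measure M1 {a<..b} - measure M2 {a<..b}"
  proof -
    have "(\<lambda>n. 1 / (2 * pi) * (CLBINT t=-real n..real n. F t * char M1 t)
        - 1 / (2 * pi) * (CLBINT t=-real n..real n. F t * char M2 t))
        \<longlonglongrightarrow> complex_of_real (measure M1 {a<..b}) - complex_of_real (measure M2 {a<..b})"
      unfolding F_def
      using real_distribution.Levy_Inversion[OF M1 ab atoms(1,2)]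
        real_distribution.Levy_Inversion[OF M2 ab atoms(3,4)]
      by (intro tendsto_diff) auto
    then show ?thesis by (simp add: J_def right_diff_distrib)
  qed
  have "cmod (complex_of_real (measure M1 {a<..b} - measure M2 {a<..b})) \<le> (LINT t|lborel. B t) / pi"
  proof (rule LIMSEQ_le_const2[OF tendsto_norm[OF L]], intro exI allI impI)
    fix n :: nat
    show "cmod (1 / (2 * pi) * J (real n)) \<le> (LINT t|lborel. B t) / pi"
      using J[of "real n"] by (simp add: norm_mult norm_divide field_simps)
  qed
  then show ?thesis by (simp only: norm_of_real)
qed

section \<open>Products of characteristic functions compared with the Gaussian one\<close>

lemma
  fixes s :: real
  assumes s: "s > 0"
  shows integrable_exp_neg_square: "integrable lborel (\<lambda>t. exp (- s * t\<^sup>2))"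
    and integral_exp_neg_square: "(LINT t|lborel. exp (- s * t\<^sup>2)) = sqrt (pi / s)"
proof -
  define \<sigma> where "\<sigma> = 1 / sqrt (2 * s)"
  have \<sigma>: "\<sigma> > 0" and \<sigma>2: "\<sigma>\<^sup>2 = 1 / (2 * s)"
    using s by (auto simp: \<sigma>_def power_divide)
  have eq: "(\<lambda>t. exp (- s * t\<^sup>2)) = (\<lambda>t. sqrt (pi / s) * normal_density 0 \<sigma> t)"
    using s by (auto simp: normal_density_def \<sigma>2 real_sqrt_divide mult.commute)
  show "integrable lborel (\<lambda>t. exp (- s * t\<^sup>2))" "(LINT t|lborel. exp (- s * t\<^sup>2)) = sqrt (pi / s)"
    unfolding eq using \<sigma> by simp_all
qed

text \<open>Dividing every factor by \<open>r i\<close> reduces this to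
  \<open>norm_prod_diff\<close> for factors in the unit disc. The gain is the product of the
  \<open>r i\<close> in front: with Gaussian \<open>r i\<close> the difference keeps a Gaussian
  decay, which the unscaled bound would lose.\<close>

lemma norm_prod_diff_scaled:
  fixes z w :: "'i \<Rightarrow> complex"
  assumes "finite I" and r: "\<And>i. i \<in> I \<Longrightarrow> 0 < r i"
    and z: "\<And>i. i \<in> I \<Longrightarrow> cmod (z i) \<le> r i" and w: "\<And>i. i \<in> I \<Longrightarrow> cmod (w i) \<le> r i"
  shows "cmod ((\<Prod>i\<in>I. z i) - (\<Prod>i\<in>I. w i)) \<le> (\<Prod>i\<in>I. r i) * (\<Sum>i\<in>I. cmod (z i - w i) / r i)"
proof -
  have factor: "(\<Prod>i\<in>I. f i) = of_real (\<Prod>i\<in>I. r i) * (\<Prod>i\<in>I. f i / of_real (r i))" for f :: "'i \<Rightarrow> complex"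
    unfolding of_real_prod prod.distrib[symmetric] using r by (intro prod.cong) force+
  have rpos: "(\<Prod>i\<in>I. r i) > 0" using r by (rule prod_pos)
  have "cmod ((\<Prod>i\<in>I. z i) - (\<Prod>i\<in>I. w i))
      = (\<Prod>i\<in>I. r i) * cmod ((\<Prod>i\<in>I. z i / of_real (r i)) - (\<Prod>i\<in>I. w i / of_real (r i)))"
    using rpos unfolding factor[of z] factor[of w] right_diff_distrib[symmetric] norm_mult norm_of_real by simp
  also have "\<dots> \<le> (\<Prod>i\<in>I. r i) * (\<Sum>i\<in>I. cmod (z i / of_real (r i) - w i / of_real (r i)))"
  proof (intro mult_left_mono norm_prod_diff)
    show "cmod (z i / of_real (r i)) \<le> 1" "cmod (w i / of_real (r i)) \<le> 1" if "i \<in> I" for i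
      using r[OF that] z[OF that] w[OF that] by (simp_all add: norm_divide)
  qed (use rpos in simp)
  also have "(\<Sum>i\<in>I. cmod (z i / of_real (r i) - w i / of_real (r i))) = (\<Sum>i\<in>I. cmod (z i - w i) / r i)"
  proof (rule sum.cong)
    fix i assume "i \<in> I"
    then show "cmod (z i / of_real (r i) - w i / of_real (r i)) = cmod (z i - w i) / r i"
      using r[of i] unfolding diff_divide_distrib[symmetric] norm_divide by simp
  qed simp
  finally show ?thesis .
qed

lemma exp_minus_quadratic_bound:
  fixes x :: real
  assumes "x \<ge> 0"
  shows "\<bar>exp (- x) - (1 - x)\<bar> \<le> x\<^sup>2 / 2"
proof -
  have "exp (- x) \<le> 1 - x + x\<^sup>2 / 2"
  proof -
    have "\<exists>t. \<bar>t\<bar> \<le> \<bar>- x\<bar> \<and> exp (- x) = (\<Sum>m<3. (- x) ^ m / fact m) + exp t / fact 3 * (- x) ^ 3"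
      by (rule Maclaurin_exp_le)
    then obtain t where "exp (- x) = (\<Sum>m<3. (- x) ^ m / fact m) + exp t / fact 3 * (- x) ^ 3" by blast
    moreover have "exp t / fact 3 * (- x) ^ 3 \<le> 0"
      using assms by (simp add: mult_nonneg_nonpos)
    moreover have "(\<Sum>m<3. (- x) ^ m / fact m) = 1 - x + x\<^sup>2 / 2"
      by (simp add: eval_nat_numeral field_simps)
    ultimately show ?thesis by simp
  qed
  moreover have "1 - x \<le> exp (- x)" using exp_ge_add_one_self[of "-x"] by simp
  ultimately show ?thesis by simp
qed

text \<open>For \<open>\<bar>t\<bar> \<le> T\<close>, the condition \<open>K * T \<le> 1\<close>
  bounds the cubic error of a factor by \<open>v i * t\<^sup>2 / 6\<close>. Lowering the Gaussian
  exponent from 1/2 to 1/3 absorbs it, so \<open>r i\<close> majorises both kinds of factors. The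
  condition \<open>w * T\<^sup>2 \<le> 2\<close> keeps \<open>1 - t\<^sup>2 * v i / 2\<close>
  nonnegative and \<open>r i\<close> above 1/3, so that dividing by \<open>r i\<close> costs at most
  a factor 3.\<close>

lemma prod_char_gaussian_diff:
  fixes \<phi> :: "'i \<Rightarrow> complex" and v :: "'i \<Rightarrow> real"
  assumes I: "finite I" and v: "\<And>i. i \<in> I \<Longrightarrow> 0 \<le> v i" "\<And>i. i \<in> I \<Longrightarrow> v i \<le> w"
    and K: "0 \<le> K" and T: "\<bar>t\<bar> \<le> T" "K * T \<le> 1" "w * T\<^sup>2 \<le> 2"
    and \<phi>: "\<And>i. i \<in> I \<Longrightarrow> cmod (\<phi> i - (1 - t\<^sup>2 * v i / 2)) \<le> K * v i * \<bar>t\<bar> ^ 3 / 6"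
  shows "cmod ((\<Prod>i\<in>I. \<phi> i) - exp (- (\<Sum>i\<in>I. v i) * t\<^sup>2 / 2))
    \<le> (K + w * T) * (\<Sum>i\<in>I. v i) * \<bar>t\<bar> ^ 3 * exp (- (\<Sum>i\<in>I. v i) * t\<^sup>2 / 3)"
proof -
  define V where "V = (\<Sum>i\<in>I. v i)"
  define r where "r = (\<lambda>i. exp (- (v i * t\<^sup>2 / 3)))"
  define g where "g = (\<lambda>i. complex_of_real (exp (- (v i * t\<^sup>2 / 2))))"
  have T0: "0 \<le> T" using T by linarith
  have Kt: "K * \<bar>t\<bar> \<le> 1" using T K by (meson mult_left_mono order_trans)
  have tT: "t\<^sup>2 \<le> T\<^sup>2" using T by (metis abs_ge_zero power2_abs power_mono)
  have vt: "v i * t\<^sup>2 \<le> 2" if "i \<in> I" for i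
  proof -
    have "v i * t\<^sup>2 \<le> w * T\<^sup>2" using v[OF that] tT by (intro mult_mono) auto
    with T show ?thesis by simp
  qed
  have cube: "\<bar>t\<bar> ^ 3 = \<bar>t\<bar> * t\<^sup>2" by (simp add: eval_nat_numeral)
  have \<phi>r: "cmod (\<phi> i) \<le> r i" if i: "i \<in> I" for i
  proof -
    have "cmod (\<phi> i) \<le> cmod (1 - t\<^sup>2 * v i / 2) + K * v i * \<bar>t\<bar> ^ 3 / 6"
      using \<phi>[OF i] norm_triangle_sub[of "\<phi> i" "1 - t\<^sup>2 * v i / 2"] by linarith
    also have "cmod (1 - t\<^sup>2 * v i / 2) = \<bar>1 - t\<^sup>2 * v i / 2\<bar>"
      by (metis norm_of_real of_real_1 of_real_diff of_real_divide of_real_mult of_real_numeral of_real_power)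
    also have "\<dots> = 1 - t\<^sup>2 * v i / 2" using vt[OF i] by (simp add: mult.commute)
    also have "K * v i * \<bar>t\<bar> ^ 3 / 6 = (K * \<bar>t\<bar>) * (v i * t\<^sup>2 / 6)"
      by (simp add: cube)
    also have "\<dots> \<le> 1 * (v i * t\<^sup>2 / 6)"
      using Kt v[OF i] by (intro mult_right_mono) auto
    also have "1 - t\<^sup>2 * v i / 2 + 1 * (v i * t\<^sup>2 / 6) = 1 + - (v i * t\<^sup>2 / 3)"
      by (simp add: field_simps)
    also have "\<dots> \<le> r i" unfolding r_def by (rule exp_ge_add_one_self)
    finally show ?thesis by simp
  qed
  have gr: "cmod (g i) \<le> r i" if i: "i \<in> I" for i
    using v(1)[OF i] by (simp add: g_def r_def norm_of_real)
  have diff: "cmod (\<phi> i - g i) / r i \<le> (K + w * T) * v i * \<bar>t\<bar> ^ 3" if i: "i \<in> I" for i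
  proof -
    have "cmod (1 - t\<^sup>2 * v i / 2 - g i) = \<bar>exp (- (v i * t\<^sup>2 / 2)) - (1 - v i * t\<^sup>2 / 2)\<bar>"
      unfolding g_def by (metis (no_types, opaque_lifting) abs_minus_commute mult.commute norm_of_real of_real_1 of_real_diff of_real_divide of_real_mult of_real_numeral of_real_power)
    also have "\<dots> \<le> (v i * t\<^sup>2 / 2)\<^sup>2 / 2"
      using v[OF i] by (intro exp_minus_quadratic_bound) auto
    also have "\<dots> = (v i * \<bar>t\<bar>) * (v i * \<bar>t\<bar> ^ 3) / 8"
      by (simp add: eval_nat_numeral)
    also have "\<dots> \<le> (w * T) * (v i * \<bar>t\<bar> ^ 3) / 8"
      using v[OF i] T by (intro divide_right_mono mult_right_mono mult_mono) auto
    finally have 1: "cmod (1 - t\<^sup>2 * v i / 2 - g i) \<le> (w * T) * (v i * \<bar>t\<bar> ^ 3) / 8" .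
    have "cmod (\<phi> i - g i) \<le> cmod (\<phi> i - (1 - t\<^sup>2 * v i / 2)) + cmod (1 - t\<^sup>2 * v i / 2 - g i)"
      using norm_triangle_ineq[of "\<phi> i - (1 - t\<^sup>2 * v i / 2)" "1 - t\<^sup>2 * v i / 2 - g i"] by simp
    also have "\<dots> \<le> K * v i * \<bar>t\<bar> ^ 3 / 6 + (w * T) * (v i * \<bar>t\<bar> ^ 3) / 8"
      using \<phi>[OF i] 1 by linarith
    \<comment> \<open>The coefficients 1/6 and 1/8 are rounded up to 1/3, which then cancels the
      factor 3 lost to \<open>r i\<close>.\<close>
    also have "\<dots> \<le> (K + w * T) * v i * \<bar>t\<bar> ^ 3 / 3"
    proof -
      have "0 \<le> K * (v i * \<bar>t\<bar> ^ 3)" "0 \<le> w * T * (v i * \<bar>t\<bar> ^ 3)"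
        using K v[OF i] T0 by auto
      then show ?thesis by (simp add: field_simps)
    qed
    finally have 2: "cmod (\<phi> i - g i) \<le> (K + w * T) * v i * \<bar>t\<bar> ^ 3 / 3" .
    have "r i \<ge> 1 / 3"
      using vt[OF i] exp_ge_add_one_self[of "- (v i * t\<^sup>2 / 3)"] by (simp add: r_def)
    then have "cmod (\<phi> i - g i) / r i \<le> cmod (\<phi> i - g i) / (1 / 3)"
      by (intro divide_left_mono) (auto simp: r_def)
    with 2 show ?thesis by simp
  qed
  have g_prod: "(\<Prod>i\<in>I. g i) = exp (- (\<Sum>i\<in>I. v i) * t\<^sup>2 / 2)"
    unfolding g_def of_real_prod[symmetric] exp_sum[OF I, symmetric]
    by (simp add: sum_negf sum_divide_distrib[symmetric] sum_distrib_right[symmetric] exp_of_real[symmetric])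
  have r_prod: "(\<Prod>i\<in>I. r i) = exp (- (\<Sum>i\<in>I. v i) * t\<^sup>2 / 3)"
    unfolding r_def exp_sum[OF I, symmetric]
    by (simp add: sum_negf sum_divide_distrib[symmetric] sum_distrib_right[symmetric])
  have "cmod ((\<Prod>i\<in>I. \<phi> i) - (\<Prod>i\<in>I. g i)) \<le> (\<Prod>i\<in>I. r i) * (\<Sum>i\<in>I. cmod (\<phi> i - g i) / r i)"
    by (intro norm_prod_diff_scaled I \<phi>r gr) (auto simp: r_def)
  also have "\<dots> \<le> (\<Prod>i\<in>I. r i) * (\<Sum>i\<in>I. (K + w * T) * v i * \<bar>t\<bar> ^ 3)"
    by (intro mult_left_mono sum_mono diff) (auto simp: r_def intro: prod_nonneg)
  also have "\<dots> = (K + w * T) * V * \<bar>t\<bar> ^ 3 * (\<Prod>i\<in>I. r i)"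
    by (simp add: V_def sum_distrib_left sum_distrib_right mult_ac)
  finally show ?thesis unfolding g_prod r_prod V_def .
qed

section \<open>The standard normal tail\<close>

lemma Q_fun_eq_measure: "Q_fun x = measure std_normal_distribution {x..}"
proof -
  have "measure std_normal_distribution {x..} = (LINT t|std_normal_distribution. indicator {x..} t)"
    by simp
  also have "\<dots> = (LINT t|lborel. std_normal_density t *\<^sub>R indicator {x..} t)"
    by (subst integral_density) auto
  also have "\<dots> = Q_fun x"
    unfolding Q_fun_def set_lebesgue_integral_def
    by (intro Bochner_Integration.integral_cong) (auto simp: std_normal_density_def)
  finally show ?thesis ..
qed

lemma std_normal_atom: "emeasure std_normal_distribution {x} = 0"
proof -
  have "AE t in lborel. ennreal (std_normal_density t) * indicator {x} t = 0"
    using AE_lborel_singleton[of x] by eventually_elim simp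
  then show ?thesis
    by (subst emeasure_density) (auto simp: nn_integral_0_iff_AE)
qed

text \<open>Half of the exponent is frozen at its value at \<open>u\<close>, the other half is
  integrated over the whole line. This is crude, but it holds from \<open>u = 0\<close> on, and only
  exponential decay in the square of \<open>u\<close> matters later.\<close>

lemma Q_fun_tail:
  assumes "u \<ge> 0"
  shows "Q_fun u \<le> sqrt 2 * exp (- u\<^sup>2 / 4)"
proof -
  have "Q_fun u = (LINT t|lborel. indicator {u..} t *\<^sub>R (1 / sqrt (2 * pi) * exp (- t\<^sup>2 / 2)))"
    by (simp add: Q_fun_def set_lebesgue_integral_def)
  also have "\<dots> \<le> (LINT t|lborel. exp (- u\<^sup>2 / 4) / sqrt (2 * pi) * exp (- (1/4) * t\<^sup>2))"
  proof (rule Bochner_Integration.integral_mono')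
    show "integrable lborel (\<lambda>t. exp (- u\<^sup>2 / 4) / sqrt (2 * pi) * exp (- (1/4) * t\<^sup>2))"
      by (intro integrable_mult_right integrable_exp_neg_square) simp
    fix t :: real
    show "indicator {u..} t *\<^sub>R (1 / sqrt (2 * pi) * exp (- t\<^sup>2 / 2))
        \<le> exp (- u\<^sup>2 / 4) / sqrt (2 * pi) * exp (- (1/4) * t\<^sup>2)"
    proof (cases "u \<le> t")
      case True
      then have "u\<^sup>2 \<le> t\<^sup>2" using assms by (rule power_mono)
      then have "exp (- t\<^sup>2 / 2) \<le> exp (- u\<^sup>2 / 4) * exp (- (1/4) * t\<^sup>2)"
        by (simp add: exp_add[symmetric])
      then show ?thesis using True by (simp add: divide_right_mono)
    qed simp
  qed simp
  also have "\<dots> = exp (- u\<^sup>2 / 4) / sqrt (2 * pi) * sqrt (pi / (1/4))"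
    by (subst integral_mult_right_zero, subst integral_exp_neg_square) simp_all
  also have "\<dots> = sqrt 2 * exp (- u\<^sup>2 / 4)"
    by (simp add: real_sqrt_mult real_sqrt_divide field_simps)
  finally show ?thesis .
qed

section \<open>Smoothing by an independent Gaussian\<close>

lemma char_distr_scale:
  assumes "sets N = sets borel"
  shows "char (distr N borel (\<lambda>x. c * x)) t = char N (c * t)"
  using assms unfolding char_def
  by (subst integral_distr) (auto simp: mult_ac measurable_cong_sets[OF assms refl])

lemma char_independent_sum:
  assumes "real_distribution \<mu>" "real_distribution \<nu>"
  shows "char (distr (\<mu> \<Otimes>\<^sub>M \<nu>) borel (\<lambda>p. fst p + c * snd p)) t = char \<mu> t * char \<nu> (c * t)"
proof -
  interpret \<mu>: real_distribution \<mu> by fact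
  interpret \<nu>: real_distribution \<nu> by fact
  interpret P: pair_prob_space \<mu> \<nu> ..
  define P where "P = \<mu> \<Otimes>\<^sub>M \<nu>"
  interpret P': prob_space P unfolding P_def by (rule P.prob_space_axioms)
  have fst_m [measurable]: "fst \<in> P \<rightarrow>\<^sub>M borel" and snd_m [measurable]: "snd \<in> P \<rightarrow>\<^sub>M borel"
    unfolding P_def by (auto simp: measurable_cong_sets[OF refl \<mu>.events_eq_borel[symmetric]] measurable_cong_sets[OF refl \<nu>.events_eq_borel[symmetric]])
  have "distr P borel fst = distr P \<mu> fst" "distr P borel snd = distr P \<nu> snd"
    by (auto intro: distr_cong)
  then have fst_d: "distr P borel fst = \<mu>" and snd_d: "distr P borel snd = \<nu>"
    using \<nu>.distr_pair_fst[of \<mu>] distr_pair_snd[OF \<mu>.prob_space_axioms \<nu>.prob_space_axioms]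
    by (simp_all add: P_def)
  have "distr P (borel \<Otimes>\<^sub>M borel) (\<lambda>p. (fst p, snd p)) = distr P P (\<lambda>p. p)"
    by (intro distr_cong) (auto simp: P_def intro!: sets_pair_measure_cong)
  then have "P'.indep_var borel fst borel snd"
    unfolding P'.indep_var_distribution_eq fst_d snd_d by (simp add: P_def distr_id2)
  from P'.indep_var_compose[OF this, of "\<lambda>x. x" borel "\<lambda>x. c * x" borel]
  have "P'.indep_var borel fst borel (\<lambda>p. c * snd p)"
    by (simp add: comp_def)
  then have "char (distr P borel (\<lambda>p. fst p + c * snd p)) t
      = char (distr P borel fst) t * char (distr P borel (\<lambda>p. c * snd p)) t"
    by (rule P'.char_distr_add)
  also have "distr P borel (\<lambda>p. c * snd p) = distr (distr P borel snd) borel (\<lambda>x. c * x)"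
    by (subst distr_distr) (auto simp: comp_def)
  finally show ?thesis
    unfolding fst_d snd_d char_distr_scale[OF \<nu>.events_eq_borel] unfolding P_def .
qed

text \<open>Near the origin \<open>close\<close> applies, and half of its exponential absorbs the
  factor \<open>V * t\<^sup>2\<close>. Beyond \<open>T\<close> nothing is known of \<open>f\<close>
  except that its modulus is at most 1, so the smoothing factor must do all the work: half of its
  exponent is frozen at \<open>T\<close> and gives the small constant, the other half stays
  integrable. The factor \<open>\<bar>t\<bar>\<close> required by
  \<open>char_diff_interval_bound\<close> comes there from \<open>T < \<bar>t\<bar>\<close>.\<close>

lemma smoothed_char_diff:
  fixes K T w V \<tau> t :: real
  assumes K: "0 \<le> K" and w: "0 \<le> w" and T: "0 < T" and V: "0 < V"
    and le1: "cmod f \<le> 1"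
    and close: "\<bar>t\<bar> \<le> T \<Longrightarrow> cmod (f - exp (- V * t\<^sup>2 / 2)) \<le> (K + w * T) * V * \<bar>t\<bar> ^ 3 * exp (- V * t\<^sup>2 / 3)"
  shows "cmod (f * exp (- \<tau>\<^sup>2 * t\<^sup>2 / 2) - exp (- (V + \<tau>\<^sup>2) * t\<^sup>2 / 2))
    \<le> \<bar>t\<bar> * (6 * (K + w * T) * exp (- (V / 6) * t\<^sup>2)
      + 2 / T * exp (- \<tau>\<^sup>2 * T\<^sup>2 / 4) * exp (- (\<tau>\<^sup>2 / 4) * t\<^sup>2))"
proof -
  define d where "d = cmod (f - exp (- V * t\<^sup>2 / 2))"
  have "complex_of_real (exp (- (V + \<tau>\<^sup>2) * t\<^sup>2 / 2)) = exp (- V * t\<^sup>2 / 2) * exp (- \<tau>\<^sup>2 * t\<^sup>2 / 2)"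
    unfolding of_real_mult[symmetric] exp_add[symmetric] by (simp add: field_simps)
  then have eq: "cmod (f * exp (- \<tau>\<^sup>2 * t\<^sup>2 / 2) - exp (- (V + \<tau>\<^sup>2) * t\<^sup>2 / 2)) = d * exp (- \<tau>\<^sup>2 * t\<^sup>2 / 2)"
    by (simp add: d_def left_diff_distrib[symmetric] norm_mult)
  have e0: "0 \<le> 6 * (K + w * T) * exp (- (V / 6) * t\<^sup>2)"
    and e1: "0 \<le> 2 / T * exp (- \<tau>\<^sup>2 * T\<^sup>2 / 4) * exp (- (\<tau>\<^sup>2 / 4) * t\<^sup>2)"
    using K w T by auto
  show ?thesis
  proof (cases "\<bar>t\<bar> \<le> T")
    case True
    have "d * exp (- \<tau>\<^sup>2 * t\<^sup>2 / 2) \<le> d * 1"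
      by (intro mult_left_mono) (auto simp: d_def)
    also have "\<dots> \<le> (K + w * T) * V * \<bar>t\<bar> ^ 3 * exp (- V * t\<^sup>2 / 3)"
      using close[OF True] by (simp add: d_def)
    also have "\<dots> = \<bar>t\<bar> * ((K + w * T) * (V * t\<^sup>2 * exp (- V * t\<^sup>2 / 3)))"
      by (simp add: eval_nat_numeral)
    also have "V * t\<^sup>2 * exp (- V * t\<^sup>2 / 3) \<le> 6 * exp (- (V / 6) * t\<^sup>2)"
    proof -
      have "V * t\<^sup>2 \<le> 6 * exp (V * t\<^sup>2 / 6)"
        using exp_ge_add_one_self[of "V * t\<^sup>2 / 6"] by linarith
      then have "V * t\<^sup>2 * exp (- V * t\<^sup>2 / 3) \<le> 6 * exp (V * t\<^sup>2 / 6) * exp (- V * t\<^sup>2 / 3)"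
        by (intro mult_right_mono) auto
      also have "\<dots> = 6 * exp (- (V / 6) * t\<^sup>2)"
        unfolding mult.assoc exp_add[symmetric] by simp
      finally show ?thesis .
    qed
    then have "\<bar>t\<bar> * ((K + w * T) * (V * t\<^sup>2 * exp (- V * t\<^sup>2 / 3)))
        \<le> \<bar>t\<bar> * ((K + w * T) * (6 * exp (- (V / 6) * t\<^sup>2)))"
      using K w T by (intro mult_left_mono) auto
    also have "\<dots> \<le> \<bar>t\<bar> * (6 * (K + w * T) * exp (- (V / 6) * t\<^sup>2)
      + 2 / T * exp (- \<tau>\<^sup>2 * T\<^sup>2 / 4) * exp (- (\<tau>\<^sup>2 / 4) * t\<^sup>2))"
      using e1 by (intro mult_left_mono) (simp_all add: algebra_simps)
    finally show ?thesis unfolding eq .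
  next
    case False
    have "d \<le> 1 + cmod (complex_of_real (exp (- V * t\<^sup>2 / 2)))"
      unfolding d_def using norm_triangle_ineq4[of f "complex_of_real (exp (- V * t\<^sup>2 / 2))"] le1 by linarith
    also have "\<dots> \<le> 2" using V by simp
    finally have "d * exp (- \<tau>\<^sup>2 * t\<^sup>2 / 2) \<le> 2 * exp (- \<tau>\<^sup>2 * t\<^sup>2 / 2)"
      by (intro mult_right_mono) auto
    also have "exp (- \<tau>\<^sup>2 * t\<^sup>2 / 2) \<le> exp (- \<tau>\<^sup>2 * T\<^sup>2 / 4) * exp (- (\<tau>\<^sup>2 / 4) * t\<^sup>2)"
    proof -
      have "T\<^sup>2 \<le> t\<^sup>2" using False T by (metis abs_ge_zero less_imp_le not_le power2_abs power_mono)
      then have "\<tau>\<^sup>2 * T\<^sup>2 \<le> \<tau>\<^sup>2 * t\<^sup>2" by (intro mult_left_mono) auto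
      then show ?thesis by (simp add: exp_add[symmetric])
    qed
    also have "2 * (exp (- \<tau>\<^sup>2 * T\<^sup>2 / 4) * exp (- (\<tau>\<^sup>2 / 4) * t\<^sup>2))
       = T * (2 / T * exp (- \<tau>\<^sup>2 * T\<^sup>2 / 4) * exp (- (\<tau>\<^sup>2 / 4) * t\<^sup>2))"
      using T by simp
    also have "\<dots> \<le> \<bar>t\<bar> * (2 / T * exp (- \<tau>\<^sup>2 * T\<^sup>2 / 4) * exp (- (\<tau>\<^sup>2 / 4) * t\<^sup>2))"
      using False e1 by (intro mult_right_mono) auto
    also have "\<dots> \<le> \<bar>t\<bar> * (6 * (K + w * T) * exp (- (V / 6) * t\<^sup>2)
      + 2 / T * exp (- \<tau>\<^sup>2 * T\<^sup>2 / 4) * exp (- (\<tau>\<^sup>2 / 4) * t\<^sup>2))"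
      using e0 by (intro mult_left_mono) auto
    finally show ?thesis unfolding eq by simp
  qed
qed

text \<open>For a standard normal \<open>g\<close> independent of the sum \<open>S\<close>, the
  event \<open>y + s \<le> S\<close> forces \<open>y \<le> S - \<tau> * g\<close> or
  \<open>s / \<tau> \<le> g\<close>. The first event is compared with the normal law of variance
  \<open>V + \<tau>\<^sup>2\<close>; the inversion error has one part for each of the two ranges of
  \<open>t\<close>. The last summand is the probability of the second event, the price of
  smoothing.\<close>

lemma (in prob_space) sum_upper_tail:
  fixes X :: "'i \<Rightarrow> 'a \<Rightarrow> real" and v :: "'i \<Rightarrow> real"
  assumes I: "finite I" and indep: "indep_vars (\<lambda>_. borel) X I"
    and int: "\<And>i. i \<in> I \<Longrightarrow> integrable M (X i)" "\<And>i. i \<in> I \<Longrightarrow> integrable M (\<lambda>\<omega>. (X i \<omega>)\<^sup>2)"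
      "\<And>i. i \<in> I \<Longrightarrow> integrable M (\<lambda>\<omega>. \<bar>X i \<omega>\<bar> ^ 3)"
    and mean: "\<And>i. i \<in> I \<Longrightarrow> expectation (X i) = 0"
    and var: "\<And>i. i \<in> I \<Longrightarrow> variance (X i) = v i"
    and third: "\<And>i. i \<in> I \<Longrightarrow> expectation (\<lambda>\<omega>. \<bar>X i \<omega>\<bar> ^ 3) \<le> K * v i"
    and v: "\<And>i. i \<in> I \<Longrightarrow> v i \<le> w" and V: "V = (\<Sum>i\<in>I. v i)" "0 < V"
    and K: "0 \<le> K" and w: "0 \<le> w" and T: "0 < T" "K * T \<le> 1" "w * T\<^sup>2 \<le> 2"
    and \<tau>: "0 < \<tau>" and s: "0 \<le> s"
  shows "prob {\<omega> \<in> space M. y + s \<le> (\<Sum>i\<in>I. X i \<omega>)}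
    \<le> Q_fun (y / sqrt (V + \<tau>\<^sup>2))
      + (6 * (K + w * T) * sqrt (pi / (V / 6)) + 2 / T * exp (- \<tau>\<^sup>2 * T\<^sup>2 / 4) * sqrt (pi / (\<tau>\<^sup>2 / 4))) / pi
      + sqrt 2 * exp (- (s / \<tau>)\<^sup>2 / 4)"
proof -
  define S where "S = (\<lambda>\<omega>. \<Sum>i\<in>I. X i \<omega>)"
  have rv: "random_variable borel (X i)" if "i \<in> I" for i
    using indep that unfolding indep_vars_def2 by auto
  have S [measurable]: "random_variable borel S"
    unfolding S_def using rv by (intro borel_measurable_sum)
  define \<mu> where "\<mu> = distr M borel S"
  define N where "N = std_normal_distribution"
  interpret \<mu>: real_distribution \<mu> unfolding \<mu>_def by (rule real_distribution_distr) simp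
  interpret N: real_distribution N unfolding N_def by (rule real_dist_normal_dist)
  interpret P: pair_prob_space \<mu> N ..
  define P where "P = \<mu> \<Otimes>\<^sub>M N"
  interpret P': prob_space P unfolding P_def by (rule P.prob_space_axioms)
  have P_borel [measurable_cong]: "sets P = sets (borel \<Otimes>\<^sub>M borel)"
    unfolding P_def by (intro sets_pair_measure_cong) auto
  define M1 where "M1 = distr P borel (\<lambda>p. fst p + (- \<tau>) * snd p)"
  define \<sigma> where "\<sigma> = sqrt (V + \<tau>\<^sup>2)"
  have \<sigma>: "\<sigma> > 0" using V by (simp add: \<sigma>_def add_pos_nonneg)
  define M2 where "M2 = distr N borel (\<lambda>x. \<sigma> * x)"
  interpret M1: real_distribution M1
    unfolding M1_def by (rule P'.real_distribution_distr) measurable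
  interpret M2: real_distribution M2
    unfolding M2_def by (rule N.real_distribution_distr) measurable
  have charN: "char N t = complex_of_real (exp (- t\<^sup>2 / 2))" for t
    by (simp add: N_def char_std_normal_distribution)
  have char1: "char M1 t = (\<Prod>i\<in>I. char (distr M borel (X i)) t) * exp (- \<tau>\<^sup>2 * t\<^sup>2 / 2)" for t
    unfolding M1_def P_def
    by (subst char_independent_sum[OF \<mu>.real_distribution_axioms N.real_distribution_axioms])
      (simp add: charN \<mu>_def S_def char_distr_sum[OF indep] power_mult_distrib)
  have char2: "char M2 t = exp (- (V + \<tau>\<^sup>2) * t\<^sup>2 / 2)" for t
  proof -
    have "char M2 t = char N (\<sigma> * t)" unfolding M2_def by (rule char_distr_scale) simp
    moreover have "\<sigma>\<^sup>2 = V + \<tau>\<^sup>2" using V by (simp add: \<sigma>_def)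
    ultimately show ?thesis by (simp add: charN power_mult_distrib) (simp add: algebra_simps)
  qed
  have v0: "0 \<le> v i" if "i \<in> I" for i using var[OF that] by (metis variance_positive)
  define B where "B = (\<lambda>t. 6 * (K + w * T) * exp (- (V / 6) * t\<^sup>2)
      + 2 / T * exp (- \<tau>\<^sup>2 * T\<^sup>2 / 4) * exp (- (\<tau>\<^sup>2 / 4) * t\<^sup>2))"
  have close: "cmod (char M1 t - char M2 t) \<le> \<bar>t\<bar> * B t" for t
    unfolding B_def char1 char2
  proof (rule smoothed_char_diff[OF K w T(1) V(2)])
    have "cmod (char (distr M borel (X i)) t) \<le> 1" if "i \<in> I" for i
      using rv[OF that] by (intro real_distribution.cmod_char_le_1 real_distribution_distr)
    then show "cmod (\<Prod>i\<in>I. char (distr M borel (X i)) t) \<le> 1"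
      unfolding prod_norm[symmetric] by (intro prod_le_1) auto
    assume t: "\<bar>t\<bar> \<le> T"
    show "cmod ((\<Prod>i\<in>I. char (distr M borel (X i)) t) - exp (- V * t\<^sup>2 / 2))
        \<le> (K + w * T) * V * \<bar>t\<bar> ^ 3 * exp (- V * t\<^sup>2 / 3)"
      unfolding V(1)
    proof (rule prod_char_gaussian_diff[OF I v0 v K t T(2,3)])
      fix i assume i: "i \<in> I"
      \<comment> \<open>The expansion offers the minimum of a square and a cube; only the cube
        yields the third power of \<open>t\<close> that \<open>prod_char_gaussian_diff\<close>
        expects.\<close>
      have "cmod (char (distr M borel (X i)) t - (1 - t\<^sup>2 * v i / 2))
          \<le> (t\<^sup>2 / 6) * expectation (\<lambda>\<omega>. min (6 * (X i \<omega>)\<^sup>2) (\<bar>t\<bar> * \<bar>X i \<omega>\<bar> ^ 3))"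
        by (rule char_approx3') (use rv int mean var i in auto)
      also have "\<dots> \<le> (t\<^sup>2 / 6) * expectation (\<lambda>\<omega>. \<bar>t\<bar> * \<bar>X i \<omega>\<bar> ^ 3)"
        using int(3)[OF i]
        by (intro mult_left_mono Bochner_Integration.integral_mono') auto
      also have "\<dots> \<le> (t\<^sup>2 / 6) * (\<bar>t\<bar> * (K * v i))"
        using third[OF i] int(3)[OF i] by (auto intro!: mult_left_mono)
      also have "\<dots> = K * v i * \<bar>t\<bar> ^ 3 / 6" by (simp add: eval_nat_numeral)
      finally show "cmod (char (distr M borel (X i)) t - (1 - t\<^sup>2 * v i / 2)) \<le> K * v i * \<bar>t\<bar> ^ 3 / 6" .
    qed
  qed
  have B_int: "integrable lborel B"
    and B_eq: "(LINT t|lborel. B t) = 6 * (K + w * T) * sqrt (pi / (V / 6))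
      + 2 / T * exp (- \<tau>\<^sup>2 * T\<^sup>2 / 4) * sqrt (pi / (\<tau>\<^sup>2 / 4))"
    using integrable_exp_neg_square[of "V / 6"] integral_exp_neg_square[of "V / 6"]
      integrable_exp_neg_square[of "\<tau>\<^sup>2 / 4"] integral_exp_neg_square[of "\<tau>\<^sup>2 / 4"] V \<tau>
    unfolding B_def by simp_all
  have B0: "0 \<le> B t" for t using K w T unfolding B_def by auto
  have N_atom: "emeasure N {x} = 0" for x unfolding N_def by (rule std_normal_atom)
  \<comment> \<open>Given the sum, only one value of the Gaussian leads to \<open>x\<close>.
    Smoothing thus removes all atoms, and every real number may serve as an end point in the
    inversion formula.\<close>
  have atom1: "measure M1 {x} = 0" for x
  proof -
    have "(\<lambda>p. fst p + (- \<tau>) * snd p) \<in> borel_measurable P" by measurable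
    then have sets: "(\<lambda>p. fst p + (- \<tau>) * snd p) -` {x} \<inter> space P \<in> sets P"
      by (rule measurable_sets) simp
    have "emeasure M1 {x} = emeasure P ((\<lambda>p. fst p + (- \<tau>) * snd p) -` {x} \<inter> space P)"
      unfolding M1_def by (rule emeasure_distr) measurable
    also have "\<dots> = (\<integral>\<^sup>+a. emeasure N (Pair a -` ((\<lambda>p. fst p + (- \<tau>) * snd p) -` {x} \<inter> space P)) \<partial>\<mu>)"
      unfolding P_def by (rule N.emeasure_pair_measure_alt) (use sets in \<open>simp only: P_def\<close>)
    also have "\<dots> = (\<integral>\<^sup>+a. emeasure N {(a - x) / \<tau>} \<partial>\<mu>)"
      using \<tau> by (intro nn_integral_cong arg_cong[where f="emeasure N"])
        (auto simp: field_simps P_def space_pair_measure)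
    also have "\<dots> = 0" unfolding N_atom by simp
    finally show ?thesis by (simp add: measure_def)
  qed
  have atom2: "measure M2 {x} = 0" for x
  proof -
    have "(\<lambda>z. \<sigma> * z) -` {x} = {x / \<sigma>}" using \<sigma> by (auto simp: field_simps)
    then show ?thesis
      unfolding M2_def by (subst measure_distr) (auto simp: N_atom measure_def)
  qed
  define err where "err = (LINT t|lborel. B t) / pi"
  \<comment> \<open>Inversion treats bounded intervals, but its error does not depend on their
    length, so the right end may tend to infinity.\<close>
  have "measure M1 {y<..} \<le> Q_fun (y / \<sigma>) + err"
  proof (rule LIMSEQ_le_const2)
    have "(\<lambda>n. measure M1 {y<..y + real n}) \<longlonglongrightarrow> measure M1 (\<Union>n. {y<..y + real n})"
      by (rule M1.finite_Lim_measure_incseq) (auto simp: incseq_def)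
    also have "(\<Union>n. {y<..y + real n}) = {y<..}"
      using real_arch_simple[of "_ - y"] by (auto simp: algebra_simps)
    finally show "(\<lambda>n. measure M1 {y<..y + real n}) \<longlonglongrightarrow> measure M1 {y<..}" .
    show "\<exists>n0. \<forall>n\<ge>n0. measure M1 {y<..y + real n} \<le> Q_fun (y / \<sigma>) + err"
    proof (intro exI allI impI)
      fix n :: nat
      have "measure M1 {y<..y + real n} \<le> measure M2 {y<..y + real n} + err"
        using char_diff_interval_bound[OF M1.real_distribution_axioms M2.real_distribution_axioms
            _ atom1 atom1 atom2 atom2 B_int B0 close, of y "y + real n"] unfolding err_def by simp
      also have "measure M2 {y<..y + real n} \<le> measure M2 {y..}"
        by (rule M2.finite_measure_mono) auto
      also have "measure M2 {y..} = measure N ((\<lambda>z. \<sigma> * z) -` {y..} \<inter> space N)"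
        unfolding M2_def by (rule measure_distr) auto
      also have "(\<lambda>z. \<sigma> * z) -` {y..} \<inter> space N = {y / \<sigma>..}"
        using \<sigma> by (auto simp: field_simps)
      also have "measure N {y / \<sigma>..} = Q_fun (y / \<sigma>)"
        by (simp add: Q_fun_eq_measure N_def)
      finally show "measure M1 {y<..y + real n} \<le> Q_fun (y / \<sigma>) + err" by simp
    qed
  qed
  moreover have "measure M1 {y..} = measure M1 {y<..}"
  proof -
    have "{y..} = {y} \<union> {y<..}" by auto
    moreover have "measure M1 ({y} \<union> {y<..}) = measure M1 {y} + measure M1 {y<..}"
      by (rule M1.finite_measure_Union) auto
    ultimately show ?thesis using atom1[of y] by simp
  qed
  ultimately have main: "measure M1 {y..} \<le> Q_fun (y / \<sigma>) + err" by simp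
  have "prob {\<omega> \<in> space M. y + s \<le> S \<omega>} = measure \<mu> {y + s..}"
    unfolding \<mu>_def by (subst measure_distr) (auto intro!: arg_cong[where f=prob])
  also have "\<dots> = measure (distr P \<mu> fst) {y + s..}"
    unfolding P_def N.distr_pair_fst ..
  also have "\<dots> = measure P (fst -` {y + s..} \<inter> space P)"
    unfolding P_def by (rule measure_distr) auto
  also have "\<dots> \<le> measure P (((\<lambda>p. fst p + (- \<tau>) * snd p) -` {y..} \<inter> space P) \<union> (snd -` {s / \<tau>..} \<inter> space P))"
  proof (rule P'.finite_measure_mono)
    show "fst -` {y + s..} \<inter> space P \<subseteq> (((\<lambda>p. fst p + (- \<tau>) * snd p) -` {y..} \<inter> space P) \<union> (snd -` {s / \<tau>..} \<inter> space P))"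
      using \<tau> by (auto simp: field_simps)
  qed measurable
  also have "\<dots> \<le> measure P ((\<lambda>p. fst p + (- \<tau>) * snd p) -` {y..} \<inter> space P) + measure P (snd -` {s / \<tau>..} \<inter> space P)"
    by (rule measure_Un_le) measurable
  also have "measure P ((\<lambda>p. fst p + (- \<tau>) * snd p) -` {y..} \<inter> space P) = measure M1 {y..}"
    unfolding M1_def by (rule measure_distr[symmetric]) measurable
  also have "measure P (snd -` {s / \<tau>..} \<inter> space P) = measure (distr P N snd) {s / \<tau>..}"
    unfolding P_def by (rule measure_distr[symmetric]) auto
  also have "\<dots> = Q_fun (s / \<tau>)"
    unfolding P_def distr_pair_snd[OF \<mu>.prob_space_axioms N.prob_space_axioms]
    by (simp add: N_def Q_fun_eq_measure)
  also have "\<dots> \<le> sqrt 2 * exp (- (s / \<tau>)\<^sup>2 / 4)"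
    using s \<tau> by (intro Q_fun_tail) simp
  finally show ?thesis
    using main unfolding S_def err_def B_eq \<sigma>_def by linarith
qed

subsection \<open>Feinstein's lemma\<close>

text \<open>A code that cannot be extended has decoding regions of total output probability at least
  \<open>\<epsilon> - \<delta>\<close>, hence at least \<open>(\<epsilon> - \<delta>) / \<beta>\<close> codewords.\<close>
lemma feinstein:
  fixes W :: "'c \<Rightarrow> 'y measure" and G :: "'c \<Rightarrow> 'y set" and \<beta> \<delta> \<epsilon> :: real
  assumes C: "finite C" "C \<noteq> {}"
    and W: "\<And>c. c \<in> C \<Longrightarrow> prob_space (W c)" "\<And>c. c \<in> C \<Longrightarrow> sets (W c) = sets N"
    and G: "\<And>c. c \<in> C \<Longrightarrow> G c \<in> sets N"
    and correct: "(1 - \<delta>) * card C \<le> (\<Sum>c\<in>C. measure (W c) (G c))"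
    and confuse: "\<And>c'. c' \<in> C \<Longrightarrow> (\<Sum>c\<in>C. measure (W c) (G c')) \<le> \<beta> * card C"
    and \<epsilon>: "\<delta> + real m * \<beta> \<le> \<epsilon>" and \<beta>: "0 \<le> \<beta>"
  shows "\<exists>enc D. enc \<in> {1..m} \<rightarrow> C \<and> disjoint_family_on D {1..m} \<and>
    (\<forall>k\<in>{1..m}. D k \<in> sets N \<and> D k \<subseteq> G (enc k) \<and> 1 - \<epsilon> \<le> measure (W (enc k)) (D k))"
  using \<epsilon>
proof (induction m)
  case 0
  then show ?case by (auto simp: disjoint_family_on_def)
next
  case (Suc m)
  \<comment> \<open>The target \<open>\<epsilon>\<close> stays fixed during the induction, so
    regions found earlier remain valid when the code grows.\<close>
  then have "\<delta> + real m * \<beta> \<le> \<epsilon>" using \<beta> by (simp add: algebra_simps)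
  from Suc.IH[OF this] obtain enc D where enc: "enc \<in> {1..m} \<rightarrow> C" and disj: "disjoint_family_on D {1..m}"
    and D: "\<And>k. k \<in> {1..m} \<Longrightarrow> D k \<in> sets N" "\<And>k. k \<in> {1..m} \<Longrightarrow> D k \<subseteq> G (enc k)"
      "\<And>k. k \<in> {1..m} \<Longrightarrow> 1 - \<epsilon> \<le> measure (W (enc k)) (D k)" by blast
  have encC: "enc k \<in> C" if "k \<in> {1..m}" for k using enc that by auto
  define U where "U = (\<Union>k\<in>{1..m}. D k)"
  have U: "U \<in> sets N" unfolding U_def using D by auto
  have W_U: "measure (W c) U \<le> (\<Sum>k\<in>{1..m}. measure (W c) (G (enc k)))" if c: "c \<in> C" for c
  proof -
    interpret prob_space "W c" using W c by blast
    have "measure (W c) U \<le> (\<Sum>k\<in>{1..m}. measure (W c) (D k))"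
      unfolding U_def using D W(2)[OF c] by (intro finite_measure_subadditive_finite) auto
    \<comment> \<open>Enlarging \<open>D k\<close> to \<open>G (enc k)\<close> is what makes
      \<open>confuse\<close> applicable to the occupied part \<open>U\<close> of the output
      space.\<close>
    also have "\<dots> \<le> (\<Sum>k\<in>{1..m}. measure (W c) (G (enc k)))"
      using D G[OF encC] W(2)[OF c] by (intro sum_mono finite_measure_mono) auto
    finally show ?thesis .
  qed
  have "\<exists>c\<in>C. 1 - \<epsilon> \<le> measure (W c) (G c - U)"
  proof (rule ccontr)
    assume "\<not> ?thesis"
    then have less: "measure (W c) (G c - U) < 1 - \<epsilon>" if "c \<in> C" for c using that by auto
    have "(\<Sum>c\<in>C. measure (W c) (G c) - measure (W c) U) < (\<Sum>c\<in>C. 1 - \<epsilon>)"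
    proof (rule sum_strict_mono[OF C])
      fix c assume c: "c \<in> C"
      interpret prob_space "W c" using W c by blast
      have "measure (W c) (G c) \<le> measure (W c) ((G c - U) \<union> U)"
        using G U W(2) c by (intro finite_measure_mono) auto
      also have "\<dots> \<le> measure (W c) (G c - U) + measure (W c) U"
        using G U W(2) c by (intro measure_Un_le) auto
      finally show "measure (W c) (G c) - measure (W c) U < 1 - \<epsilon>" using less[OF c] by linarith
    qed
    moreover have "(\<Sum>c\<in>C. measure (W c) U) \<le> real m * (\<beta> * card C)"
    proof -
      have "(\<Sum>c\<in>C. measure (W c) U) \<le> (\<Sum>k\<in>{1..m}. \<Sum>c\<in>C. measure (W c) (G (enc k)))"
        by (subst sum.swap) (intro sum_mono W_U)
      also have "\<dots> \<le> (\<Sum>k\<in>{1..m}. \<beta> * card C)"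
        using enc by (intro sum_mono confuse) auto
      finally show ?thesis by simp
    qed
    ultimately have "(1 - \<delta>) * card C - real m * (\<beta> * card C) < (1 - \<epsilon>) * card C"
      using correct by (simp add: sum_subtractf mult.commute)
    then have "(\<epsilon> - (\<delta> + real m * \<beta>)) * card C < 0" by (simp add: algebra_simps)
    moreover have "0 \<le> (\<epsilon> - (\<delta> + real m * \<beta>)) * card C"
      using \<open>\<delta> + real m * \<beta> \<le> \<epsilon>\<close> by (intro mult_nonneg_nonneg) auto
    ultimately show False by linarith
  qed
  then obtain c where c: "c \<in> C" "1 - \<epsilon> \<le> measure (W c) (G c - U)" by blast
  show ?case
  proof (intro exI conjI)
    show "enc(Suc m := c) \<in> {1..Suc m} \<rightarrow> C" using enc c by auto
    show "disjoint_family_on (D(Suc m := G c - U)) {1..Suc m}"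
    proof -
      have "disjoint_family_on (D(Suc m := G c - U)) {1..m}"
        using disj by (auto simp: disjoint_family_on_def)
      then have "disjoint_family_on (D(Suc m := G c - U)) (insert (Suc m) {1..m})"
        by (subst disjoint_family_on_insert) (auto simp: U_def)
      then show ?thesis by (simp add: atLeastAtMostSuc_conv)
    qed
    show "\<forall>k\<in>{1..Suc m}. (D(Suc m := G c - U)) k \<in> sets N \<and> (D(Suc m := G c - U)) k \<subseteq> G ((enc(Suc m := c)) k) \<and>
        1 - \<epsilon> \<le> measure (W ((enc(Suc m := c)) k)) ((D(Suc m := G c - U)) k)"
    proof
      fix k assume "k \<in> {1..Suc m}"
      then consider "k = Suc m" | "k \<in> {1..m}" "k \<noteq> Suc m" by fastforce
      then show "(D(Suc m := G c - U)) k \<in> sets N \<and> (D(Suc m := G c - U)) k \<subseteq> G ((enc(Suc m := c)) k) \<and>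
        1 - \<epsilon> \<le> measure (W ((enc(Suc m := c)) k)) ((D(Suc m := G c - U)) k)"
        using D c G[OF c(1)] U by cases auto
    qed
  qed
qed

lemma decoder_of_regions:
  fixes D :: "nat \<Rightarrow> 'y set"
  assumes disj: "disjoint_family_on D {1..M}" and D: "\<And>k. k \<in> {1..M} \<Longrightarrow> D k \<in> sets N"
    and M: "1 \<le> M"
  shows "\<exists>dec. dec \<in> N \<rightarrow>\<^sub>M count_space {1..M} \<and> (\<forall>k\<in>{1..M}. \<forall>y\<in>D k. dec y = k)"
proof -
  \<comment> \<open>The search for the first region containing \<open>y\<close> is closed off at
    \<open>M\<close>, the default answer for outputs in no region. With \<open>min k M\<close>, the
    predicate is for each \<open>k\<close> either membership in a single region or constant, hence
    measurable, and \<open>LEAST\<close> always has a witness.\<close>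
  define P where "P = (\<lambda>y k. 1 \<le> k \<and> (y \<in> D (min k M) \<or> M \<le> k))"
  define dec where "dec = (\<lambda>y. LEAST k. P y k)"
  have PM: "P y M" for y using M by (simp add: P_def)
  have P_dec: "P y (dec y)" for y unfolding dec_def by (rule LeastI[of "P y", OF PM])
  have dec_le: "P y k \<Longrightarrow> dec y \<le> k" for y k unfolding dec_def by (rule Least_le[of "P y"])
  have "dec y = k" if "k \<in> {1..M}" "y \<in> D k" for k y
  proof -
    have "dec y \<le> k" by (rule dec_le) (use that in \<open>auto simp: P_def\<close>)
    moreover have False if "dec y < k"
    proof -
      have "dec y \<in> {1..M}" "y \<in> D (dec y)"
        using P_dec[of y] that \<open>k \<in> {1..M}\<close> by (auto simp: P_def min_def)
      then show False
        using disjoint_family_onD[OF disj, of "dec y" k] that \<open>k \<in> {1..M}\<close> \<open>y \<in> D k\<close> by auto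
    qed
    ultimately show ?thesis by (meson le_neq_implies_less)
  qed
  have D': "D (min k M) \<in> sets N" if "1 \<le> k" for k using D that M by auto
  have "{y \<in> space N. P y k} \<in> sets N" for k
  proof (cases "1 \<le> k \<and> \<not> M \<le> k")
    case True
    then have "{y \<in> space N. P y k} = D (min k M)"
      using sets.sets_into_space[OF D'[of k]] by (auto simp: P_def)
    then show ?thesis using D'[of k] True by metis
  next
    case False
    then have "P y k = (1 \<le> k)" for y by (auto simp: P_def)
    then show ?thesis by simp
  qed
  then have dec_N: "dec \<in> N \<rightarrow>\<^sub>M count_space UNIV"
    unfolding dec_def by (intro measurable_Least) (simp add: pred_def)
  have "dec -` {a} \<inter> space N \<in> sets N" for a
    by (rule measurable_sets[OF dec_N]) simp
  moreover have "dec \<in> space N \<rightarrow> {1..M}" using P_dec dec_le[OF PM] by (auto simp: P_def)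
  ultimately have "dec \<in> N \<rightarrow>\<^sub>M count_space {1..M}"
    unfolding measurable_count_space_eq2[OF finite_atLeastAtMost] by blast
  with \<open>\<And>y k. k \<in> {1..M} \<Longrightarrow> y \<in> D k \<Longrightarrow> dec y = k\<close> show ?thesis by blast
qed

subsection \<open>A single channel use\<close>

lemma prob_space_law_int: "prob_space (law_int A B)"
proof -
  interpret G: prob_space cgauss by (rule prob_space_cgauss)
  interpret UB: prob_space "unif B" by (rule prob_space_measure_pmf)
  interpret UA: prob_space "unif A" by (rule prob_space_measure_pmf)
  interpret BG: pair_prob_space "unif B" cgauss ..
  interpret ABG: pair_prob_space "unif A" "unif B \<Otimes>\<^sub>M cgauss" ..
  show ?thesis unfolding law_int_def by (rule ABG.prob_space_axioms)
qed

lemma sets_law_int [measurable_cong]: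
  "sets (law_int A B) = sets (count_space UNIV \<Otimes>\<^sub>M (count_space UNIV \<Otimes>\<^sub>M borel))"
  unfolding law_int_def by (intro sets_pair_measure_cong) auto

lemma law_int_components [measurable]:
  "fst \<in> law_int A B \<rightarrow>\<^sub>M borel" "(\<lambda>w. fst (snd w)) \<in> law_int A B \<rightarrow>\<^sub>M borel"
  "(\<lambda>w. snd (snd w)) \<in> law_int A B \<rightarrow>\<^sub>M borel"
proof -
  have id: "(\<lambda>x. x) \<in> count_space UNIV \<rightarrow>\<^sub>M (borel :: complex measure)" by simp
  have 1: "fst \<in> law_int A B \<rightarrow>\<^sub>M count_space UNIV"
    "(\<lambda>w. fst (snd w)) \<in> law_int A B \<rightarrow>\<^sub>M count_space UNIV" by measurable
  from measurable_compose[OF 1(1) id] measurable_compose[OF 1(2) id]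
  show "fst \<in> law_int A B \<rightarrow>\<^sub>M borel" "(\<lambda>w. fst (snd w)) \<in> law_int A B \<rightarrow>\<^sub>M borel" by auto
  show "(\<lambda>w. snd (snd w)) \<in> law_int A B \<rightarrow>\<^sub>M borel" by measurable
qed

text \<open>Up to the factor \<open>1 / (pi * card B)\<close>, the density of interference plus
  noise. It enters \<open>ratio\<close> only through quotients, so the normalisation is left
  out.\<close>

definition mix :: "complex set \<Rightarrow> complex \<Rightarrow> complex \<Rightarrow> real" where
  "mix B h u = (\<Sum>b\<in>B. exp (- (cmod (u - h * b))\<^sup>2))"

definition ratio :: "complex set \<Rightarrow> complex set \<Rightarrow> complex \<Rightarrow> complex \<Rightarrow> complex \<Rightarrow> real" where
  "ratio A B h a y = real (card A) * mix B h (y - h * a) / (\<Sum>a'\<in>A. mix B h (y - h * a'))"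

definition chan_out :: "complex \<Rightarrow> complex \<times> complex \<times> complex \<Rightarrow> complex" where
  "chan_out h = (\<lambda>(x, x1, z). h * (x1 + x) + z)"

lemma mix_measurable [measurable]: "mix B h \<in> borel_measurable borel"
  unfolding mix_def by measurable

lemma ratio_measurable [measurable]: "ratio A B h a \<in> borel_measurable borel"
  unfolding ratio_def by measurable

lemma chan_out_measurable [measurable]: "chan_out h \<in> borel_measurable (law_int A B)"
  unfolding chan_out_def case_prod_beta' by measurable

lemma mix_pos: "finite B \<Longrightarrow> B \<noteq> {} \<Longrightarrow> 0 < mix B h u"
  unfolding mix_def by (rule sum_pos) auto

lemma ratio_pos:
  assumes "finite A" "A \<noteq> {}" "finite B" "B \<noteq> {}"
  shows "0 < ratio A B h a y"
  using assms unfolding ratio_def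
  by (intro divide_pos_pos mult_pos_pos sum_pos mix_pos) (auto simp: card_gt_0_iff)

text \<open>\<open>L_int\<close> is written with the interference and the noise, neither of which
  the decoder observes. They enter only through the channel output, so that comparing the
  information density with a threshold is a legitimate decoding rule.\<close>

lemma L_int_eq_ratio:
  assumes "A \<noteq> {}" "finite A"
  shows "L_int A B h x x1 z = real (card A) / ratio A B h x (chan_out h (x, x1, z))"
proof -
  have "mix B h (chan_out h (x, x1, z) - h * a) = (\<Sum>b\<in>B. exp (- (cmod (z + h * (x - a + x1 - b)))\<^sup>2))" for a
    by (simp add: mix_def chan_out_def algebra_simps)
  then show ?thesis
    using assms by (simp add: L_int_def ratio_def)
qed

lemma nn_integral_chan_out:
  assumes A: "finite A" "A \<noteq> {}" and B: "finite B" "B \<noteq> {}"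
    and f [measurable]: "f \<in> borel_measurable borel"
  shows "(\<integral>\<^sup>+w. f (chan_out h w) \<partial>law_int A B)
    = (\<integral>\<^sup>+y. ennreal ((\<Sum>a\<in>A. mix B h (y - h * a)) / (pi * card A * card B)) * f y \<partial>lborel)"
proof -
  interpret G: prob_space cgauss by (rule prob_space_cgauss)
  interpret UB: prob_space "unif B" by (rule prob_space_measure_pmf)
  interpret BG: pair_prob_space "unif B" cgauss ..
  have meas: "(\<lambda>w. f (chan_out h w)) \<in> borel_measurable (law_int A B)" by measurable
  have meas2: "(\<lambda>n. f (chan_out h (x, n))) \<in> borel_measurable (unif B \<Otimes>\<^sub>M cgauss)" for x
    by (rule measurable_compose[OF _ meas]) (simp add: law_int_def)
  define e where "e = (\<lambda>z. exp (- (cmod z)\<^sup>2))"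
  have [measurable]: "e \<in> borel_measurable borel" unfolding e_def by measurable
  have z: "(\<integral>\<^sup>+z. f (chan_out h (a, b, z)) \<partial>cgauss) = (\<integral>\<^sup>+y. ennreal (1 / pi * e (y - h * a - h * b)) * f y \<partial>lborel)" for a b
  proof -
    have "(\<integral>\<^sup>+z. f (chan_out h (a, b, z)) \<partial>cgauss) = (\<integral>\<^sup>+z. ennreal (1 / pi * e z) * f (h * (b + a) + z) \<partial>lborel)"
      unfolding cgauss_def chan_out_def e_def by (subst nn_integral_density) auto
    also have "\<dots> = (\<integral>\<^sup>+y. ennreal (1 / pi * e (y - h * a - h * b)) * f y \<partial>lborel)"
      using lborel_shift[of "\<lambda>y. ennreal (1 / pi * e (y - h * a - h * b)) * f y" "h * (b + a)"]
      by (simp add: algebra_simps)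
    finally show ?thesis .
  qed
  have cA: "real (card A) > 0" and cB: "real (card B) > 0" using A B by (auto simp: card_gt_0_iff)
  have "(\<integral>\<^sup>+w. f (chan_out h w) \<partial>law_int A B) = (\<integral>\<^sup>+a. \<integral>\<^sup>+n. f (chan_out h (a, n)) \<partial>(unif B \<Otimes>\<^sub>M cgauss) \<partial>unif A)"
    using meas unfolding law_int_def by (rule BG.nn_integral_fst[symmetric])
  also have "\<dots> = (\<integral>\<^sup>+a. \<integral>\<^sup>+b. \<integral>\<^sup>+z. f (chan_out h (a, b, z)) \<partial>cgauss \<partial>unif B \<partial>unif A)"
    using meas2 by (intro nn_integral_cong G.nn_integral_fst[symmetric])
  also have "\<dots> = (\<Sum>a\<in>A. (\<Sum>b\<in>B. \<integral>\<^sup>+y. ennreal (1 / pi * e (y - h * a - h * b)) * f y \<partial>lborel) / card B) / card A"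
    unfolding z using A B by (simp add: nn_integral_pmf_of_set)
  also have "\<dots> = (\<integral>\<^sup>+y. (\<Sum>a\<in>A. (\<Sum>b\<in>B. ennreal (1 / pi * e (y - h * a - h * b)) * f y) / card B) / card A \<partial>lborel)"
    by (subst nn_integral_divide, simp, subst nn_integral_sum, simp, subst nn_integral_divide, simp)
      (simp add: nn_integral_sum)
  also have "\<dots> = (\<integral>\<^sup>+y. ennreal ((\<Sum>a\<in>A. mix B h (y - h * a)) / (pi * card A * card B)) * f y \<partial>lborel)"
  proof (rule nn_integral_cong)
    fix y
    have "(\<Sum>a\<in>A. (\<Sum>b\<in>B. ennreal (1 / pi * e (y - h * a - h * b)) * f y) / card B) / card A
        = (\<Sum>a\<in>A. (\<Sum>b\<in>B. ennreal (1 / pi * e (y - h * a - h * b))) / card B) / card A * f y"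
      unfolding divide_ennreal_def by (simp only: sum_distrib_left mult_ac)
    also have "(\<Sum>a\<in>A. (\<Sum>b\<in>B. ennreal (1 / pi * e (y - h * a - h * b))) / card B) / card A
       = ennreal ((\<Sum>a\<in>A. (\<Sum>b\<in>B. 1 / pi * e (y - h * a - h * b)) / card B) / card A)"
      using cA cB
      by (simp add: e_def ennreal_of_nat_eq_real_of_nat divide_ennreal sum_nonneg)
    also have "(\<Sum>a\<in>A. (\<Sum>b\<in>B. 1 / pi * e (y - h * a - h * b)) / card B) / card A
        = (\<Sum>a\<in>A. mix B h (y - h * a)) / (pi * card A * card B)"
      by (simp add: mix_def e_def sum_divide_distrib mult_ac)
    finally show "(\<Sum>a\<in>A. (\<Sum>b\<in>B. ennreal (1 / pi * e (y - h * a - h * b)) * f y) / card B) / card A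
        = ennreal ((\<Sum>a\<in>A. mix B h (y - h * a)) / (pi * card A * card B)) * f y" .
  qed
  finally show ?thesis .
qed

text \<open>The ratio is the density of the output given \<open>a\<close> relative to the output law.\<close>
lemma nn_integral_ratio:
  assumes A: "finite A" "A \<noteq> {}" and B: "finite B" "B \<noteq> {}"
  shows "(\<integral>\<^sup>+w. ennreal (ratio A B h a (chan_out h w)) \<partial>law_int A B) = 1"
proof -
  have cA: "real (card A) > 0" and cB: "real (card B) > 0" using A B by (auto simp: card_gt_0_iff)
  have "(\<integral>\<^sup>+w. ennreal (ratio A B h a (chan_out h w)) \<partial>law_int A B)
      = (\<integral>\<^sup>+y. ennreal ((\<Sum>a\<in>A. mix B h (y - h * a)) / (pi * card A * card B)) * ennreal (ratio A B h a y) \<partial>lborel)"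
    by (rule nn_integral_chan_out[OF A B]) measurable
  also have "\<dots> = (\<integral>\<^sup>+y. ennreal (1 / (pi * card B)) * (\<Sum>b\<in>B. ennreal (exp (- 1 * (cmod (- h * a - h * b + y))\<^sup>2))) \<partial>lborel)"
  proof (rule nn_integral_cong)
    fix y
    have "(\<Sum>a\<in>A. mix B h (y - h * a)) > 0" using A B by (intro sum_pos mix_pos) auto
    then have "(\<Sum>a\<in>A. mix B h (y - h * a)) / (pi * card A * card B) * ratio A B h a y
       = 1 / (pi * card B) * mix B h (y - h * a)"
      using cA cB by (simp add: ratio_def field_simps)
    moreover have "ennreal (mix B h (y - h * a)) = (\<Sum>b\<in>B. ennreal (exp (- 1 * (cmod (- h * a - h * b + y))\<^sup>2)))"
      by (simp add: mix_def algebra_simps)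
    ultimately show "ennreal ((\<Sum>a\<in>A. mix B h (y - h * a)) / (pi * card A * card B)) * ennreal (ratio A B h a y)
      = ennreal (1 / (pi * card B)) * (\<Sum>b\<in>B. ennreal (exp (- 1 * (cmod (- h * a - h * b + y))\<^sup>2)))"
      using less_imp_le[OF ratio_pos[OF A B]] less_imp_le[OF mix_pos[OF B]]
      by (metis (no_types, lifting) ennreal_mult'' )
  qed
  also have "\<dots> = ennreal (1 / (pi * card B)) * (\<Sum>b\<in>B. \<integral>\<^sup>+y. ennreal (exp (- 1 * (cmod (- h * a - h * b + y))\<^sup>2)) \<partial>lborel)"
    by (subst nn_integral_cmult) (auto simp: nn_integral_sum simp del: sum_ennreal)
  also have "\<dots> = ennreal (1 / (pi * card B)) * (\<Sum>b\<in>B. ennreal pi)"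
    by (subst lborel_shift[of "\<lambda>y. ennreal (exp (- 1 * (cmod y)\<^sup>2))"], simp)
       (use nn_integral_exp_cmod[of 1] in simp)
  also have "\<dots> = 1"
    using cB by (simp add: ennreal_of_nat_eq_real_of_nat ennreal_mult[symmetric])
  finally show ?thesis .
qed

section \<open>Moments of the information loss\<close>

lemma (in prob_space)
  fixes X :: "'a \<Rightarrow> real"
  assumes [measurable]: "random_variable borel X" and third: "integrable M (\<lambda>\<omega>. \<bar>X \<omega>\<bar> ^ 3)"
  shows integrable_of_third: "integrable M X"
    and integrable_square_of_third: "integrable M (\<lambda>\<omega>. (X \<omega>)\<^sup>2)"
    and integrable_shift_third: "integrable M (\<lambda>\<omega>. \<bar>X \<omega> - m\<bar> ^ 3)"
proof -
  have int: "integrable M (\<lambda>\<omega>. 1 + \<bar>X \<omega>\<bar> ^ 3)" "integrable M (\<lambda>\<omega>. 8 * (\<bar>X \<omega>\<bar> ^ 3 + \<bar>m\<bar> ^ 3))"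
    using third by simp_all
  have bounds: "\<bar>x\<bar> \<le> 1 + \<bar>x\<bar> ^ 3" "x\<^sup>2 \<le> 1 + \<bar>x\<bar> ^ 3" for x :: real
  proof -
    have "\<bar>x\<bar> ^ k \<le> 1 + \<bar>x\<bar> ^ 3" if "k \<le> 3" for k
    proof (cases "\<bar>x\<bar> \<le> 1")
      case True
      then have "\<bar>x\<bar> ^ k \<le> 1" by (simp add: power_le_one)
      then show ?thesis using zero_le_power[of "\<bar>x\<bar>" 3] by linarith
    next
      case False
      then have "\<bar>x\<bar> ^ k \<le> \<bar>x\<bar> ^ 3" using that by (intro power_increasing) auto
      then show ?thesis by simp
    qed
    from this[of 1] this[of 2] show "\<bar>x\<bar> \<le> 1 + \<bar>x\<bar> ^ 3" "x\<^sup>2 \<le> 1 + \<bar>x\<bar> ^ 3" by simp_all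
  qed
  show "integrable M X"
    by (rule Bochner_Integration.integrable_bound[OF int(1)]) (use bounds(1) in auto)
  show "integrable M (\<lambda>\<omega>. (X \<omega>)\<^sup>2)"
    by (rule Bochner_Integration.integrable_bound[OF int(1)]) (use bounds(2) in auto)
  have "\<bar>x - m\<bar> ^ 3 \<le> 8 * (\<bar>x\<bar> ^ 3 + \<bar>m\<bar> ^ 3)" for x
  proof -
    have "\<bar>x - m\<bar> ^ 3 \<le> (2 * max \<bar>x\<bar> \<bar>m\<bar>) ^ 3" by (intro power_mono) auto
    also have "\<dots> = 8 * (max \<bar>x\<bar> \<bar>m\<bar>) ^ 3" by (simp add: power_mult_distrib)
    also have "\<dots> \<le> 8 * (\<bar>x\<bar> ^ 3 + \<bar>m\<bar> ^ 3)" by (simp add: max_def)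
    finally show ?thesis .
  qed
  then show "integrable M (\<lambda>\<omega>. \<bar>X \<omega> - m\<bar> ^ 3)"
    by (intro Bochner_Integration.integrable_bound[OF int(2)]) auto
qed

text \<open>With zero variance, \<open>X\<close> is almost surely constant, both sides vanish and
  any \<open>K\<close> will do; otherwise \<open>K\<close> is the quotient of the two moments. The
  degenerate case does occur: a one-point constellation has information loss 0 almost
  surely.\<close>

lemma (in prob_space) third_moment_le_variance:
  fixes X :: "'a \<Rightarrow> real"
  assumes [measurable]: "random_variable borel X" and third: "integrable M (\<lambda>\<omega>. \<bar>X \<omega>\<bar> ^ 3)"
  shows "\<exists>K\<ge>0. expectation (\<lambda>\<omega>. \<bar>X \<omega> - expectation X\<bar> ^ 3) \<le> K * variance X"
proof (cases "variance X = 0")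
  case True
  have "integrable M (\<lambda>\<omega>. (X \<omega> - expectation X)\<^sup>2)"
    by (rule integrable_square_of_third) (simp_all add: integrable_shift_third third)
  with True have "AE \<omega> in M. (X \<omega> - expectation X)\<^sup>2 = 0"
    by (subst integral_nonneg_eq_0_iff_AE[symmetric]) auto
  then have "AE \<omega> in M. \<bar>X \<omega> - expectation X\<bar> ^ 3 = 0" by eventually_elim simp
  then have "expectation (\<lambda>\<omega>. \<bar>X \<omega> - expectation X\<bar> ^ 3) = expectation (\<lambda>_. 0)"
    by (intro integral_cong_AE) auto
  then show ?thesis by auto
next
  case False
  then have pos: "variance X > 0" using variance_positive[of X] by linarith
  define T where "T = expectation (\<lambda>\<omega>. \<bar>X \<omega> - expectation X\<bar> ^ 3)"
  have "0 \<le> T" unfolding T_def by (rule Bochner_Integration.integral_nonneg) simp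
  with pos have "0 \<le> T / variance X" "T \<le> T / variance X * variance X" by simp_all
  then show ?thesis unfolding T_def by blast
qed

definition info_loss :: "complex set \<Rightarrow> complex set \<Rightarrow> complex \<Rightarrow> complex \<times> complex \<times> complex \<Rightarrow> real" where
  "info_loss A B h = (\<lambda>(x, x1, z). log 2 (L_int A B h x x1 z))"

lemma info_loss_measurable [measurable]: "info_loss A B h \<in> borel_measurable (law_int A B)"
  unfolding info_loss_def L_int_def case_prod_beta' by measurable

lemma AE_law_int:
  assumes A: "finite A" "A \<noteq> {}" and B: "finite B" "B \<noteq> {}"
  shows "AE w in law_int A B. fst w \<in> A \<and> fst (snd w) \<in> B"
proof -
  interpret G: prob_space cgauss by (rule prob_space_cgauss)
  interpret UB: prob_space "unif B" by (rule prob_space_measure_pmf)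
  interpret UA: prob_space "unif A" by (rule prob_space_measure_pmf)
  interpret BG: pair_prob_space "unif B" cgauss ..
  interpret ABG: pair_prob_space "unif A" "unif B \<Otimes>\<^sub>M cgauss" ..
  have uA: "AE x in unif A. x \<in> A" and uB: "AE x in unif B. x \<in> B"
    using A B by (auto simp: AE_measure_pmf_iff)
  have n: "AE n in unif B \<Otimes>\<^sub>M cgauss. fst n \<in> B"
  proof (rule BG.AE_pair_measure)
    have "{n \<in> space (unif B \<Otimes>\<^sub>M cgauss). fst n \<in> B} = B \<times> space cgauss"
      by (auto simp: space_pair_measure)
    then show "{n \<in> space (unif B \<Otimes>\<^sub>M cgauss). fst n \<in> B} \<in> sets (unif B \<Otimes>\<^sub>M cgauss)"
      by (simp only:) (intro pair_measureI; simp only: sets_measure_pmf UNIV_I sets.top)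
    show "AE x in unif B. AE y in cgauss. fst (x, y) \<in> B" using uB by eventually_elim simp
  qed
  show ?thesis
    unfolding law_int_def
  proof (rule ABG.AE_pair_measure)
    have "{w \<in> space (unif A \<Otimes>\<^sub>M (unif B \<Otimes>\<^sub>M cgauss)). fst w \<in> A \<and> fst (snd w) \<in> B}
        = A \<times> (B \<times> space cgauss)" by (auto simp: space_pair_measure)
    then show "{w \<in> space (unif A \<Otimes>\<^sub>M (unif B \<Otimes>\<^sub>M cgauss)). fst w \<in> A \<and> fst (snd w) \<in> B}
      \<in> sets (unif A \<Otimes>\<^sub>M (unif B \<Otimes>\<^sub>M cgauss))"
      by (simp only:) (intro pair_measureI; simp only: sets_measure_pmf UNIV_I sets.top)
    show "AE x in unif A. AE n in unif B \<Otimes>\<^sub>M cgauss. fst (x, n) \<in> A \<and> fst (snd (x, n)) \<in> B"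
      using uA
    proof eventually_elim
      case (elim x)
      show ?case using n by eventually_elim (use elim in simp)
    qed
  qed
qed

lemma integrable_law_int_noise:
  fixes f :: "complex \<Rightarrow> real"
  assumes f: "integrable cgauss f"
  shows "integrable (law_int A B) (\<lambda>w. f (snd (snd w)))"
proof -
  interpret G: prob_space cgauss by (rule prob_space_cgauss)
  interpret UB: prob_space "unif B" by (rule prob_space_measure_pmf)
  interpret BG: pair_prob_space "unif B" cgauss ..
  have "integrable (distr (unif B \<Otimes>\<^sub>M cgauss) cgauss snd) f"
    unfolding distr_pair_snd[OF prob_space_measure_pmf G.prob_space_axioms] by (rule f)
  then have "integrable (unif B \<Otimes>\<^sub>M cgauss) (\<lambda>n. f (snd n))"
    by (rule integrable_distr[rotated]) simp
  then have "integrable (distr (law_int A B) (unif B \<Otimes>\<^sub>M cgauss) snd) (\<lambda>n. f (snd n))"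
    unfolding law_int_def distr_pair_snd[OF prob_space_measure_pmf BG.prob_space_axioms] .
  then show ?thesis
    by (rule integrable_distr[rotated]) (simp add: law_int_def)
qed

lemma integrable_cgauss_exp: "integrable cgauss (\<lambda>z. exp ((cmod z)\<^sup>2 / 2))"
proof -
  have "integrable lborel (\<lambda>z::complex. 1 / pi * exp (- (1/2) * (cmod z)\<^sup>2))"
    using nn_integral_exp_cmod[of "1/2"]
    by (intro integrable_mult_right integrableI_nonneg) auto
  moreover have "1 / pi * exp (- (cmod z)\<^sup>2) * exp ((cmod z)\<^sup>2 / 2) = 1 / pi * exp (- (1/2) * (cmod z)\<^sup>2)" for z
    by (simp add: exp_add[symmetric] mult.assoc)
  ultimately have "integrable lborel (\<lambda>z::complex. 1 / pi * exp (- (cmod z)\<^sup>2) * exp ((cmod z)\<^sup>2 / 2))"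
    by simp
  then show ?thesis
    unfolding cgauss_def by (subst integrable_density) auto
qed

text \<open>The summand \<open>x' = x\<close> of the numerator is exactly the denominator, whence
  the lower bound. For the upper one, each numerator term is at most 1, and the denominator is at
  least its term \<open>x1' = x1\<close>, which is \<open>exp (- (cmod z)\<^sup>2)\<close>.\<close>

lemma L_int_bounds:
  assumes A: "finite A" "x \<in> A" and B: "finite B" "x1 \<in> B"
  shows "1 \<le> L_int A B h x x1 z" "L_int A B h x x1 z \<le> real (card A * card B) * exp ((cmod z)\<^sup>2)"
proof -
  define e where "e = (\<lambda>z. exp (- (cmod z)\<^sup>2))"
  have e: "0 < e z" "e z \<le> 1" for z by (auto simp: e_def)
  define den where "den = (\<Sum>x1'\<in>B. e (z + h * (x1 - x1')))"
  define num where "num = (\<lambda>x'. \<Sum>x1'\<in>B. e (z + h * (x - x' + x1 - x1')))"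
  have L: "L_int A B h x x1 z = (\<Sum>x'\<in>A. num x') / den"
    by (simp add: L_int_def num_def den_def e_def)
  have "e (z + h * (x1 - x1)) \<le> den"
    unfolding den_def using B e by (intro member_le_sum) (auto intro: less_imp_le)
  then have den: "e z \<le> den" by simp
  then have den0: "0 < den" using e(1)[of z] by linarith
  have "0 \<le> num x'" for x' unfolding num_def by (intro sum_nonneg less_imp_le[OF e(1)])
  then have "num x \<le> (\<Sum>x'\<in>A. num x')" using A by (intro member_le_sum) auto
  moreover have "num x = den" by (simp add: num_def den_def)
  ultimately show "1 \<le> L_int A B h x x1 z" using den0 by (simp add: L)
  have "(\<Sum>x'\<in>A. num x') \<le> (\<Sum>x'\<in>A. \<Sum>x1'\<in>B. 1)"
    unfolding num_def by (intro sum_mono e)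
  then have "L_int A B h x x1 z \<le> real (card A * card B) / e z"
    unfolding L using den e(1)[of z] by (intro frac_le) auto
  then show "L_int A B h x x1 z \<le> real (card A * card B) * exp ((cmod z)\<^sup>2)"
    by (simp add: e_def exp_minus field_simps)
qed

lemma integrable_info_loss_third:
  assumes A: "finite A" "A \<noteq> {}" and B: "finite B" "B \<noteq> {}"
  shows "integrable (law_int A B) (\<lambda>w. \<bar>info_loss A B h w\<bar> ^ 3)"
proof -
  define c where "c = log 2 (real (card A * card B))"
  \<comment> \<open>The loss is at most \<open>t = c + (cmod z)\<^sup>2 / ln 2\<close>. This
    \<open>s\<close> turns \<open>s * t\<close> into \<open>s * c + (cmod z)\<^sup>2 / 2\<close>,
    half the decay rate of the noise density, so the exponential dominating the cube is still
    integrable.\<close>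
  define s where "s = ln 2 / (2::real)"
  have s: "s > 0" by (simp add: s_def)
  have "integrable (law_int A B) (\<lambda>w. 27 / s ^ 3 * exp (s * c) * exp ((cmod (snd (snd w)))\<^sup>2 / 2))"
    using integrable_law_int_noise[OF integrable_cgauss_exp] by simp
  then show ?thesis
  proof (rule Bochner_Integration.integrable_bound)
    show "AE w in law_int A B. norm (\<bar>info_loss A B h w\<bar> ^ 3)
        \<le> norm (27 / s ^ 3 * exp (s * c) * exp ((cmod (snd (snd w)))\<^sup>2 / 2))"
      using AE_law_int[OF A B]
    proof eventually_elim
      case (elim w)
      define t where "t = c + (cmod (snd (snd w)))\<^sup>2 / ln 2"
      have "real (card A * card B) \<ge> 1"
        using A B by (metis One_nat_def Suc_leI card_gt_0_iff nat_0_less_mult_iff of_nat_1 of_nat_mono)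
      then have le: "\<bar>info_loss A B h w\<bar> \<le> t"
        unfolding info_loss_def case_prod_beta' t_def c_def
        using elim A B by (intro sum_log_bounds L_int_bounds) auto
      then have t: "0 \<le> t" by linarith
      have "\<bar>info_loss A B h w\<bar> ^ 3 \<le> t ^ 3" using le by (intro power_mono) auto
      also have "t ^ 3 = (s * t) ^ 3 / s ^ 3" using s by (simp add: power_mult_distrib)
      also have "(s * t) ^ 3 \<le> 27 * exp (s * t)"
      proof -
        have "s * t \<le> 3 * exp (s * t / 3)" using exp_ge_add_one_self[of "s * t / 3"] by linarith
        then have "(s * t) ^ 3 \<le> (3 * exp (s * t / 3)) ^ 3" using s t by (intro power_mono) auto
        also have "\<dots> = 27 * exp (s * t)" by (simp add: power_mult_distrib exp_of_nat_mult[symmetric])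
        finally show ?thesis .
      qed
      also have "exp (s * t) = exp (s * c) * exp ((cmod (snd (snd w)))\<^sup>2 / 2)"
        by (simp add: t_def s_def exp_add[symmetric] algebra_simps)
      finally show ?case
        using s by (simp add: divide_right_mono mult_ac)
    qed
  qed measurable
qed

text \<open>The uniform law on one point is a point mass, so the missing interference coordinate can
  be inserted by a push-forward; both the mean and the variance of the loss are transported along
  it.\<close>

lemma law_int_trivial_interference:
  "law_int A {0} = distr (law_free A) (law_int A {0}) (\<lambda>(x, z). (x, 0, z))"
proof -
  interpret G: prob_space cgauss by (rule prob_space_cgauss)
  interpret UB: prob_space "unif {0::complex}" by (rule prob_space_measure_pmf)
  interpret BG: pair_prob_space "unif {0::complex}" cgauss ..
  have sp: "space cgauss = UNIV" by (simp add: cgauss_def)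
  have z0: "distr cgauss (unif {0} \<Otimes>\<^sub>M cgauss) (Pair 0) = unif {0::complex} \<Otimes>\<^sub>M cgauss"
  proof (rule measure_eqI)
    fix E assume E: "E \<in> sets (distr cgauss (unif {0::complex} \<Otimes>\<^sub>M cgauss) (Pair 0))"
    then have "emeasure (unif {0::complex} \<Otimes>\<^sub>M cgauss) E = (\<integral>\<^sup>+x. emeasure cgauss (Pair x -` E) \<partial>unif {0})"
      by (intro G.emeasure_pair_measure_alt) simp
    also have "\<dots> = emeasure cgauss (Pair 0 -` E)"
      by (subst nn_integral_pmf_of_set) (auto simp: divide_ennreal_def)
    finally show "emeasure (distr cgauss (unif {0} \<Otimes>\<^sub>M cgauss) (Pair 0)) E = emeasure (unif {0::complex} \<Otimes>\<^sub>M cgauss) E"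
      using E sp by (subst emeasure_distr) simp_all
  qed simp
  have "distr (unif A) (unif A) (\<lambda>x. x) \<Otimes>\<^sub>M distr cgauss (unif {0::complex} \<Otimes>\<^sub>M cgauss) (Pair 0)
      = distr (unif A \<Otimes>\<^sub>M cgauss) (unif A \<Otimes>\<^sub>M (unif {0} \<Otimes>\<^sub>M cgauss)) (\<lambda>(x, z). (x, Pair 0 z))"
    by (rule pair_measure_distr) (auto simp: z0 BG.sigma_finite_measure_axioms)
  then show ?thesis
    by (simp add: z0 law_int_def law_free_def distr_id)
qed

lemma law_free_to_int: "(\<lambda>(x, z). (x, 0, z)) \<in> law_free A \<rightarrow>\<^sub>M law_int A {0}"
  unfolding case_prod_beta' law_free_def law_int_def
  by (intro measurable_Pair measurable_fst measurable_snd measurable_const) auto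

lemma
  assumes A: "finite A" "A \<noteq> {}"
  shows I_free_eq_I_int: "I_free A h = I_int A {0} h"
    and V_free_eq_V_int: "V_free A h = V_int A {0} h"
proof -
  have E: "(\<integral>w. f w \<partial>law_int A {0}) = (\<integral>(x, z). f (x, 0, z) \<partial>law_free A)"
    if f: "f \<in> borel_measurable (law_int A {0})" for f :: "_ \<Rightarrow> real"
    by (subst law_int_trivial_interference, subst integral_distr[OF law_free_to_int f])
      (simp add: case_prod_beta')
  have L: "info_loss A {0} h (x, 0, z) = log 2 (L_free A h x z)" for x z
    by (simp add: info_loss_def L_int_def L_free_def)
  have mean: "(\<integral>w. info_loss A {0} h w \<partial>law_int A {0}) = (\<integral>(x, z). log 2 (L_free A h x z) \<partial>law_free A)"
    by (subst E) (simp_all add: L)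
  show "I_free A h = I_int A {0} h"
    using mean unfolding I_free_eq[OF A] by (subst I_int_eq[OF A]) (auto simp: info_loss_def)
  have "V_int A {0} h = (\<integral>w. (info_loss A {0} h w - (\<integral>w. info_loss A {0} h w \<partial>law_int A {0}))\<^sup>2 \<partial>law_int A {0})"
    unfolding V_int_def info_loss_def ..
  also have "\<dots> = V_free A h"
    unfolding V_free_def mean by (subst E) (simp_all add: L case_prod_beta')
  finally show "V_free A h = V_int A {0} h" ..
qed

subsection \<open>The block channel\<close>

text \<open>The weight \<open>of_nat (card A) * indicator {a} (fst w)\<close> is the density that
  conditions the uniform input on being \<open>a\<close>. As a product over the positions it gives
  the conditioning on a whole codeword.\<close>

lemma nn_integral_law_int_given_input:
  assumes A: "finite A" "a \<in> A" and f [measurable]: "f \<in> borel_measurable borel"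
  shows "(\<integral>\<^sup>+w. of_nat (card A) * indicator {a} (fst w) * f (chan_out h w) \<partial>law_int A B)
    = (\<integral>\<^sup>+b. \<integral>\<^sup>+z. f (h * (b + a) + z) \<partial>cgauss \<partial>unif B)"
proof -
  interpret G: prob_space cgauss by (rule prob_space_cgauss)
  interpret UB: prob_space "unif B" by (rule prob_space_measure_pmf)
  interpret BG: pair_prob_space "unif B" cgauss ..
  have cA: "card A > 0" using A by (auto simp: card_gt_0_iff)
  have [measurable]: "fst \<in> law_int A B \<rightarrow>\<^sub>M count_space UNIV" by measurable
  have meas: "(\<lambda>w. of_nat (card A) * indicator {a} (fst w) * f (chan_out h w)) \<in> borel_measurable (law_int A B)"
    by measurable
  have meas2: "(\<lambda>n. f (chan_out h (a, n))) \<in> borel_measurable (unif B \<Otimes>\<^sub>M cgauss)"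
    by (rule measurable_compose[of "Pair a" _ "law_int A B"], simp add: law_int_def, measurable)
  have "(\<integral>\<^sup>+w. of_nat (card A) * indicator {a} (fst w) * f (chan_out h w) \<partial>law_int A B)
      = (\<integral>\<^sup>+x. \<integral>\<^sup>+n. of_nat (card A) * indicator {a} x * f (chan_out h (x, n)) \<partial>(unif B \<Otimes>\<^sub>M cgauss) \<partial>unif A)"
    using meas unfolding law_int_def by (subst BG.nn_integral_fst[symmetric]) simp_all
  also have "\<dots> = (\<Sum>x\<in>A. \<integral>\<^sup>+n. of_nat (card A) * indicator {a} x * f (chan_out h (x, n)) \<partial>(unif B \<Otimes>\<^sub>M cgauss)) / card A"
    using A by (subst nn_integral_pmf_of_set) auto
  also have "(\<Sum>x\<in>A. \<integral>\<^sup>+n. of_nat (card A) * indicator {a} x * f (chan_out h (x, n)) \<partial>(unif B \<Otimes>\<^sub>M cgauss))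
      = (\<Sum>x\<in>{a}. \<integral>\<^sup>+n. of_nat (card A) * indicator {a} x * f (chan_out h (x, n)) \<partial>(unif B \<Otimes>\<^sub>M cgauss))"
    using A by (intro sum.mono_neutral_right) auto
  also have "\<dots> = of_nat (card A) * (\<integral>\<^sup>+n. f (chan_out h (a, n)) \<partial>(unif B \<Otimes>\<^sub>M cgauss))"
    using meas2 by (simp add: nn_integral_cmult)
  also have "\<dots> / card A = (\<integral>\<^sup>+n. f (chan_out h (a, n)) \<partial>(unif B \<Otimes>\<^sub>M cgauss))"
    using cA by (subst mult.commute) (simp add: ennreal_mult_divide_eq)
  also have "\<dots> = (\<integral>\<^sup>+b. \<integral>\<^sup>+z. f (chan_out h (a, b, z)) \<partial>cgauss \<partial>unif B)"
    using meas2 by (subst G.nn_integral_fst[symmetric]) simp_all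
  finally show ?thesis by (simp add: chan_out_def)
qed

lemma log_ratio:
  assumes "finite A" "A \<noteq> {}" "finite B" "B \<noteq> {}"
  shows "log 2 (ratio A B h (fst w) (chan_out h w)) = log 2 (real (card A)) - info_loss A B h w"
proof -
  obtain x x1 z where w: "w = (x, x1, z)" by (cases w) auto
  have "0 < ratio A B h x (chan_out h w)" "0 < real (card A)"
    using ratio_pos[OF assms] assms by (auto simp: card_gt_0_iff)
  then show ?thesis
    by (simp add: w info_loss_def L_int_eq_ratio[OF assms(2,1)] log_divide)
qed

locale block_channel =
  fixes h :: complex and X1 X21 X22 :: "complex set" and N1 N2 :: nat
  assumes X1: "finite X1" "X1 \<noteq> {}" and X21: "finite X21" "X21 \<noteq> {}" and X22: "finite X22" "X22 \<noteq> {}"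
    and N12: "N1 \<le> N2"
begin

definition alphabet :: "nat \<Rightarrow> complex set" where
  "alphabet j = (if j \<le> N1 then X21 else X22)"

definition interf :: "nat \<Rightarrow> complex set" where
  "interf j = (if j \<le> N1 then X1 else {0})"

definition words :: "(nat \<Rightarrow> complex) set" where
  "words = (\<Pi>\<^sub>E j\<in>{1..N2}. alphabet j)"

definition letter_law :: "nat \<Rightarrow> (complex \<times> complex \<times> complex) measure" where
  "letter_law j = law_int (alphabet j) (interf j)"

text \<open>Law of the triples (symbol, interference, noise) for a codeword drawn uniformly from \<open>words\<close>.\<close>
definition block_law :: "(nat \<Rightarrow> complex \<times> complex \<times> complex) measure" where
  "block_law = PiM {1..N2} letter_law"

definition outs :: "(nat \<Rightarrow> complex) measure" where
  "outs = (\<Pi>\<^sub>M j\<in>{1..N2}. borel)"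

definition noise_law :: "((nat \<Rightarrow> complex) \<times> (nat \<Rightarrow> complex)) measure" where
  "noise_law = (\<Pi>\<^sub>M j\<in>{1..N1}. unif X1) \<Otimes>\<^sub>M (\<Pi>\<^sub>M j\<in>{1..N2}. cgauss)"

definition chan :: "(nat \<Rightarrow> complex) \<Rightarrow> (nat \<Rightarrow> complex) measure" where
  "chan c = distr noise_law outs (\<lambda>(x, z). received h N1 N2 c x z)"

definition block_out :: "(nat \<Rightarrow> complex \<times> complex \<times> complex) \<Rightarrow> nat \<Rightarrow> complex" where
  "block_out \<omega> = (\<lambda>j\<in>{1..N2}. chan_out h (\<omega> j))"

definition info :: "(nat \<Rightarrow> complex) \<Rightarrow> (nat \<Rightarrow> complex) \<Rightarrow> real" where
  "info c y = (\<Sum>j\<in>{1..N2}. log 2 (ratio (alphabet j) (interf j) h (c j) (y j)))"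

lemma alphabet: "finite (alphabet j)" "alphabet j \<noteq> {}"
  using X21 X22 by (auto simp: alphabet_def)

lemma interf: "finite (interf j)" "interf j \<noteq> {}"
  using X1 by (auto simp: interf_def)

lemma words: "finite words" "words \<noteq> {}"
  using alphabet by (auto simp: words_def PiE_eq_empty_iff intro!: finite_PiE)

lemma card_words: "card words = (\<Prod>j\<in>{1..N2}. card (alphabet j))"
  unfolding words_def by (rule card_PiE) simp

sublocale letters: product_prob_space letter_law "{1..N2}"
  unfolding letter_law_def
  by (intro product_prob_spaceI prob_space_law_int)

sublocale block: prob_space block_law
  unfolding block_law_def letter_law_def by (intro prob_space_PiM prob_space_law_int)

lemma prob_space_noise_law: "prob_space noise_law"
proof -
  interpret C: product_prob_space "\<lambda>_::nat. cgauss" "{1..N2}"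
    by (intro product_prob_spaceI prob_space_cgauss)
  interpret U: product_prob_space "\<lambda>_::nat. unif X1" "{1..N1}"
    by (intro product_prob_spaceI prob_space_measure_pmf)
  interpret CP: prob_space "\<Pi>\<^sub>M j\<in>{1..N2}. cgauss" by (intro prob_space_PiM prob_space_cgauss)
  interpret UP: prob_space "\<Pi>\<^sub>M j\<in>{1..N1}. unif X1" by (intro prob_space_PiM prob_space_measure_pmf)
  interpret P: pair_prob_space "\<Pi>\<^sub>M j\<in>{1..N1}. unif X1" "\<Pi>\<^sub>M j\<in>{1..N2}. cgauss" ..
  show ?thesis unfolding noise_law_def by (rule P.prob_space_axioms)
qed

lemma letter_measurable [measurable]:
  "j \<in> {1..N2} \<Longrightarrow> (\<lambda>\<omega>. \<omega> j) \<in> block_law \<rightarrow>\<^sub>M letter_law j"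
  unfolding block_law_def by (rule measurable_component_singleton)

lemma chan_out_letter [measurable]: "chan_out h \<in> borel_measurable (letter_law j)"
  unfolding letter_law_def by measurable

lemma block_out_measurable [measurable]: "block_out \<in> block_law \<rightarrow>\<^sub>M outs"
  unfolding outs_def block_out_def
  by (rule measurable_restrict) measurable

lemma received_measurable: "(\<lambda>(x, z). received h N1 N2 c x z) \<in> noise_law \<rightarrow>\<^sub>M outs"
  unfolding outs_def received_def noise_law_def case_prod_beta'
proof (rule measurable_restrict)
  fix j assume j: "j \<in> {1..N2}"
  let ?Q = "(\<Pi>\<^sub>M j\<in>{1..N1}. unif X1) \<Otimes>\<^sub>M (\<Pi>\<^sub>M j\<in>{1..N2}. cgauss)"
  have "(\<lambda>p. snd p j) \<in> ?Q \<rightarrow>\<^sub>M cgauss"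
    using j by (intro measurable_compose[OF measurable_snd measurable_component_singleton])
  then have z [measurable]: "(\<lambda>p. snd p j) \<in> ?Q \<rightarrow>\<^sub>M borel"
    using measurable_cong_sets[OF refl sets_cgauss] by blast
  show "(\<lambda>p. if j \<le> N1 then h * (fst p j + c j) + snd p j else h * c j + snd p j) \<in> ?Q \<rightarrow>\<^sub>M borel"
  proof (cases "j \<le> N1")
    case True
    then have "(\<lambda>p. fst p j) \<in> ?Q \<rightarrow>\<^sub>M unif X1"
      using j by (intro measurable_compose[OF measurable_fst measurable_component_singleton]) simp
    then have [measurable]: "(\<lambda>p. fst p j) \<in> ?Q \<rightarrow>\<^sub>M borel"
      by (rule measurable_compose) simp
    show ?thesis unfolding if_P[OF True] by measurable
  next
    case False
    show ?thesis unfolding if_not_P[OF False] by measurable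
  qed
qed

lemma prob_space_chan: "prob_space (chan c)"
  unfolding chan_def using prob_space_noise_law received_measurable by (rule prob_space.prob_space_distr)

lemma sets_chan [simp]: "sets (chan c) = sets outs"
  by (simp add: chan_def)

lemma chan_rectangle:
  assumes E: "\<And>j. j \<in> {1..N2} \<Longrightarrow> E j \<in> sets borel"
  shows "emeasure (chan c) (Pi\<^sub>E {1..N2} E)
    = (\<Prod>j\<in>{1..N2}. \<integral>\<^sup>+b. \<integral>\<^sup>+z. indicator (E j) (h * (b + c j) + z) \<partial>cgauss \<partial>unif (interf j))"
proof -
  interpret C: product_prob_space "\<lambda>_::nat. cgauss" "{1..N2}"
    by (intro product_prob_spaceI prob_space_cgauss)
  interpret U: product_prob_space "\<lambda>_::nat. unif X1" "{1..N1}"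
    by (intro product_prob_spaceI prob_space_measure_pmf)
  have sf: "sigma_finite_measure (\<Pi>\<^sub>M j\<in>{1..N2}. cgauss)"
    by (intro prob_space_imp_sigma_finite prob_space_PiM prob_space_cgauss)
  have EP: "Pi\<^sub>E {1..N2} E \<in> sets outs" unfolding outs_def using E by (intro sets_PiM_I_finite) auto
  define g where "g = (\<lambda>j b. \<integral>\<^sup>+z. indicator (E j) (h * (b + c j) + z) \<partial>cgauss)"
  \<comment> \<open>The interference block has only \<open>N1\<close> entries; padding it with 0
    gives all positions the same channel equation and matches \<open>interf j = {0}\<close> after
    \<open>N1\<close>.\<close>
  define q where "q = (\<lambda>x j. if j \<le> N1 then x j else (0::complex))"
  have "emeasure (chan c) (Pi\<^sub>E {1..N2} E) = (\<integral>\<^sup>+p. indicator (Pi\<^sub>E {1..N2} E) ((\<lambda>(x, z). received h N1 N2 c x z) p) \<partial>noise_law)"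
  proof -
    have "emeasure (chan c) (Pi\<^sub>E {1..N2} E) = (\<integral>\<^sup>+y. indicator (Pi\<^sub>E {1..N2} E) y \<partial>chan c)"
      using EP by simp
    also have "\<dots> = (\<integral>\<^sup>+p. indicator (Pi\<^sub>E {1..N2} E) ((\<lambda>(x, z). received h N1 N2 c x z) p) \<partial>noise_law)"
      unfolding chan_def using EP by (intro nn_integral_distr[OF received_measurable]) simp
    finally show ?thesis .
  qed
  also have "\<dots> = (\<integral>\<^sup>+x. \<integral>\<^sup>+z. indicator (Pi\<^sub>E {1..N2} E) (received h N1 N2 c x z) \<partial>(\<Pi>\<^sub>M j\<in>{1..N2}. cgauss) \<partial>(\<Pi>\<^sub>M j\<in>{1..N1}. unif X1))"
    using measurable_compose[OF received_measurable borel_measurable_indicator[OF EP], of c]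
    unfolding noise_law_def by (subst sigma_finite_measure.nn_integral_fst[OF sf, symmetric]) (simp_all add: case_prod_beta')
  also have "\<dots> = (\<integral>\<^sup>+x. (\<Prod>j\<in>{1..N2}. g j (q x j)) \<partial>(\<Pi>\<^sub>M j\<in>{1..N1}. unif X1))"
  proof (rule nn_integral_cong)
    fix x
    have "indicator (Pi\<^sub>E {1..N2} E) (received h N1 N2 c x z) = (\<Prod>j\<in>{1..N2}. indicator (E j) (h * (q x j + c j) + z j) :: ennreal)" for z
    proof (cases "\<forall>j\<in>{1..N2}. h * (q x j + c j) + z j \<in> E j")
      case True
      then have "received h N1 N2 c x z \<in> Pi\<^sub>E {1..N2} E"
        by (auto simp: received_def q_def split: if_splits)
      then show ?thesis using True by simp
    next
      case False
      then have "received h N1 N2 c x z \<notin> Pi\<^sub>E {1..N2} E"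
        by (fastforce simp: received_def q_def PiE_iff split: if_splits)
      moreover have "(\<Prod>j\<in>{1..N2}. indicator (E j) (h * (q x j + c j) + z j) :: ennreal) = 0"
        using False by (intro prod_zero finite_atLeastAtMost) (metis indicator_simps(2))
      ultimately show ?thesis by simp
    qed
    then have "(\<integral>\<^sup>+z. indicator (Pi\<^sub>E {1..N2} E) (received h N1 N2 c x z) \<partial>(\<Pi>\<^sub>M j\<in>{1..N2}. cgauss))
        = (\<integral>\<^sup>+z. (\<Prod>j\<in>{1..N2}. indicator (E j) (h * (q x j + c j) + z j)) \<partial>(\<Pi>\<^sub>M j\<in>{1..N2}. cgauss))"
      by simp
    also have "\<dots> = (\<Prod>j\<in>{1..N2}. g j (q x j))"
    proof -
      have "(\<lambda>z. indicator (E j) (h * (q x j + c j) + z) :: ennreal) \<in> borel_measurable cgauss"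
        if "j \<in> {1..N2}" for j
      proof -
        have "(\<lambda>z. h * (q x j + c j) + z) \<in> borel_measurable cgauss"
          by (intro borel_measurable_add borel_measurable_const measurable_ident_sets sets_cgauss)
        then show ?thesis by (rule measurable_compose[OF _ borel_measurable_indicator[OF E[OF that]]])
      qed
      then show ?thesis unfolding g_def by (intro C.product_nn_integral_prod) auto
    qed
    finally show "(\<integral>\<^sup>+z. indicator (Pi\<^sub>E {1..N2} E) (received h N1 N2 c x z) \<partial>(\<Pi>\<^sub>M j\<in>{1..N2}. cgauss))
        = (\<Prod>j\<in>{1..N2}. g j (q x j))" .
  qed
  \<comment> \<open>Positions after \<open>N1\<close> do not see the interference block and leave
    the integral as constants; below they return as integrals over the point mass
    \<open>unif {0}\<close>.\<close>
  also have "\<dots> = (\<integral>\<^sup>+x. (\<Prod>j\<in>{Suc N1..N2}. g j 0) * (\<Prod>j\<in>{1..N1}. g j (x j)) \<partial>(\<Pi>\<^sub>M j\<in>{1..N1}. unif X1))"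
  proof (rule nn_integral_cong)
    fix x
    have split: "{1..N2} = {1..N1} \<union> {Suc N1..N2}" using N12 by auto
    show "(\<Prod>j\<in>{1..N2}. g j (q x j)) = (\<Prod>j\<in>{Suc N1..N2}. g j 0) * (\<Prod>j\<in>{1..N1}. g j (x j))"
      unfolding split by (subst prod.union_disjoint) (auto simp: q_def mult.commute)
  qed
  also have "\<dots> = (\<Prod>j\<in>{Suc N1..N2}. g j 0) * (\<Prod>j\<in>{1..N1}. \<integral>\<^sup>+b. g j b \<partial>unif X1)"
  proof -
    have "(\<lambda>x. g j (x j)) \<in> borel_measurable (\<Pi>\<^sub>M j\<in>{1..N1}. unif X1)" if "j \<in> {1..N1}" for j
      by (rule measurable_compose[OF measurable_component_singleton[OF that]]) simp
    then have "(\<lambda>x. \<Prod>j\<in>{1..N1}. g j (x j)) \<in> borel_measurable (\<Pi>\<^sub>M j\<in>{1..N1}. unif X1)"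
      by (intro borel_measurable_prod_ennreal)
    then show ?thesis
      by (subst nn_integral_cmult) (auto simp: U.product_nn_integral_prod)
  qed
  also have "\<dots> = (\<Prod>j\<in>{1..N2}. \<integral>\<^sup>+b. g j b \<partial>unif (interf j))"
  proof -
    have split: "{1..N2} = {1..N1} \<union> {Suc N1..N2}" using N12 by auto
    have "(\<integral>\<^sup>+b. g j b \<partial>unif {0}) = g j 0" for j
      by (subst nn_integral_pmf_of_set) (auto simp: divide_ennreal_def)
    then show ?thesis
      unfolding split by (subst prod.union_disjoint) (auto simp: interf_def mult.commute)
  qed
  finally show ?thesis unfolding g_def .
qed

text \<open>The conditional law of the output given that the random word is \<open>c\<close>, an
  event of probability \<open>1 / card words\<close>, is the channel law of \<open>c\<close>. Both
  are finite measures on \<open>outs\<close> with the same product form on rectangles, hence equal.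
  This links the channel with separate interference and noise blocks to the independent letter
  triples.\<close>

lemma chan_eq:
  assumes c: "c \<in> words" and E: "E \<in> sets outs"
  shows "measure (chan c) E = card words * block.prob {\<omega> \<in> space block_law. (\<forall>j\<in>{1..N2}. fst (\<omega> j) = c j) \<and> block_out \<omega> \<in> E}"
proof -
  \<comment> \<open>Density of the conditioning event: it equals \<open>card words\<close> where the
    input is \<open>c\<close> and 0 elsewhere, but written as a product it can be integrated letter
    by letter.\<close>
  define d where "d = (\<lambda>\<omega> :: nat \<Rightarrow> complex \<times> complex \<times> complex. \<Prod>j\<in>{1..N2}. of_nat (card (alphabet j)) * indicator {c j} (fst (\<omega> j)) :: ennreal)"
  have fst_m [measurable]: "fst \<in> letter_law j \<rightarrow>\<^sub>M count_space UNIV" for j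
    unfolding letter_law_def by measurable
  have fst_j [measurable]: "(\<lambda>\<omega>. fst (\<omega> j)) \<in> block_law \<rightarrow>\<^sub>M count_space UNIV" if "j \<in> {1..N2}" for j
    by (rule measurable_compose[OF letter_measurable[OF that] fst_m])
  have d [measurable]: "d \<in> borel_measurable block_law"
    unfolding d_def by measurable
  have rect: "emeasure (distr (density block_law d) outs block_out) (Pi\<^sub>E {1..N2} F) = emeasure (chan c) (Pi\<^sub>E {1..N2} F)"
    if F: "\<And>j. j \<in> {1..N2} \<Longrightarrow> F j \<in> sets (borel :: complex measure)" for F
  proof -
    have FP: "Pi\<^sub>E {1..N2} F \<in> sets outs" unfolding outs_def using F by (intro sets_PiM_I_finite) auto
    have "emeasure (distr (density block_law d) outs block_out) (Pi\<^sub>E {1..N2} F)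
        = (\<integral>\<^sup>+\<omega>. d \<omega> * indicator (Pi\<^sub>E {1..N2} F) (block_out \<omega>) \<partial>block_law)"
      using FP by (subst emeasure_distr, simp, simp, subst emeasure_density)
        (auto intro!: nn_integral_cong measurable_sets[OF block_out_measurable] split: split_indicator)
    also have "\<dots> = (\<integral>\<^sup>+\<omega>. (\<Prod>j\<in>{1..N2}. of_nat (card (alphabet j)) * indicator {c j} (fst (\<omega> j)) * indicator (F j) (chan_out h (\<omega> j))) \<partial>block_law)"
    proof (rule nn_integral_cong)
      fix \<omega>
      have "indicator (Pi\<^sub>E {1..N2} F) (block_out \<omega>) = (\<Prod>j\<in>{1..N2}. indicator (F j) (chan_out h (\<omega> j)) :: ennreal)"
      proof (cases "\<forall>j\<in>{1..N2}. chan_out h (\<omega> j) \<in> F j")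
        case False
        then have "(\<Prod>j\<in>{1..N2}. indicator (F j) (chan_out h (\<omega> j)) :: ennreal) = 0"
          by (intro prod_zero finite_atLeastAtMost) (metis indicator_simps(2))
        with False show ?thesis by (auto simp: block_out_def PiE_iff)
      qed (auto simp: block_out_def)
      then show "d \<omega> * indicator (Pi\<^sub>E {1..N2} F) (block_out \<omega>)
          = (\<Prod>j\<in>{1..N2}. of_nat (card (alphabet j)) * indicator {c j} (fst (\<omega> j)) * indicator (F j) (chan_out h (\<omega> j)))"
        unfolding d_def by (simp add: prod.distrib)
    qed
    also have "\<dots> = (\<Prod>j\<in>{1..N2}. \<integral>\<^sup>+w. of_nat (card (alphabet j)) * indicator {c j} (fst w) * indicator (F j) (chan_out h w) \<partial>letter_law j)"
    proof -
      have "(\<lambda>w. of_nat (card (alphabet j)) * indicator {c j} (fst w) * indicator (F j) (chan_out h w) :: ennreal)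
          \<in> borel_measurable (letter_law j)" if "j \<in> {1..N2}" for j
      proof -
        have [measurable]: "F j \<in> sets borel" by (rule F[OF that])
        have [measurable]: "(\<lambda>w. indicator {c j} (fst w) :: ennreal) \<in> borel_measurable (letter_law j)"
          by (rule measurable_compose[OF fst_m]) simp
        show ?thesis by measurable
      qed
      then show ?thesis unfolding block_law_def by (intro letters.product_nn_integral_prod) auto
    qed
    also have "\<dots> = (\<Prod>j\<in>{1..N2}. \<integral>\<^sup>+b. \<integral>\<^sup>+z. indicator (F j) (h * (b + c j) + z) \<partial>cgauss \<partial>unif (interf j))"
      unfolding letter_law_def using F c alphabet
      by (intro prod.cong refl nn_integral_law_int_given_input) (auto simp: words_def)
    also have "\<dots> = emeasure (chan c) (Pi\<^sub>E {1..N2} F)"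
      using F by (rule chan_rectangle[symmetric])
    finally show ?thesis .
  qed
  interpret W: prob_space "chan c" by (rule prob_space_chan)
  have "distr (density block_law d) outs block_out = chan c"
  proof (rule measure_eqI_PiM_finite[of "{1..N2}" _ "\<lambda>_. borel"])
    show "sets (distr (density block_law d) outs block_out) = sets (\<Pi>\<^sub>M j\<in>{1..N2}. borel)"
      "sets (chan c) = sets (\<Pi>\<^sub>M j\<in>{1..N2}. borel)" by (simp_all add: outs_def)
    show "range (\<lambda>_::nat. Pi\<^sub>E {1..N2} (\<lambda>_. UNIV)) \<subseteq> prod_algebra {1..N2} (\<lambda>_. borel :: complex measure)"
      by (auto intro!: prod_algebraI_finite)
    show "(\<Union>i::nat. Pi\<^sub>E {1..N2} (\<lambda>_. UNIV)) = space (\<Pi>\<^sub>M j\<in>{1..N2}. (borel :: complex measure))"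
      by (simp add: space_PiM)
    show "emeasure (distr (density block_law d) outs block_out) (Pi\<^sub>E {1..N2} (\<lambda>_. UNIV)) \<noteq> \<infinity>" for i :: nat
      by (subst rect) auto
  qed (use rect in auto)
  then have "emeasure (chan c) E = emeasure (distr (density block_law d) outs block_out) E" by simp
  also have "\<dots> = (\<integral>\<^sup>+\<omega>. d \<omega> * indicator E (block_out \<omega>) \<partial>block_law)"
    using E by (subst emeasure_distr, simp, simp, subst emeasure_density)
        (auto intro!: nn_integral_cong measurable_sets[OF block_out_measurable] split: split_indicator)
  also have "\<dots> = (\<integral>\<^sup>+\<omega>. of_nat (card words) * indicator {\<omega> \<in> space block_law. (\<forall>j\<in>{1..N2}. fst (\<omega> j) = c j) \<and> block_out \<omega> \<in> E} \<omega> \<partial>block_law)"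
  proof (rule nn_integral_cong)
    fix \<omega> assume "\<omega> \<in> space block_law"
    moreover have "d \<omega> = (if \<forall>j\<in>{1..N2}. fst (\<omega> j) = c j then of_nat (card words) else 0)"
    proof (cases "\<forall>j\<in>{1..N2}. fst (\<omega> j) = c j")
      case False
      then have "\<exists>j\<in>{1..N2}. of_nat (card (alphabet j)) * indicator {c j} (fst (\<omega> j)) = (0 :: ennreal)"
        by (metis indicator_simps(2) mult_zero_right singletonD)
      then have "d \<omega> = 0" unfolding d_def by (intro prod_zero finite_atLeastAtMost)
      then show ?thesis using False by auto
    qed (simp add: d_def card_words)
    ultimately show "d \<omega> * indicator E (block_out \<omega>)
      = of_nat (card words) * indicator {\<omega> \<in> space block_law. (\<forall>j\<in>{1..N2}. fst (\<omega> j) = c j) \<and> block_out \<omega> \<in> E} \<omega>"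
      by (auto split: split_indicator)
  qed
  also have "\<dots> = of_nat (card words) * emeasure block_law {\<omega> \<in> space block_law. (\<forall>j\<in>{1..N2}. fst (\<omega> j) = c j) \<and> block_out \<omega> \<in> E}"
  proof (rule nn_integral_cmult_indicator)
    have [measurable]: "E \<in> sets outs" by fact
    have [measurable]: "Measurable.pred block_law (\<lambda>\<omega>. fst (\<omega> j) = c j)" if "j \<in> {1..N2}" for j
      by (rule measurable_compose[OF fst_j[OF that]]) simp
    show "{\<omega> \<in> space block_law. (\<forall>j\<in>{1..N2}. fst (\<omega> j) = c j) \<and> block_out \<omega> \<in> E} \<in> sets block_law"
      by measurable
  qed
  finally show ?thesis
    by (simp add: measure_def enn2real_mult)
qed

end

section \<open>Information density and decoding error of the block code\<close>

context block_channel begin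

lemma info_measurable [measurable]: "info c \<in> borel_measurable outs"
proof -
  have "(\<lambda>y. y j) \<in> borel_measurable outs" if "j \<in> {1..N2}" for j
    unfolding outs_def using that by (rule measurable_component_singleton)
  note [measurable] = this
  show ?thesis unfolding info_def by measurable
qed

text \<open>Markov's inequality applied to the likelihood ratio, whose mean under the output law is 1.\<close>
lemma confusion_bound:
  "block.prob {\<omega> \<in> space block_law. \<theta> < info c (block_out \<omega>)} \<le> 2 powr - \<theta>"
proof -
  define r where "r = (\<lambda>j w. ratio (alphabet j) (interf j) h (c j) (chan_out h w))"
  have r [measurable]: "r j \<in> borel_measurable (letter_law j)" for j
    unfolding r_def by measurable
  have rpos: "0 < r j w" for j w
    unfolding r_def by (intro ratio_pos alphabet interf)
  have S: "{\<omega> \<in> space block_law. \<theta> < info c (block_out \<omega>)} \<in> sets block_law" by measurable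
  have "emeasure block_law {\<omega> \<in> space block_law. \<theta> < info c (block_out \<omega>)}
      = (\<integral>\<^sup>+\<omega>. indicator {\<omega> \<in> space block_law. \<theta> < info c (block_out \<omega>)} \<omega> \<partial>block_law)"
    using S by simp
  also have "\<dots> \<le> (\<integral>\<^sup>+\<omega>. ennreal (2 powr - \<theta>) * (\<Prod>j\<in>{1..N2}. ennreal (r j (\<omega> j))) \<partial>block_law)"
  proof (rule nn_integral_mono)
    fix \<omega>
    have "1 \<le> 2 powr - \<theta> * (\<Prod>j\<in>{1..N2}. r j (\<omega> j))" if "\<theta> < info c (block_out \<omega>)"
    proof -
      have "info c (block_out \<omega>) = (\<Sum>j\<in>{1..N2}. log 2 (r j (\<omega> j)))"
        by (simp add: info_def r_def block_out_def)
      then have "2 powr info c (block_out \<omega>) = (\<Prod>j\<in>{1..N2}. r j (\<omega> j))"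
        using rpos by (simp add: powr_sum powr_log_cancel)
      moreover have "2 powr \<theta> \<le> 2 powr info c (block_out \<omega>)" using that by simp
      ultimately have "2 powr - \<theta> * 2 powr \<theta> \<le> 2 powr - \<theta> * (\<Prod>j\<in>{1..N2}. r j (\<omega> j))"
        by (intro mult_left_mono) auto
      then show ?thesis by (simp add: powr_add[symmetric])
    qed
    moreover have "ennreal (2 powr - \<theta>) * (\<Prod>j\<in>{1..N2}. ennreal (r j (\<omega> j)))
        = ennreal (2 powr - \<theta> * (\<Prod>j\<in>{1..N2}. r j (\<omega> j)))"
      using rpos by (simp add: prod_ennreal less_imp_le ennreal_mult prod_nonneg)
    ultimately show "indicator {\<omega> \<in> space block_law. \<theta> < info c (block_out \<omega>)} \<omega>
        \<le> ennreal (2 powr - \<theta>) * (\<Prod>j\<in>{1..N2}. ennreal (r j (\<omega> j)))"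
      by (auto split: split_indicator)
  qed
  also have "\<dots> = ennreal (2 powr - \<theta>) * (\<integral>\<^sup>+\<omega>. (\<Prod>j\<in>{1..N2}. ennreal (r j (\<omega> j))) \<partial>block_law)"
    by (rule nn_integral_cmult) measurable
  also have "(\<integral>\<^sup>+\<omega>. (\<Prod>j\<in>{1..N2}. ennreal (r j (\<omega> j))) \<partial>block_law)
      = (\<Prod>j\<in>{1..N2}. \<integral>\<^sup>+w. ennreal (r j w) \<partial>letter_law j)"
    unfolding block_law_def by (intro letters.product_nn_integral_prod) auto
  also have "\<dots> = 1"
    unfolding r_def letter_law_def by (subst nn_integral_ratio[OF alphabet interf]) simp
  finally show ?thesis
    by (simp add: block.emeasure_eq_measure)
qed

lemma AE_block_input: "AE \<omega> in block_law. \<forall>j\<in>{1..N2}. fst (\<omega> j) \<in> alphabet j"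
proof -
  have "AE \<omega> in block_law. fst (\<omega> j) \<in> alphabet j" if j: "j \<in> {1..N2}" for j
  proof -
    have "AE w in letter_law j. fst w \<in> alphabet j"
      using AE_law_int[OF alphabet interf, of j j] unfolding letter_law_def by eventually_elim simp
    then show ?thesis
      unfolding block_law_def using j
      by (intro letters.AE_component) auto
  qed
  then show ?thesis by (intro AE_finite_allI) auto
qed

lemma sets_joint:
  assumes "E \<in> sets outs"
  shows "{\<omega> \<in> space block_law. (\<forall>j\<in>{1..N2}. fst (\<omega> j) = c j) \<and> block_out \<omega> \<in> E} \<in> sets block_law"
proof -
  have fst_m: "fst \<in> letter_law j \<rightarrow>\<^sub>M count_space UNIV" for j
    unfolding letter_law_def by measurable
  have [measurable]: "Measurable.pred block_law (\<lambda>\<omega>. fst (\<omega> j) = c j)" if "j \<in> {1..N2}" for j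
    by (rule measurable_compose[OF measurable_compose[OF letter_measurable[OF that] fst_m]]) simp
  show ?thesis using assms by measurable
qed

text \<open>The bound holds for each message separately, hence for the average: an error on message
  \<open>w\<close> needs an output outside \<open>D w\<close>.\<close>

lemma error_prob_le:
  assumes M: "1 \<le> M" and D: "\<And>k. k \<in> {1..M} \<Longrightarrow> D k \<in> sets outs"
      "\<And>k. k \<in> {1..M} \<Longrightarrow> 1 - \<epsilon> \<le> measure (chan (enc k)) (D k)"
    and dec: "\<And>k y. k \<in> {1..M} \<Longrightarrow> y \<in> D k \<Longrightarrow> dec y = k"
  shows "error_prob h X1 N1 N2 M enc dec \<le> \<epsilon>"
proof -
  interpret Q: prob_space noise_law by (rule prob_space_noise_law)
  define S where "S = {p \<in> space (unif {1..M} \<Otimes>\<^sub>M noise_law).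
      case p of (w, x, z) \<Rightarrow> dec (received h N1 N2 (enc w) x z) \<noteq> w}"
  have \<epsilon>: "0 \<le> \<epsilon>"
    using D(2)[of 1] M prob_space.prob_le_1[OF prob_space_chan, of "enc 1" "D 1"] by simp
  have err: "error_prob h X1 N1 N2 M enc dec = measure (unif {1..M} \<Otimes>\<^sub>M noise_law) S"
    unfolding error_prob_def transmission_law_def S_def noise_law_def by (simp add: case_prod_beta')
  show ?thesis
  proof (cases "S \<in> sets (unif {1..M} \<Otimes>\<^sub>M noise_law)")
    \<comment> \<open>Outside the sigma-algebra \<open>measure\<close> is 0 by convention, so
      \<open>0 \<le> \<epsilon>\<close> settles this case and the error event does not have to be
      shown measurable.\<close>
    case False
    then show ?thesis using \<epsilon> measure_notin_sets[OF False] unfolding err by linarith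
  next
    case True
    have le: "emeasure noise_law (Pair w -` S) \<le> ennreal \<epsilon>" if w: "w \<in> {1..M}" for w
    proof -
      define R where "R = (\<lambda>(x, z). received h N1 N2 (enc w) x z) -` D w \<inter> space noise_law"
      have R: "R \<in> sets noise_law"
        unfolding R_def by (rule measurable_sets[OF received_measurable D(1)[OF w]])
      have "emeasure noise_law (Pair w -` S) \<le> emeasure noise_law (space noise_law - R)"
        using R dec[OF w] by (intro emeasure_mono) (auto simp: S_def R_def space_pair_measure)
      also have "\<dots> = ennreal (1 - Q.prob R)"
        using R by (simp add: Q.emeasure_eq_measure Q.prob_compl)
      also have "Q.prob R = measure (chan (enc w)) (D w)"
        unfolding chan_def R_def by (rule measure_distr[symmetric, OF received_measurable D(1)[OF w]])
      also have "ennreal (1 - measure (chan (enc w)) (D w)) \<le> ennreal \<epsilon>"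
        using D(2)[OF w] by (intro ennreal_leI) linarith
      finally show ?thesis .
    qed
    have "emeasure (unif {1..M} \<Otimes>\<^sub>M noise_law) S = (\<integral>\<^sup>+w. emeasure noise_law (Pair w -` S) \<partial>unif {1..M})"
      by (rule Q.emeasure_pair_measure_alt[OF True])
    also have "\<dots> \<le> (\<integral>\<^sup>+w. ennreal \<epsilon> \<partial>unif {1..M})"
      by (rule nn_integral_mono_AE) (use le M in \<open>simp add: AE_measure_pmf_iff\<close>)
    also have "\<dots> = ennreal \<epsilon>" by simp
    finally show ?thesis
      unfolding err measure_def using \<epsilon> by (simp add: enn2real_leI)
  qed
qed

text \<open>Feinstein's construction over all words, with \<open>G c\<close> the outputs whose
  information density with \<open>c\<close> exceeds \<open>\<theta>\<close>. Since the random word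
  is uniform, the sums over \<open>words\<close> required there are \<open>card words\<close> times
  probabilities under \<open>block_law\<close>: one for the true pair of word and output, one for an
  output tested against a fixed word.\<close>

lemma achievable:
  assumes M: "1 \<le> M"
    and err: "block.prob {\<omega> \<in> space block_law. (\<Sum>j\<in>{1..N2}. log 2 (real (card (alphabet j)))
        - info_loss (alphabet j) (interf j) h (\<omega> j)) \<le> \<theta>} + real M * 2 powr - \<theta> \<le> \<epsilon>"
  shows "\<exists>enc dec. is_code X21 X22 N1 N2 M enc dec \<and> error_prob h X1 N1 N2 M enc dec \<le> \<epsilon>"
proof -
  define bad where "bad = {\<omega> \<in> space block_law. (\<Sum>j\<in>{1..N2}. log 2 (real (card (alphabet j)))
        - info_loss (alphabet j) (interf j) h (\<omega> j)) \<le> \<theta>}"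
  define G where "G = (\<lambda>c. {y \<in> space outs. \<theta> < info c y})"
  define joint where "joint = (\<lambda>c E. {\<omega> \<in> space block_law. (\<forall>j\<in>{1..N2}. fst (\<omega> j) = c j) \<and> block_out \<omega> \<in> E})"
  have G: "G c \<in> sets outs" for c unfolding G_def by measurable
  have joint: "E \<in> sets outs \<Longrightarrow> joint c E \<in> sets block_law" for c E
    unfolding joint_def by (rule sets_joint)
  have out_space: "block_out \<omega> \<in> space outs" if "\<omega> \<in> space block_law" for \<omega>
    using measurable_space[OF block_out_measurable that] .
  have joint_disj: "disjoint_family_on (\<lambda>c. joint c (E c)) words" for E
    unfolding disjoint_family_on_def
  proof (intro ballI impI)
    fix c c' assume "c \<in> words" "c' \<in> words" "c \<noteq> c'"
    then obtain j where "j \<in> {1..N2}" "c j \<noteq> c' j"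
      unfolding words_def by (meson PiE_ext)
    then show "joint c (E c) \<inter> joint c' (E c') = {}" unfolding joint_def by auto
  qed
  have [measurable]: "info_loss (alphabet j) (interf j) h \<in> borel_measurable (letter_law j)" for j
    unfolding letter_law_def by measurable
  have bad_sets: "bad \<in> sets block_law" unfolding bad_def by measurable
  have correct: "(1 - block.prob bad) * card words \<le> (\<Sum>c\<in>words. measure (chan c) (G c))"
  proof -
    have "1 - block.prob bad = block.prob (space block_law - bad)"
      using bad_sets by (simp add: block.prob_compl)
    \<comment> \<open>Almost every outcome has as its input some word \<open>c\<close>; off
      \<open>bad\<close> the information density of this word and the output exceeds
      \<open>\<theta>\<close>, so the output lies in \<open>G c\<close>.\<close>
    also have "\<dots> \<le> block.prob (\<Union>c\<in>words. joint c (G c))"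
    proof (rule block.finite_measure_mono_AE)
      show "AE \<omega> in block_law. \<omega> \<in> space block_law - bad \<longrightarrow> \<omega> \<in> (\<Union>c\<in>words. joint c (G c))"
        using AE_block_input
      proof eventually_elim
        case (elim \<omega>)
        show ?case
        proof
          assume \<omega>: "\<omega> \<in> space block_law - bad"
          define c where "c = (\<lambda>j\<in>{1..N2}. fst (\<omega> j))"
          have "c \<in> words" using elim by (auto simp: c_def words_def)
          moreover have "info c (block_out \<omega>) = (\<Sum>j\<in>{1..N2}. log 2 (real (card (alphabet j)))
              - info_loss (alphabet j) (interf j) h (\<omega> j))"
            unfolding info_def
            by (intro sum.cong refl) (simp add: c_def block_out_def log_ratio[OF alphabet interf])
          ultimately have "\<omega> \<in> joint c (G c)"
            using \<omega> out_space[of \<omega>] by (auto simp: joint_def G_def bad_def c_def)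
          then show "\<omega> \<in> (\<Union>c\<in>words. joint c (G c))" using \<open>c \<in> words\<close> by blast
        qed
      qed
      show "(\<Union>c\<in>words. joint c (G c)) \<in> sets block_law"
        using words joint G by (intro sets.finite_UN) auto
    qed
    also have "\<dots> = (\<Sum>c\<in>words. block.prob (joint c (G c)))"
      using words joint G joint_disj by (intro block.finite_measure_finite_Union) auto
    finally have "(1 - block.prob bad) * card words \<le> (\<Sum>c\<in>words. block.prob (joint c (G c))) * card words"
      by (rule mult_right_mono) simp
    also have "\<dots> = (\<Sum>c\<in>words. measure (chan c) (G c))"
      unfolding sum_distrib_right by (intro sum.cong refl) (simp add: chan_eq[OF _ G] joint_def mult.commute)
    finally show ?thesis .
  qed
  have confuse: "(\<Sum>c\<in>words. measure (chan c) (G c')) \<le> 2 powr - \<theta> * card words" for c'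
  proof -
    have "(\<Sum>c\<in>words. measure (chan c) (G c')) = (\<Sum>c\<in>words. block.prob (joint c (G c'))) * card words"
      unfolding sum_distrib_right by (intro sum.cong refl) (simp add: chan_eq[OF _ G] joint_def mult.commute)
    also have "(\<Sum>c\<in>words. block.prob (joint c (G c'))) = block.prob (\<Union>c\<in>words. joint c (G c'))"
      using words joint G joint_disj by (intro block.finite_measure_finite_Union[symmetric]) auto
    \<comment> \<open>Forgetting which word was sent leaves an output of the mixture law tested
      against the fixed word \<open>c'\<close>, the situation of
      \<open>confusion_bound\<close>.\<close>
    also have "\<dots> \<le> block.prob {\<omega> \<in> space block_law. \<theta> < info c' (block_out \<omega>)}"
    proof (rule block.finite_measure_mono)
      show "(\<Union>c\<in>words. joint c (G c')) \<subseteq> {\<omega> \<in> space block_law. \<theta> < info c' (block_out \<omega>)}"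
        by (auto simp: joint_def G_def)
    qed measurable
    also have "\<dots> \<le> 2 powr - \<theta>" by (rule confusion_bound)
    finally show ?thesis by (simp add: mult_right_mono)
  qed
  have "\<exists>enc D. enc \<in> {1..M} \<rightarrow> words \<and> disjoint_family_on D {1..M} \<and>
    (\<forall>k\<in>{1..M}. D k \<in> sets outs \<and> D k \<subseteq> G (enc k) \<and> 1 - \<epsilon> \<le> measure (chan (enc k)) (D k))"
    by (rule feinstein[OF words prob_space_chan sets_chan G correct confuse])
      (use err in \<open>simp_all add: bad_def\<close>)
  then obtain enc D where enc: "enc \<in> {1..M} \<rightarrow> words" and D: "disjoint_family_on D {1..M}"
      "\<And>k. k \<in> {1..M} \<Longrightarrow> D k \<in> sets outs" "\<And>k. k \<in> {1..M} \<Longrightarrow> 1 - \<epsilon> \<le> measure (chan (enc k)) (D k)"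
    by blast
  obtain dec where dec: "dec \<in> outs \<rightarrow>\<^sub>M count_space {1..M}" "\<And>k y. k \<in> {1..M} \<Longrightarrow> y \<in> D k \<Longrightarrow> dec y = k"
    using decoder_of_regions[OF D(1,2) M] by blast
  have code: "is_code X21 X22 N1 N2 M enc dec"
    using enc dec(1) unfolding is_code_def words_def alphabet_def outs_def by simp
  have "error_prob h X1 N1 N2 M enc dec \<le> \<epsilon>"
    by (rule error_prob_le[OF M D(2,3) dec(2)])
  with code show ?thesis by blast
qed

end

subsection \<open>Second-order rates\<close>

lemma (in prob_space) sum_indep_second_moment:
  fixes X :: "'i \<Rightarrow> 'a \<Rightarrow> real"
  assumes "finite I" "indep_vars (\<lambda>_. borel) X I"
    and "\<And>i. i \<in> I \<Longrightarrow> integrable M (X i)" "\<And>i. i \<in> I \<Longrightarrow> integrable M (\<lambda>\<omega>. (X i \<omega>)\<^sup>2)"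
    and "\<And>i. i \<in> I \<Longrightarrow> expectation (X i) = 0"
  shows "integrable M (\<lambda>\<omega>. (\<Sum>i\<in>I. X i \<omega>)\<^sup>2)
    \<and> expectation (\<lambda>\<omega>. (\<Sum>i\<in>I. X i \<omega>)\<^sup>2) = (\<Sum>i\<in>I. expectation (\<lambda>\<omega>. (X i \<omega>)\<^sup>2))"
  using assms
proof (induction I rule: finite_induct)
  case (insert i I)
  define S where "S = (\<lambda>\<omega>. \<Sum>i\<in>I. X i \<omega>)"
  have indep: "indep_var borel (X i) borel S"
    unfolding S_def using insert by (intro indep_vars_sum) auto
  have "indep_vars (\<lambda>_. borel) X I" using insert.prems(1) by (rule indep_vars_subset) auto
  then have IH: "integrable M (\<lambda>\<omega>. (S \<omega>)\<^sup>2)" "expectation (\<lambda>\<omega>. (S \<omega>)\<^sup>2) = (\<Sum>i\<in>I. expectation (\<lambda>\<omega>. (X i \<omega>)\<^sup>2))"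
    using insert.IH insert.prems unfolding S_def by auto
  have Xi: "integrable M (X i)" "integrable M (\<lambda>\<omega>. (X i \<omega>)\<^sup>2)" "expectation (X i) = 0"
    and S: "integrable M S"
    using insert.prems unfolding S_def by auto
  have cross: "integrable M (\<lambda>\<omega>. X i \<omega> * S \<omega>)" "expectation (\<lambda>\<omega>. X i \<omega> * S \<omega>) = 0"
    using indep_var_integrable[OF indep Xi(1) S] indep_var_lebesgue_integral[OF indep Xi(1) S] Xi(3) by simp_all
  have eq: "(\<lambda>\<omega>. (\<Sum>i\<in>insert i I. X i \<omega>)\<^sup>2) = (\<lambda>\<omega>. (X i \<omega>)\<^sup>2 + (2 * (X i \<omega> * S \<omega>) + (S \<omega>)\<^sup>2))"
    using insert.hyps by (auto simp: S_def power2_eq_square algebra_simps)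
  show ?case
    unfolding eq using Xi IH cross insert.hyps by simp
qed simp

text \<open>Continuity of the normal distribution function and the intermediate value theorem. Since
  \<open>Q_inv\<close> is a choice of preimages, attaining \<open>e\<close> is what makes
  \<open>Q_inv e\<close> a quantile.\<close>

lemma Q_fun_attained:
  assumes "0 < e" "e < 1"
  shows "\<exists>x. Q_fun x = e"
proof -
  interpret N: real_distribution std_normal_distribution by (rule real_dist_normal_dist)
  have Q: "Q_fun x = 1 - cdf std_normal_distribution x" for x
  proof -
    have "{x..} = UNIV - {..x} \<union> {x}" by auto
    then have "Q_fun x = measure std_normal_distribution (UNIV - {..x}) + measure std_normal_distribution {x}"
      unfolding Q_fun_eq_measure by (simp only:) (rule N.finite_measure_Union, auto)
    also have "measure std_normal_distribution {x} = 0"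
      by (simp add: measure_def std_normal_atom)
    also have "measure std_normal_distribution (UNIV - {..x}) = 1 - cdf std_normal_distribution x"
      using N.prob_compl[of "{..x}"] by (simp add: cdf_def)
    finally show ?thesis by simp
  qed
  have cont: "isCont (cdf std_normal_distribution) x" for x
    unfolding N.isCont_cdf by (simp add: measure_def std_normal_atom)
  have "eventually (\<lambda>x. cdf std_normal_distribution x < 1 - e) at_bot"
    using N.cdf_lim_at_bot assms by (intro order_tendstoD) auto
  then obtain a where a: "\<And>x. x \<le> a \<Longrightarrow> cdf std_normal_distribution x < 1 - e"
    unfolding eventually_at_bot_linorder by blast
  have "eventually (\<lambda>x. 1 - e < cdf std_normal_distribution x) at_top"
    using N.cdf_lim_at_top assms N.prob_space by (intro order_tendstoD) auto
  then obtain b where b: "\<And>x. b \<le> x \<Longrightarrow> 1 - e < cdf std_normal_distribution x"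
    unfolding eventually_at_top_linorder by blast
  have "\<exists>x. min a b \<le> x \<and> x \<le> max a b \<and> cdf std_normal_distribution x = 1 - e"
    using a[of "min a b"] b[of "max a b"] cont by (intro IVT) auto
  then obtain x where "cdf std_normal_distribution x = 1 - e" by blast
  then have "Q_fun x = e" by (simp add: Q)
  then show ?thesis ..
qed

lemma Q_fun_Q_inv: "0 < e \<Longrightarrow> e < 1 \<Longrightarrow> Q_fun (Q_inv e) = e"
  unfolding Q_inv_def using Q_fun_attained by (metis f_inv_into_f rangeI)

text \<open>On \<open>{q..q + 1}\<close> the normal density is at least its value at
  \<open>\<bar>q\<bar> + 1\<close>. This linear gain pays for errors of order 1 / \<sigma> by a
  shift of the quantile of the same order.\<close>

lemma Q_fun_decrease:
  "\<exists>c>0. \<forall>a. 0 \<le> a \<and> a \<le> 1 \<longrightarrow> Q_fun (q + a) \<le> Q_fun q - c * a"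
proof (intro exI conjI allI impI)
  interpret N: real_distribution std_normal_distribution by (rule real_dist_normal_dist)
  show "0 < std_normal_density (\<bar>q\<bar> + 1)" by (rule normal_density_pos) simp
  fix a :: real assume a: "0 \<le> a \<and> a \<le> 1"
  have "{q..} = {q..<q + a} \<union> {q + a..}" using a by auto
  then have Q: "Q_fun q = measure std_normal_distribution {q..<q + a} + Q_fun (q + a)"
    unfolding Q_fun_eq_measure by (simp only:) (rule N.finite_measure_Union, auto)
  have "ennreal (std_normal_density (\<bar>q\<bar> + 1) * a) = (\<integral>\<^sup>+t. ennreal (std_normal_density (\<bar>q\<bar> + 1)) * indicator {q..<q + a} t \<partial>lborel)"
    using a by (subst nn_integral_cmult_indicator) (auto simp: ennreal_mult)
  also have "\<dots> \<le> (\<integral>\<^sup>+t. ennreal (std_normal_density t) * indicator {q..<q + a} t \<partial>lborel)"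
  proof (rule nn_integral_mono)
    fix t
    show "ennreal (std_normal_density (\<bar>q\<bar> + 1)) * indicator {q..<q + a} t \<le> ennreal (std_normal_density t) * indicator {q..<q + a} t"
    proof (cases "t \<in> {q..<q + a}")
      case True
      then have "\<bar>t\<bar> \<le> \<bar>q\<bar> + 1" using a by auto
      then have "t\<^sup>2 \<le> (\<bar>q\<bar> + 1)\<^sup>2" by (metis abs_ge_zero power2_abs power_mono)
      then have "std_normal_density (\<bar>q\<bar> + 1) \<le> std_normal_density t"
        by (simp add: std_normal_density_def divide_right_mono)
      then show ?thesis by (intro mult_right_mono ennreal_leI) auto
    qed simp
  qed
  also have "\<dots> = emeasure std_normal_distribution {q..<q + a}"
    by (rule emeasure_density[symmetric]) auto
  finally have "std_normal_density (\<bar>q\<bar> + 1) * a \<le> measure std_normal_distribution {q..<q + a}"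
    by (simp add: N.emeasure_eq_measure)
  then show "Q_fun (q + a) \<le> Q_fun q - std_normal_density (\<bar>q\<bar> + 1) * a" using Q by simp
qed

section \<open>Moments and tails of the block information density\<close>

context block_channel begin

text \<open>The centred loss rather than the centred information density: its upper tail is the
  lower tail of the density, so the sum of the \<open>dev j\<close> reaches \<open>x\<close> exactly
  when the density of the block is at most \<open>block_info - x\<close>.\<close>

definition dev :: "nat \<Rightarrow> complex \<times> complex \<times> complex \<Rightarrow> real" where
  "dev j w = info_loss (alphabet j) (interf j) h w - (\<integral>w. info_loss (alphabet j) (interf j) h w \<partial>letter_law j)"

definition block_var :: real where
  "block_var = (\<Sum>j\<in>{1..N2}. V_int (alphabet j) (interf j) h)"

definition block_info :: real where
  "block_info = (\<Sum>j\<in>{1..N2}. I_int (alphabet j) (interf j) h)"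

lemma dev_measurable [measurable]: "dev j \<in> borel_measurable (letter_law j)"
  unfolding dev_def letter_law_def by measurable

lemma prob_space_letter_law: "prob_space (letter_law j)"
  unfolding letter_law_def by (rule prob_space_law_int)

lemma V_int_eq: "V_int (alphabet j) (interf j) h = (\<integral>w. (dev j w)\<^sup>2 \<partial>letter_law j)"
  unfolding V_int_def dev_def letter_law_def info_loss_def ..

lemma block_split: "(\<Sum>j\<in>{1..N2}. f (alphabet j) (interf j)) = real N1 * f X21 X1 + (real N2 - real N1) * f X22 {0}"
proof -
  have split: "{1..N2} = {1..N1} \<union> {Suc N1..N2}" using N12 by auto
  show ?thesis
    unfolding split using N12
    by (subst sum.union_disjoint) (auto simp: alphabet_def interf_def of_nat_diff)
qed

lemma dev_moments:
  shows "integrable (letter_law j) (dev j)" "integrable (letter_law j) (\<lambda>w. (dev j w)\<^sup>2)"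
    "integrable (letter_law j) (\<lambda>w. \<bar>dev j w\<bar> ^ 3)" "(\<integral>w. dev j w \<partial>letter_law j) = 0"
proof -
  note ps = prob_space_letter_law[of j]
  have "info_loss (alphabet j) (interf j) h \<in> borel_measurable (letter_law j)"
    unfolding letter_law_def by measurable
  moreover have 3: "integrable (letter_law j) (\<lambda>w. \<bar>info_loss (alphabet j) (interf j) h w\<bar> ^ 3)"
    unfolding letter_law_def by (intro integrable_info_loss_third alphabet interf)
  ultimately show 4: "integrable (letter_law j) (\<lambda>w. \<bar>dev j w\<bar> ^ 3)"
    unfolding dev_def by (rule prob_space.integrable_shift_third[OF ps])
  show "integrable (letter_law j) (dev j)" "integrable (letter_law j) (\<lambda>w. (dev j w)\<^sup>2)"
    using 4 by (auto intro: prob_space.integrable_of_third[OF ps] prob_space.integrable_square_of_third[OF ps])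
  have "integrable (letter_law j) (info_loss (alphabet j) (interf j) h)"
    by (rule prob_space.integrable_of_third[OF ps _ 3]) (simp add: letter_law_def)
  then show "(\<integral>w. dev j w \<partial>letter_law j) = 0"
    unfolding dev_def by (simp add: prob_space.prob_space[OF ps])
qed

lemma letter_transfer:
  fixes f :: "complex \<times> complex \<times> complex \<Rightarrow> real"
  assumes j: "j \<in> {1..N2}" and f: "f \<in> borel_measurable (letter_law j)"
  shows "(\<integral>\<omega>. f (\<omega> j) \<partial>block_law) = (\<integral>w. f w \<partial>letter_law j)"
    and "integrable block_law (\<lambda>\<omega>. f (\<omega> j)) \<longleftrightarrow> integrable (letter_law j) f"
proof -
  have d: "distr block_law (letter_law j) (\<lambda>\<omega>. \<omega> j) = letter_law j"
    unfolding block_law_def using j by (rule letters.PiM_component)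
  show "(\<integral>\<omega>. f (\<omega> j) \<partial>block_law) = (\<integral>w. f w \<partial>letter_law j)"
    using integral_distr[OF letter_measurable[OF j] f] unfolding d by simp
  show "integrable block_law (\<lambda>\<omega>. f (\<omega> j)) \<longleftrightarrow> integrable (letter_law j) f"
    using integrable_distr_eq[OF letter_measurable[OF j] f] unfolding d by simp
qed

lemma indep_dev:
  assumes "1 \<le> N2"
  shows "block.indep_vars (\<lambda>_. borel) (\<lambda>j \<omega>. dev j (\<omega> j)) {1..N2}"
proof -
  have "block.indep_vars letter_law (\<lambda>j \<omega>. \<omega> j) {1..N2}"
  proof (rule block.indep_vars_iff_distr_eq_PiM'[THEN iffD2])
    show "{1..N2} \<noteq> {}" using assms by auto
    have "distr block_law (Pi\<^sub>M {1..N2} letter_law) (\<lambda>\<omega>. \<lambda>j\<in>{1..N2}. \<omega> j) = distr block_law block_law (\<lambda>\<omega>. \<omega>)"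
      by (rule distr_cong) (auto simp: block_law_def space_PiM)
    also have "\<dots> = Pi\<^sub>M {1..N2} letter_law" by (simp add: distr_id block_law_def)
    also have "\<dots> = (\<Pi>\<^sub>M j\<in>{1..N2}. distr block_law (letter_law j) (\<lambda>\<omega>. \<omega> j))"
      by (rule PiM_cong[OF refl]) (simp only: block_law_def letters.PiM_component)
    finally show "distr block_law (Pi\<^sub>M {1..N2} letter_law) (\<lambda>\<omega>. \<lambda>j\<in>{1..N2}. \<omega> j)
      = (\<Pi>\<^sub>M j\<in>{1..N2}. distr block_law (letter_law j) (\<lambda>\<omega>. \<omega> j))" .
  qed (rule letter_measurable)
  then show ?thesis by (rule block.indep_vars_compose2) (rule dev_measurable)
qed

lemma dev_block_moments:
  assumes j: "j \<in> {1..N2}"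
  shows "integrable block_law (\<lambda>\<omega>. dev j (\<omega> j))" "integrable block_law (\<lambda>\<omega>. (dev j (\<omega> j))\<^sup>2)"
    "integrable block_law (\<lambda>\<omega>. \<bar>dev j (\<omega> j)\<bar> ^ 3)" "block.expectation (\<lambda>\<omega>. dev j (\<omega> j)) = 0"
    "block.expectation (\<lambda>\<omega>. (dev j (\<omega> j))\<^sup>2) = V_int (alphabet j) (interf j) h"
    "block.expectation (\<lambda>\<omega>. \<bar>dev j (\<omega> j)\<bar> ^ 3) = (\<integral>w. \<bar>dev j w\<bar> ^ 3 \<partial>letter_law j)"
  using dev_moments[of j]
  by (simp_all add: letter_transfer[OF j, where f="dev j"] letter_transfer[OF j, where f="\<lambda>w. (dev j w)\<^sup>2"]
      letter_transfer[OF j, where f="\<lambda>w. \<bar>dev j w\<bar> ^ 3"] V_int_eq)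

lemma dev_chebyshev:
  assumes "1 \<le> N2" "0 < t"
  shows "block.prob {\<omega> \<in> space block_law. t \<le> (\<Sum>j\<in>{1..N2}. dev j (\<omega> j))} \<le> block_var / t\<^sup>2"
proof -
  note sq = block.sum_indep_second_moment[OF _ indep_dev[OF assms(1)] dev_block_moments(1,2,4)]
  have S: "(\<lambda>\<omega>. \<Sum>j\<in>{1..N2}. dev j (\<omega> j)) \<in> borel_measurable block_law" by measurable
  have mean: "block.expectation (\<lambda>\<omega>. \<Sum>j\<in>{1..N2}. dev j (\<omega> j)) = 0"
    by (subst Bochner_Integration.integral_sum) (auto intro: dev_block_moments simp: dev_block_moments)
  have "block.prob {\<omega> \<in> space block_law. t \<le> (\<Sum>j\<in>{1..N2}. dev j (\<omega> j))}
      \<le> block.prob {\<omega> \<in> space block_law. t \<le> \<bar>(\<Sum>j\<in>{1..N2}. dev j (\<omega> j)) - block.expectation (\<lambda>\<omega>. \<Sum>j\<in>{1..N2}. dev j (\<omega> j))\<bar>}"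
    unfolding mean by (rule block.finite_measure_mono) (auto, measurable)
  also have "\<dots> \<le> block.variance (\<lambda>\<omega>. \<Sum>j\<in>{1..N2}. dev j (\<omega> j)) / t\<^sup>2"
    using sq S assms by (intro block.Chebyshev_inequality) auto
  also have "block.variance (\<lambda>\<omega>. \<Sum>j\<in>{1..N2}. dev j (\<omega> j)) = block_var"
    unfolding mean block_var_def using sq by (simp add: dev_block_moments)
  finally show ?thesis .
qed

lemma dev_upper_tail:
  assumes N2: "1 \<le> N2"
    and third: "\<And>j. j \<in> {1..N2} \<Longrightarrow> (\<integral>w. \<bar>dev j w\<bar> ^ 3 \<partial>letter_law j) \<le> K * V_int (alphabet j) (interf j) h"
    and v: "\<And>j. j \<in> {1..N2} \<Longrightarrow> V_int (alphabet j) (interf j) h \<le> w"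
    and "0 < block_var" "0 \<le> K" "0 \<le> w" "0 < T" "K * T \<le> 1" "w * T\<^sup>2 \<le> 2" "0 < \<tau>" "0 \<le> s"
  shows "block.prob {\<omega> \<in> space block_law. y + s \<le> (\<Sum>j\<in>{1..N2}. dev j (\<omega> j))}
    \<le> Q_fun (y / sqrt (block_var + \<tau>\<^sup>2))
      + (6 * (K + w * T) * sqrt (pi / (block_var / 6)) + 2 / T * exp (- \<tau>\<^sup>2 * T\<^sup>2 / 4) * sqrt (pi / (\<tau>\<^sup>2 / 4))) / pi
      + sqrt 2 * exp (- (s / \<tau>)\<^sup>2 / 4)"
  using assms dev_block_moments
  by (intro block.sum_upper_tail[where v="\<lambda>j. V_int (alphabet j) (interf j) h" and K=K and w=w] indep_dev)
    (auto simp: block_var_def)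

lemma code_of_tail:
  assumes N2: "1 \<le> N2"
    and tail: "block.prob {\<omega> \<in> space block_law. x \<le> (\<Sum>j\<in>{1..N2}. dev j (\<omega> j))} + 1 / sqrt (real N2) \<le> \<epsilon>"
  shows "\<exists>M\<ge>1. block_info - x - log 2 (real N2) / 2 - 1 \<le> log 2 (real M) \<and>
    (\<exists>enc dec. is_code X21 X22 N1 N2 M enc dec \<and> error_prob h X1 N1 N2 M enc dec \<le> \<epsilon>)"
proof (cases "block_info - x - log 2 (real N2) / 2 < 0")
  case True
  \<comment> \<open>A negative target is met by a single codeword, \<open>log 2 1\<close> being 0;
    the constant decoder never errs, and \<open>0 \<le> \<epsilon>\<close> is read off
    \<open>tail\<close>.\<close>
  obtain c where c: "c \<in> words" using words by blast
  have "0 \<le> 1 / sqrt (real N2)" by simp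
  then have \<epsilon>: "0 \<le> \<epsilon>" using tail measure_nonneg[of block_law] by (smt (verit))
  have "error_prob h X1 N1 N2 1 (\<lambda>_. c) (\<lambda>_. 1) \<le> \<epsilon>"
  proof (rule error_prob_le[where D="\<lambda>_. space outs"])
    show "1 - \<epsilon> \<le> measure (chan c) (space outs)" for k :: nat
      using prob_space.prob_space[OF prob_space_chan[of c]] \<epsilon> by (simp add: chan_def)
  qed auto
  moreover have "is_code X21 X22 N1 N2 1 (\<lambda>_. c) (\<lambda>_. 1)"
    using c unfolding is_code_def words_def alphabet_def by auto
  ultimately show ?thesis using True by (intro exI[of _ 1]) auto
next
  case False
  \<comment> \<open>Staying \<open>log 2 (real N2) / 2\<close> below the decoding threshold
    \<open>block_info - x\<close> brings the confusion term down to
    \<open>1 / sqrt (real N2)\<close>, the amount reserved in \<open>tail\<close>.\<close>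
  define e where "e = block_info - x - log 2 (real N2) / 2"
  have e: "0 \<le> e" using False by (simp add: e_def)
  define M where "M = nat \<lfloor>2 powr e\<rfloor>"
  have pe: "1 \<le> 2 powr e" using e by (simp add: ge_one_powr_ge_zero)
  then have M1: "1 \<le> M" unfolding M_def by (simp add: le_nat_floor)
  have M_le: "real M \<le> 2 powr e" unfolding M_def by (simp add: of_nat_floor)
  \<comment> \<open>As \<open>2 powr e \<ge> 1\<close>, rounding down loses at most a factor 2, the
    final \<open>- 1\<close> in the exponent.\<close>
  have M_ge: "2 powr e / 2 \<le> real M"
  proof -
    have "2 powr e < real M + 1" unfolding M_def using pe by linarith
    then show ?thesis using M1 by linarith
  qed
  have "e - 1 = log 2 (2 powr e / 2)" by (simp add: log_divide)
  also have "\<dots> \<le> log 2 (real M)" using M_ge M1 by (subst log_le_cancel_iff) auto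
  finally have rate: "e - 1 \<le> log 2 (real M)" .
  have mean: "I_int (alphabet j) (interf j) h = log 2 (real (card (alphabet j))) - (\<integral>w. info_loss (alphabet j) (interf j) h w \<partial>letter_law j)" for j
    unfolding letter_law_def info_loss_def by (rule I_int_eq[OF alphabet interf])
  have "(\<Sum>j\<in>{1..N2}. log 2 (real (card (alphabet j))) - info_loss (alphabet j) (interf j) h (\<omega> j))
      = block_info - (\<Sum>j\<in>{1..N2}. dev j (\<omega> j))" for \<omega>
    unfolding block_info_def sum_subtractf[symmetric] by (rule sum.cong) (simp_all add: mean dev_def)
  then have "{\<omega> \<in> space block_law. (\<Sum>j\<in>{1..N2}. log 2 (real (card (alphabet j))) - info_loss (alphabet j) (interf j) h (\<omega> j)) \<le> block_info - x}
      = {\<omega> \<in> space block_law. x \<le> (\<Sum>j\<in>{1..N2}. dev j (\<omega> j))}" by auto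
  moreover have "real M * 2 powr - (block_info - x) \<le> 1 / sqrt (real N2)"
  proof -
    have "real M * 2 powr - (block_info - x) \<le> 2 powr e * 2 powr - (block_info - x)"
      using M_le by (intro mult_right_mono) auto
    also have "\<dots> = 2 powr - (log 2 (real N2) / 2)"
      by (simp add: e_def powr_add[symmetric])
    also have "\<dots> = inverse ((2 powr log 2 (real N2)) powr (1/2))"
      by (simp add: powr_powr powr_minus)
    also have "\<dots> = 1 / sqrt (real N2)"
      using N2 by (simp add: powr_log_cancel powr_half_sqrt inverse_eq_divide)
    finally show ?thesis .
  qed
  ultimately have "\<exists>enc dec. is_code X21 X22 N1 N2 M enc dec \<and> error_prob h X1 N1 N2 M enc dec \<le> \<epsilon>"
    using tail by (intro achievable[OF M1, where \<theta>="block_info - x"]) simp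
  with M1 rate show ?thesis unfolding e_def by blast
qed

end

text \<open>The cost of the two corrections to \<open>sqrt V * q\<close>: variance enlarged by
  \<open>t\<close>, quantile shifted by \<open>r / sqrt V\<close>. For \<open>V \<ge> 1\<close> one
  has \<open>sqrt (V + t) \<le> sqrt V + t\<close>, so for \<open>t\<close> of order log N2 the cost
  is of that order, uniformly in \<open>V\<close>. The absolute value covers negative
  quantiles.\<close>

lemma smoothed_quantile_bound:
  fixes V t q r :: real
  assumes "1 \<le> V" "0 \<le> t" "0 \<le> r"
  shows "sqrt (V + t) * (q + r / sqrt V) \<le> sqrt V * q + t * \<bar>q\<bar> + r * (1 + t)"
proof -
  have V: "1 \<le> sqrt V" using assms by simp
  have "V + t \<le> (sqrt V + t)\<^sup>2"
  proof -
    have "t * 1 \<le> t * sqrt V" using V assms by (intro mult_left_mono) auto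
    moreover have "(sqrt V + t)\<^sup>2 = V + 2 * (t * sqrt V) + t\<^sup>2"
      using assms by (simp add: power2_sum)
    ultimately show ?thesis using assms zero_le_power2[of t] by linarith
  qed
  then have le: "sqrt (V + t) \<le> sqrt V + t"
    using assms by (intro real_le_lsqrt) auto
  have ge: "sqrt V \<le> sqrt (V + t)" using assms by simp
  have "(sqrt (V + t) - sqrt V) * q \<le> \<bar>sqrt (V + t) - sqrt V\<bar> * \<bar>q\<bar>"
    by (metis abs_ge_self abs_mult)
  also have "\<dots> \<le> t * \<bar>q\<bar>" using le ge by (intro mult_right_mono) auto
  finally have 1: "(sqrt (V + t) - sqrt V) * q \<le> t * \<bar>q\<bar>" .
  have "sqrt (V + t) / sqrt V \<le> (sqrt V + t) / sqrt V"
    using le V by (intro divide_right_mono) auto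
  also have "\<dots> = 1 + t / sqrt V" using V by (simp add: add_divide_distrib)
  also have "\<dots> \<le> 1 + t / 1" using V assms by (intro add_left_mono divide_left_mono) auto
  finally have "r * (sqrt (V + t) / sqrt V) \<le> r * (1 + t)" using assms by (intro mult_left_mono) auto
  with 1 show ?thesis by (simp add: algebra_simps)
qed

lemma third_moment_info_loss:
  assumes "finite A" "A \<noteq> {}" "finite B" "B \<noteq> {}"
  shows "\<exists>K\<ge>0. (\<integral>w. \<bar>info_loss A B h w - (\<integral>w. info_loss A B h w \<partial>law_int A B)\<bar> ^ 3 \<partial>law_int A B)
    \<le> K * V_int A B h"
  using prob_space.third_moment_le_variance[OF prob_space_law_int info_loss_measurable integrable_info_loss_third[OF assms]]
  unfolding V_int_def info_loss_def .

text \<open>Both the smoothing variance \<open>\<tau>\<^sup>2\<close> and the shift \<open>s\<close> of the threshold may be of order \<open>ln N2\<close>,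
  which makes every error term of \<open>dev_upper_tail\<close> \<open>O(1 / sqrt block_var)\<close>.\<close>
lemma (in block_channel) dev_tail_log:
  assumes N2: "3 \<le> N2"
    and third: "\<And>j. j \<in> {1..N2} \<Longrightarrow> (\<integral>w. \<bar>dev j w\<bar> ^ 3 \<partial>letter_law j) \<le> K * V_int (alphabet j) (interf j) h"
    and v: "\<And>j. j \<in> {1..N2} \<Longrightarrow> V_int (alphabet j) (interf j) h \<le> w"
    and V: "0 < block_var" and K: "0 \<le> K" and w: "0 \<le> w" and T: "0 < T" "K * T \<le> 1" "w * T\<^sup>2 \<le> 2"
  shows "block.prob {\<omega> \<in> space block_law. y + 2 * ln (real N2) / T \<le> (\<Sum>j\<in>{1..N2}. dev j (\<omega> j))} + 1 / sqrt (real N2)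
    \<le> Q_fun (y / sqrt (block_var + 2 * ln (real N2) / T\<^sup>2))
      + (6 * (K + w * T) * sqrt (6 * pi) / pi + (2 * sqrt (2 * pi) / pi + sqrt 2 + 1) * sqrt w) / sqrt block_var"
proof -
  define L where "L = ln (real N2)"
  have L: "1 \<le> L"
  proof -
    have "exp 1 \<le> real N2" using exp_le N2 by linarith
    then show ?thesis unfolding L_def using N2 by (subst ln_ge_iff) auto
  qed
  \<comment> \<open>The scales are tuned to the exponents of \<open>dev_upper_tail\<close>: both
    \<open>\<tau>\<^sup>2 * T\<^sup>2 / 4\<close> and \<open>(s / \<tau>)\<^sup>2 / 4\<close> become
    \<open>L / 2\<close>, so both exponentials equal \<open>1 / sqrt (real N2)\<close>.\<close>
  define \<tau> where "\<tau> = sqrt (2 * L) / T"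
  define s where "s = 2 * L / T"
  have \<tau>: "0 < \<tau>" and s: "0 \<le> s" using L T by (auto simp: \<tau>_def s_def)
  have \<tau>2: "\<tau>\<^sup>2 = 2 * L / T\<^sup>2" using L by (simp add: \<tau>_def power_divide)
  have e: "exp (- (L / 2)) = 1 / sqrt (real N2)"
  proof -
    have "exp (- (L / 2)) = inverse (exp (ln (real N2)) powr (1/2))"
      by (simp add: L_def exp_minus powr_def)
    also have "\<dots> = 1 / sqrt (real N2)" using N2 by (simp add: powr_half_sqrt inverse_eq_divide)
    finally show ?thesis .
  qed
  have 1: "- \<tau>\<^sup>2 * T\<^sup>2 / 4 = - (L / 2)" using T by (simp add: \<tau>2)
  have "s / \<tau> = sqrt (2 * L)"
    using T L by (simp add: s_def \<tau>_def field_simps)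
  then have 2: "- (s / \<tau>)\<^sup>2 / 4 = - (L / 2)" using L by simp
  \<comment> \<open>Here \<open>1 \<le> L\<close>, the reason for \<open>3 \<le> N2\<close>, removes
    \<open>L\<close> from the denominator.\<close>
  have 3: "sqrt (pi / (\<tau>\<^sup>2 / 4)) \<le> T * sqrt (2 * pi)"
  proof -
    have "pi / (\<tau>\<^sup>2 / 4) = 2 * pi * T\<^sup>2 / L" using T L by (simp add: \<tau>2 field_simps)
    also have "\<dots> \<le> 2 * pi * T\<^sup>2 / 1" using L by (intro divide_left_mono) auto
    finally have "sqrt (pi / (\<tau>\<^sup>2 / 4)) \<le> sqrt (2 * pi * T\<^sup>2)" by simp
    also have "\<dots> = T * sqrt (2 * pi)" using T by (simp add: real_sqrt_mult)
    finally show ?thesis .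
  qed
  have "2 / T * (1 / sqrt (real N2)) * sqrt (pi / (\<tau>\<^sup>2 / 4)) \<le> 2 / T * (1 / sqrt (real N2)) * (T * sqrt (2 * pi))"
    using 3 T by (intro mult_left_mono) auto
  also have "\<dots> = 2 * sqrt (2 * pi) * (1 / sqrt (real N2))" using T by simp
  finally have 4: "2 / T * (1 / sqrt (real N2)) * sqrt (pi / (\<tau>\<^sup>2 / 4)) \<le> 2 * sqrt (2 * pi) * (1 / sqrt (real N2))" .
  have 5: "sqrt (pi / (block_var / 6)) = sqrt (6 * pi) / sqrt block_var"
    by (simp add: real_sqrt_divide[symmetric] field_simps)
  \<comment> \<open>The block variance is at most \<open>w * N2\<close>, so errors of order
    \<open>1 / sqrt N2\<close> are also of order \<open>1 / sqrt block_var\<close>, the scale that a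
    shift of the quantile can repay.\<close>
  have 6: "1 / sqrt (real N2) \<le> sqrt w / sqrt block_var"
  proof -
    have "block_var \<le> (\<Sum>j\<in>{1..N2}. w)" unfolding block_var_def by (intro sum_mono v)
    then have "sqrt block_var \<le> sqrt w * sqrt (real N2)"
      unfolding real_sqrt_mult[symmetric] by (simp add: mult.commute)
    then show ?thesis using V N2 by (simp add: field_simps)
  qed
  have "block.prob {\<omega> \<in> space block_law. y + s \<le> (\<Sum>j\<in>{1..N2}. dev j (\<omega> j))}
    \<le> Q_fun (y / sqrt (block_var + \<tau>\<^sup>2))
      + (6 * (K + w * T) * sqrt (pi / (block_var / 6)) + 2 / T * exp (- \<tau>\<^sup>2 * T\<^sup>2 / 4) * sqrt (pi / (\<tau>\<^sup>2 / 4))) / pi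
      + sqrt 2 * exp (- (s / \<tau>)\<^sup>2 / 4)"
    using N2 by (intro dev_upper_tail third v V K w T \<tau> s) auto
  also have "\<dots> \<le> Q_fun (y / sqrt (block_var + \<tau>\<^sup>2))
      + (6 * (K + w * T) * (sqrt (6 * pi) / sqrt block_var) + 2 * sqrt (2 * pi) * (1 / sqrt (real N2))) / pi
      + sqrt 2 * (1 / sqrt (real N2))"
    unfolding 1 2 5 e using 4 by (intro add_mono divide_right_mono order_refl) auto
  finally have "block.prob {\<omega> \<in> space block_law. y + s \<le> (\<Sum>j\<in>{1..N2}. dev j (\<omega> j))} + 1 / sqrt (real N2)
    \<le> Q_fun (y / sqrt (block_var + \<tau>\<^sup>2)) + 6 * (K + w * T) * sqrt (6 * pi) / pi / sqrt block_var
      + (2 * sqrt (2 * pi) / pi + sqrt 2 + 1) * (1 / sqrt (real N2))"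
    by (simp add: add_divide_distrib distrib_right mult_ac)
  also have "\<dots> \<le> Q_fun (y / sqrt (block_var + \<tau>\<^sup>2)) + 6 * (K + w * T) * sqrt (6 * pi) / pi / sqrt block_var
      + (2 * sqrt (2 * pi) / pi + sqrt 2 + 1) * (sqrt w / sqrt block_var)"
    using 6 by (intro add_left_mono mult_left_mono) auto
  finally show ?thesis
    unfolding \<tau>2 s_def L_def by (simp add: add_divide_distrib)
qed

lemma second_order_achievability:
  assumes X1: "finite X1" "X1 \<noteq> {}" and X21: "finite X21" "X21 \<noteq> {}" and X22: "finite X22" "X22 \<noteq> {}"
    and \<epsilon>: "0 < \<epsilon>" "\<epsilon> < 1"
  shows "\<exists>C>0. \<exists>n0\<ge>2. \<forall>N2\<ge>n0. \<forall>N1\<in>{1..N2}. \<exists>M\<ge>1.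
    real N1 * I_int X21 X1 h + (real N2 - real N1) * I_free X22 h
      - sqrt (real N1 * V_int X21 X1 h + (real N2 - real N1) * V_free X22 h) * Q_inv \<epsilon> - C * log 2 (real N2)
      \<le> log 2 (real M) \<and>
    (\<exists>enc dec. is_code X21 X22 N1 N2 M enc dec \<and> error_prob h X1 N1 N2 M enc dec \<le> \<epsilon>)"
proof -
  have Z: "finite {0::complex}" "{0::complex} \<noteq> {}" by auto
  obtain K1 K2 where K1: "0 \<le> K1"
      "(\<integral>w. \<bar>info_loss X21 X1 h w - (\<integral>w. info_loss X21 X1 h w \<partial>law_int X21 X1)\<bar> ^ 3 \<partial>law_int X21 X1) \<le> K1 * V_int X21 X1 h"
    and K2: "0 \<le> K2"
      "(\<integral>w. \<bar>info_loss X22 {0} h w - (\<integral>w. info_loss X22 {0} h w \<partial>law_int X22 {0})\<bar> ^ 3 \<partial>law_int X22 {0}) \<le> K2 * V_int X22 {0} h"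
    using third_moment_info_loss[OF X21 X1, of h] third_moment_info_loss[OF X22 Z, of h] by blast
  have v0: "0 \<le> V_int A B h" for A B
    unfolding V_int_def by (rule Bochner_Integration.integral_nonneg) simp
  define K where "K = max K1 K2"
  define w where "w = max (V_int X21 X1 h) (V_int X22 {0} h)"
  \<comment> \<open>One frequency cut-off for all block lengths, small enough for
    \<open>K * T \<le> 1\<close> and \<open>w * T\<^sup>2 \<le> 2\<close> at once.\<close>
  define T where "T = 1 / (1 + K + w)"
  have K: "0 \<le> K" and w: "0 \<le> w" using K1 v0 by (auto simp: K_def w_def le_max_iff_disj)
  have T: "0 < T" "K * T \<le> 1" "w * T\<^sup>2 \<le> 2"
  proof -
    show T0: "0 < T" "K * T \<le> 1" using K w by (auto simp: T_def)
    have "T \<le> 1" "w * T \<le> 1" using K w by (auto simp: T_def)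
    then have "w * T * T \<le> 1 * 1" using T0 w by (intro mult_mono) auto
    then show "w * T\<^sup>2 \<le> 2" by (simp add: power2_eq_square)
  qed
  define q where "q = Q_inv \<epsilon>"
  have q: "Q_fun q = \<epsilon>" unfolding q_def using \<epsilon> by (rule Q_fun_Q_inv)
  obtain c where c: "0 < c" "\<And>a. 0 \<le> a \<Longrightarrow> a \<le> 1 \<Longrightarrow> Q_fun (q + a) \<le> Q_fun q - c * a"
    using Q_fun_decrease[of q] by blast
  define b where "b = 6 * (K + w * T) * sqrt (6 * pi) / pi + (2 * sqrt (2 * pi) / pi + sqrt 2 + 1) * sqrt w"
  have b: "0 \<le> b" using K w T by (simp add: b_def)
  \<comment> \<open>The total error in \<open>dev_tail_log\<close> is
    \<open>b / sqrt block_var\<close>; shifting the quantile by \<open>r / sqrt block_var\<close>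
    lowers the Gaussian tail by \<open>c\<close> times the shift, which is exactly that
    amount.\<close>
  define r where "r = b / c"
  have r: "0 \<le> r" using b c by (simp add: r_def)
  \<comment> \<open>The border between large and bounded variance. From \<open>V0\<close> on,
    \<open>r / sqrt block_var \<le> 1\<close>, the range of \<open>Q_fun_decrease\<close>, and the
    variance is at least 1, as \<open>smoothed_quantile_bound\<close> requires.\<close>
  define V0 where "V0 = 1 + r\<^sup>2"
  \<comment> \<open>Chosen so that Chebyshev's inequality gives \<open>\<epsilon> / 2\<close> below
    variance \<open>V0\<close>.\<close>
  define t where "t = sqrt (2 * V0 / \<epsilon>)"
  have V0: "1 \<le> V0" by (simp add: V0_def)
  have t: "0 < t" "t\<^sup>2 = 2 * V0 / \<epsilon>" using V0 \<epsilon> by (auto simp: t_def)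
  \<comment> \<open>The first entry covers the large-variance case, the second the bounded one;
    there \<open>sqrt block_var * q\<close> is itself bounded and is simply absorbed.\<close>
  define C where "C = max (2 / T\<^sup>2 * \<bar>q\<bar> + r * (1 + 2 / T\<^sup>2) + 2 / T + 2) (t + sqrt V0 * \<bar>q\<bar> + 2)"
  have C: "0 < C" unfolding C_def using t V0 by (simp add: less_max_iff_disj add_nonneg_pos)
  \<comment> \<open>The 3 ensures \<open>ln N2 \<ge> 1\<close>; the other entry makes
    \<open>1 / sqrt N2\<close> at most \<open>\<epsilon> / 2\<close>, the half left over by
    Chebyshev's inequality.\<close>
  define n0 where "n0 = max 3 (nat \<lceil>4 / \<epsilon>\<^sup>2\<rceil>)"
  have main: "\<exists>M\<ge>1.
    real N1 * I_int X21 X1 h + (real N2 - real N1) * I_free X22 h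
      - sqrt (real N1 * V_int X21 X1 h + (real N2 - real N1) * V_free X22 h) * q - C * log 2 (real N2)
      \<le> log 2 (real M) \<and>
    (\<exists>enc dec. is_code X21 X22 N1 N2 M enc dec \<and> error_prob h X1 N1 N2 M enc dec \<le> \<epsilon>)"
    if n: "n0 \<le> N2" "N1 \<in> {1..N2}" for N1 N2
  proof -
    interpret block_channel h X1 X21 X22 N1 N2
      using X1 X21 X22 n by unfold_locales auto
    have N2: "3 \<le> N2" using n by (simp add: n0_def)
    have info: "block_info = real N1 * I_int X21 X1 h + (real N2 - real N1) * I_free X22 h"
      unfolding block_info_def I_free_eq_I_int[OF X22] by (rule block_split)
    have var: "block_var = real N1 * V_int X21 X1 h + (real N2 - real N1) * V_free X22 h"
      unfolding block_var_def V_free_eq_V_int[OF X22] by (rule block_split)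
    have third: "(\<integral>w. \<bar>dev j w\<bar> ^ 3 \<partial>letter_law j) \<le> K * V_int (alphabet j) (interf j) h" for j
    proof (cases "j \<le> N1")
      case True
      then have "(\<integral>w. \<bar>dev j w\<bar> ^ 3 \<partial>letter_law j) \<le> K1 * V_int (alphabet j) (interf j) h"
        using K1(2) by (simp add: dev_def letter_law_def alphabet_def interf_def)
      also have "\<dots> \<le> K * V_int (alphabet j) (interf j) h" by (intro mult_right_mono v0) (simp add: K_def)
      finally show ?thesis .
    next
      case False
      then have "(\<integral>w. \<bar>dev j w\<bar> ^ 3 \<partial>letter_law j) \<le> K2 * V_int (alphabet j) (interf j) h"
        using K2(2) by (simp add: dev_def letter_law_def alphabet_def interf_def)
      also have "\<dots> \<le> K * V_int (alphabet j) (interf j) h" by (intro mult_right_mono v0) (simp add: K_def)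
      finally show ?thesis .
    qed
    have v: "V_int (alphabet j) (interf j) h \<le> w" for j by (simp add: alphabet_def interf_def w_def)
    have var0: "0 \<le> block_var" unfolding block_var_def by (intro sum_nonneg v0)
    define L where "L = ln (real N2)"
    define lb where "lb = log 2 (real N2)"
    have "1 \<le> L"
    proof -
      have "exp 1 \<le> real N2" using exp_le N2 by linarith
      then show ?thesis unfolding L_def using N2 by (subst ln_ge_iff) auto
    qed
    moreover have "L \<le> lb"
    proof -
      have "L * 1 \<le> L / ln 2" using \<open>1 \<le> L\<close> ln_2_less_1 by (simp add: field_simps)
      then show ?thesis by (simp add: lb_def log_def L_def)
    qed
    ultimately have L: "1 \<le> L" "L \<le> lb" "1 \<le> lb" by auto
    have "\<exists>x. block.prob {\<omega> \<in> space block_law. x \<le> (\<Sum>j\<in>{1..N2}. dev j (\<omega> j))} + 1 / sqrt (real N2) \<le> \<epsilon>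
      \<and> x + lb / 2 + 1 \<le> sqrt block_var * q + C * lb"
    proof (cases "V0 \<le> block_var")
      case True
      then have V: "1 \<le> block_var" using V0 by linarith
      \<comment> \<open>Scaling by the smoothed deviation makes the normalised argument in
        \<open>dev_tail_log\<close> exactly the shifted quantile.\<close>
      define y where "y = sqrt (block_var + 2 * L / T\<^sup>2) * (q + r / sqrt block_var)"
      have "r \<le> sqrt block_var"
        using True r by (intro real_le_rsqrt) (simp add: V0_def)
      then have a: "0 \<le> r / sqrt block_var" "r / sqrt block_var \<le> 1" using V r by auto
      have "block_var + 2 * L / T\<^sup>2 > 0" using V L by (intro add_pos_nonneg) auto
      then have yq: "y / sqrt (block_var + 2 * L / T\<^sup>2) = q + r / sqrt block_var" by (simp add: y_def)
      have "block.prob {\<omega> \<in> space block_law. y + 2 * L / T \<le> (\<Sum>j\<in>{1..N2}. dev j (\<omega> j))} + 1 / sqrt (real N2)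
          \<le> Q_fun (q + r / sqrt block_var) + b / sqrt block_var"
        using dev_tail_log[OF N2 third v _ K w T, of y] V unfolding L_def[symmetric] yq b_def by simp
      also have "\<dots> \<le> \<epsilon> - c * (r / sqrt block_var) + b / sqrt block_var"
        using c(2)[OF a] q by simp
      also have "\<dots> = \<epsilon>" using c by (simp add: r_def)
      finally have tail: "block.prob {\<omega> \<in> space block_law. y + 2 * L / T \<le> (\<Sum>j\<in>{1..N2}. dev j (\<omega> j))} + 1 / sqrt (real N2) \<le> \<epsilon>" .
      have "y + 2 * L / T + lb / 2 + 1 \<le> sqrt block_var * q
          + (2 * L / T\<^sup>2 * \<bar>q\<bar> + r * (1 + 2 * L / T\<^sup>2) + 2 * L / T + lb / 2 + 1)"
        using smoothed_quantile_bound[of block_var "2 * L / T\<^sup>2" r q] V L r unfolding y_def by simp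
      \<comment> \<open>Each term becomes a multiple of \<open>lb\<close>, through
        \<open>L \<le> lb\<close> and \<open>1 \<le> lb\<close>.\<close>
      also have "2 * L / T\<^sup>2 * \<bar>q\<bar> + r * (1 + 2 * L / T\<^sup>2) + 2 * L / T + lb / 2 + 1
          \<le> 2 * lb / T\<^sup>2 * \<bar>q\<bar> + r * (lb + 2 * lb / T\<^sup>2) + 2 * lb / T + lb / 2 + lb"
        using L r T by (intro add_mono mult_right_mono mult_left_mono divide_right_mono) auto
      also have "\<dots> \<le> (2 / T\<^sup>2 * \<bar>q\<bar> + r * (1 + 2 / T\<^sup>2) + 2 / T + 2) * lb"
        using L by (simp add: algebra_simps)
      also have "\<dots> \<le> C * lb" using L by (intro mult_right_mono) (auto simp: C_def)
      finally show ?thesis using tail by (intro exI[of _ "y + 2 * L / T"]) auto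
    next
      case False
      have "block.prob {\<omega> \<in> space block_law. t \<le> (\<Sum>j\<in>{1..N2}. dev j (\<omega> j))} \<le> block_var / t\<^sup>2"
        using N2 t by (intro dev_chebyshev) auto
      also have "\<dots> \<le> V0 / t\<^sup>2" using False by (intro divide_right_mono) auto
      also have "\<dots> = \<epsilon> / 2" using V0 \<epsilon> by (simp add: t)
      finally have cheb: "block.prob {\<omega> \<in> space block_law. t \<le> (\<Sum>j\<in>{1..N2}. dev j (\<omega> j))} \<le> \<epsilon> / 2" .
      have "1 / sqrt (real N2) \<le> \<epsilon> / 2"
      proof -
        have "4 / \<epsilon>\<^sup>2 \<le> real N2" using n(1) unfolding n0_def by linarith
        then have "sqrt (4 / \<epsilon>\<^sup>2) \<le> sqrt (real N2)" by simp
        then have "2 / \<epsilon> \<le> sqrt (real N2)" using \<epsilon> by (simp add: real_sqrt_divide)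
        then show ?thesis using \<epsilon> N2 by (simp add: field_simps)
      qed
      moreover have "t + lb / 2 + 1 \<le> sqrt block_var * q + C * lb"
      proof -
        \<comment> \<open>The quantile is negative for large \<open>\<epsilon>\<close>; then the
          rate to be reached exceeds the mean, but by a bounded amount only.\<close>
        have "- (sqrt block_var * q) \<le> sqrt V0 * \<bar>q\<bar>"
        proof -
          have "- (sqrt block_var * q) \<le> sqrt block_var * \<bar>q\<bar>"
            using mult_left_mono[of "- q" "\<bar>q\<bar>" "sqrt block_var"] var0 by simp
          also have "\<dots> \<le> sqrt V0 * \<bar>q\<bar>" using False by (intro mult_right_mono) auto
          finally show ?thesis .
        qed
        moreover have "(t + sqrt V0 * \<bar>q\<bar>) * 1 \<le> (t + sqrt V0 * \<bar>q\<bar>) * lb"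
          using L t V0 by (intro mult_left_mono) auto
        moreover have "(t + sqrt V0 * \<bar>q\<bar> + 2) * lb \<le> C * lb"
          using L by (intro mult_right_mono) (auto simp: C_def)
        ultimately show ?thesis using L by (simp add: distrib_right)
      qed
      ultimately show ?thesis using cheb by (intro exI[of _ t]) auto
    qed
    then obtain x where x: "block.prob {\<omega> \<in> space block_law. x \<le> (\<Sum>j\<in>{1..N2}. dev j (\<omega> j))} + 1 / sqrt (real N2) \<le> \<epsilon>"
      "x + lb / 2 + 1 \<le> sqrt block_var * q + C * lb" by blast
    obtain M where M: "1 \<le> M" "block_info - x - lb / 2 - 1 \<le> log 2 (real M)"
      "\<exists>enc dec. is_code X21 X22 N1 N2 M enc dec \<and> error_prob h X1 N1 N2 M enc dec \<le> \<epsilon>"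
      using code_of_tail[OF _ x(1)] N2 unfolding lb_def by auto
    have "block_info - sqrt block_var * q - C * lb \<le> log 2 (real M)" using M(2) x(2) by linarith
    with M show ?thesis unfolding info var lb_def by blast
  qed
  show ?thesis
    by (rule exI[of _ C], rule conjI[OF C], rule exI[of _ n0]) (use main in \<open>auto simp: n0_def q_def\<close>)
qed

lemma scaled_qam: "finite (scaled r (qam m))" "scaled r (qam m) \<noteq> {}"
proof -
  have pam: "finite (pam k)" for k by (simp add: pam_def)
  have "qam m = (\<lambda>(a, b). Complex a b) ` (pam (2 ^ (m div 2)) \<times> pam (2 ^ (m div 2)))"
    by (auto simp: qam_def)
  moreover have "pam (2 ^ (m div 2)) \<noteq> {}" by (simp add: pam_def lessThan_empty_iff)
  ultimately show "finite (scaled r (qam m))" "scaled r (qam m) \<noteq> {}"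
    using pam by (auto simp: scaled_def)
qed

theorem proposition2:
  fixes h1 h2 :: complex
    and m1 m21 m22 :: nat
    and S P22 eps2 :: real
    and X1 X21 X22 :: "complex set"
  assumes "h1 \<noteq> 0" and "h2 \<noteq> 0" and "cmod h1 \<noteq> cmod h2"
    and "even m1" and "even m21" and "even m22" and "m1 + m21 > 0"
    and "S > 0" and "P22 > 0"
    and "X1 = const_1 h1 h2 m1 m21 S"
    and "X21 = const_21 h1 h2 m1 m21 S"
    and "X22 = const_22 m22 P22"
    and "0 < eps2" and "eps2 < 1"
  shows "\<exists>C>0. \<exists>n0\<ge>2. \<forall>N2\<ge>n0. \<forall>N1\<in>{1..N2}. \<exists>M2::nat. M2 \<ge> 1 \<and>
    log 2 (real M2) / real N2 \<ge>
      real N1 / real N2 * I_int X21 X1 h2 + (real N2 - real N1) / real N2 * I_free X22 h2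
      - sqrt (real N1 * V_int X21 X1 h2 + (real N2 - real N1) * V_free X22 h2) / real N2 * Q_inv eps2
      - C * (log 2 (real N2) / real N2) \<and>
    (\<exists>enc dec. is_code X21 X22 N1 N2 M2 enc dec \<and> error_prob h2 X1 N1 N2 M2 enc dec \<le> eps2)"
proof -
  have X: "finite X1" "X1 \<noteq> {}" "finite X21" "X21 \<noteq> {}" "finite X22" "X22 \<noteq> {}"
    using assms scaled_qam by (auto simp: const_1_def const_21_def const_22_def)
  obtain C and n0 :: nat where C: "0 < C" and n0: "2 \<le> n0" and main: "\<And>N1 N2. n0 \<le> N2 \<Longrightarrow> N1 \<in> {1..N2} \<Longrightarrow> \<exists>M\<ge>1.
    real N1 * I_int X21 X1 h2 + (real N2 - real N1) * I_free X22 h2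
      - sqrt (real N1 * V_int X21 X1 h2 + (real N2 - real N1) * V_free X22 h2) * Q_inv eps2 - C * log 2 (real N2)
      \<le> log 2 (real M) \<and>
    (\<exists>enc dec. is_code X21 X22 N1 N2 M enc dec \<and> error_prob h2 X1 N1 N2 M enc dec \<le> eps2)"
    using second_order_achievability[OF X \<open>0 < eps2\<close> \<open>eps2 < 1\<close>, of h2] by metis
  show ?thesis
  proof (rule exI[of _ C], intro conjI C, rule exI[of _ n0], intro conjI n0 allI impI ballI)
    fix N1 N2 :: nat assume N: "n0 \<le> N2" "N1 \<in> {1..N2}"
    then obtain M where M: "1 \<le> M"
      "real N1 * I_int X21 X1 h2 + (real N2 - real N1) * I_free X22 h2
      - sqrt (real N1 * V_int X21 X1 h2 + (real N2 - real N1) * V_free X22 h2) * Q_inv eps2 - C * log 2 (real N2)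
      \<le> log 2 (real M)"
      "\<exists>enc dec. is_code X21 X22 N1 N2 M enc dec \<and> error_prob h2 X1 N1 N2 M enc dec \<le> eps2"
      using main by blast
    have "(real N1 * I_int X21 X1 h2 + (real N2 - real N1) * I_free X22 h2
      - sqrt (real N1 * V_int X21 X1 h2 + (real N2 - real N1) * V_free X22 h2) * Q_inv eps2 - C * log 2 (real N2)) / real N2
      \<le> log 2 (real M) / real N2"
      using M(2) by (intro divide_right_mono) auto
    \<comment> \<open>An identity in free real variables, valid for \<open>u = 0\<close> as well, so
      that dividing by the block length raises no side condition.\<close>
    moreover have "(n * i + d * j - s * k - C * l) / u = n / u * i + d / u * j - s / u * k - C * (l / u)"
      for n i d j s k l u :: real
      by (simp add: add_divide_distrib diff_divide_distrib)
    ultimately have "log 2 (real M) / real N2 \<ge>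
      real N1 / real N2 * I_int X21 X1 h2 + (real N2 - real N1) / real N2 * I_free X22 h2
      - sqrt (real N1 * V_int X21 X1 h2 + (real N2 - real N1) * V_free X22 h2) / real N2 * Q_inv eps2
      - C * (log 2 (real N2) / real N2)"
      by (simp only:)
    with M show "\<exists>M2::nat. M2 \<ge> 1 \<and>
    log 2 (real M2) / real N2 \<ge>
      real N1 / real N2 * I_int X21 X1 h2 + (real N2 - real N1) / real N2 * I_free X22 h2
      - sqrt (real N1 * V_int X21 X1 h2 + (real N2 - real N1) * V_free X22 h2) / real N2 * Q_inv eps2
      - C * (log 2 (real N2) / real N2) \<and>
    (\<exists>enc dec. is_code X21 X22 N1 N2 M2 enc dec \<and> error_prob h2 X1 N1 N2 M2 enc dec \<le> eps2)"
      by blast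
  qed
qed

end
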